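(* Assume $(t,u,v,w)\in\mathcal P$ and that $u=v=w$ does not hold. (a) For almost every $x\in X$ (with respect to $\nu$) the operator $M_x(t,u,v,w)$ does not have eigenvalues. In particular, for $\mu$-almost every $\xi\in\partial\mathcal T$ the operator $M_\xi(t,u,v,w)$ does not have eigenvalues. (b) For every $x\in X_1$ the operator $M_x(t,u,v,w)$ does not have eigenvalues.
   Context: **Parameters.** $\mathcal P:=\{(t,u,v,w)\in\mathbb R^4: t\ne 0,\ u+v\ne0,\ u+w\ne0,\ v+w\neq 0\}$. **The group.** $G$ is Grigorchuk's group: the group of automorphisms of the rooted binary tree $\mathcal T$ (vertex set $\{0,1\}^*$) generated by the involutions $a,b,c,d$ given by $a(0w)=1w$, $a(1w)=0w$; $b(0w)=0a(w)$, $b(1w)=1c(w)$; $c(0w)=0a(w)$, $c(1w)=1d(w)$; $d(0w)=0w$, $d(1w)=1b(w)$. It acts by homeomorphisms on the boundary $\partial\mathcal T=\{0,1\}^{\mathbb N}$. $\mu$ is the uniform Bernoulli probability measure on $\partial\mathcal T$. **Schreier graphs and $X$.** For $\xi\in\partial\mathcal T$ the graph $\Gamma_\xi$ has vertex set $G\xi$ and, for each $s\in\{a,b,c,d\}$, an undirected edge labeled $s$ between $p$ and $q$ iff $sp=q$ (loops and multiple edges allowed; each vertex is incident to exactly one edge of each label). $\mathcal G_*$ is the space of isomorphism classes $[(\Gamma,v)]$ of rooted connected graphs with edges labeled in $\{a,b,c,d\}$, with the topology of local convergence (two classes are close if large balls around the roots are isomorphic as rooted labeled graphs). Put $\mathcal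 F(\xi)=[(\Gamma_\xi,\xi)]$ and $X:=\overline{\mathcal F(\partial\mathcal T)}\setminus\{\text{isolated points of }\overline{\mathcal F(\partial\mathcal T)}\}$. $G$ acts on $X$ by changing the root: a generator $s$ sends $[(\Gamma,v)]$ to $[(\Gamma,v')]$, where $v'$ is the other endpoint of the unique edge labeled $s$ at $v$. This action is minimal and uniquely ergodic; $\nu$ is its unique invariant probability measure. **The set $X_1$.** The graph $\Gamma_{1^\infty}$ is one-ended, and its vertex $1^\infty$ carries three loops labeled $b,c,d$. For each of the pairs $\{b,c\},\{b,d\},\{c,d\}$, take two copies of $\Gamma_{1^\infty}$ and, for each of the two labels in the pair, replace the loops with this label at the two copies of $1^\infty$ by one edge with this label joining the two copies of $1^\infty$ (the loop with the third label is kept at each copy). $X_1\subset X$ is the set of isomorphism classes of all rooted graphs obtained from these three two-ended graphs by choosing an arbitrary vertex as root. **Laplacians.** For a graph $\Gamma$ with vertex set $V$ and edges labeled by $a,b,c,d$, the Laplacian $M_\Gamma(t,u,v,w)$ is the selfadjoint operator on $\ell^2(V)$ given by $(M_\Gamma(t,u,v,w)\varphi)(p)=\sum_{e} w(e)\,\varphi(q_e)$, where the sum is over all edges $e$ emanating from $p$, $q_e$ is the other endpoint of $e$ ($q_e=p$ for a loop, which is counted once), and $w(e)=t,u,v,w$ according to whether the label of $e$ is $a,b,c,d$. For $\xi\in\partial\mathcal T$, $M_\xi:=M_{\Gamma_\xi}$. For $x\in X$, $M_x(t,u,v,w)$ denotes $M_{\widehat x}(t,u,v,w)$ for a chosen representative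 $\widehat x$ of the isomorphism class $x$ (unique up to unitary equivalence). *)

theory Defs
  imports "HOL-Probability.Probability" "HOL-Algebra.Bij" "HOL-Algebra.Generated_Groups"
begin

text \<open>
  The letters 0 and 1 are \<open>False\<close> and \<open>True\<close>; vertices of the rooted binary tree are finite
  words, boundary points are infinite sequences.
\<close>

datatype gen = gen_a | gen_b | gen_c | gen_d

fun gen_word :: "gen \<Rightarrow> bool list \<Rightarrow> bool list" where
  "gen_word s [] = []"
| "gen_word gen_a (x # w) = (\<not> x) # w"
| "gen_word gen_b (False # w) = False # gen_word gen_a w"
| "gen_word gen_b (True # w) = True # gen_word gen_c w"
| "gen_word gen_c (False # w) = False # gen_word gen_a w"
| "gen_word gen_c (True # w) = True # gen_word gen_d w"
| "gen_word gen_d (False # w) = False # w"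
| "gen_word gen_d (True # w) = True # gen_word gen_b w"

definition grigorchuk_group :: "(bool list \<Rightarrow> bool list) set" where
  "grigorchuk_group = generate (BijGroup UNIV) (range gen_word)"

text \<open>
  The homeomorphism of the boundary induced by a tree automorphism \<open>g\<close>: the prefixes of the image
  of \<open>\<xi>\<close> are the images of the prefixes of \<open>\<xi>\<close>.
\<close>

definition bdry :: "(bool list \<Rightarrow> bool list) \<Rightarrow> (nat \<Rightarrow> bool) \<Rightarrow> (nat \<Rightarrow> bool)" where
  "bdry g \<xi> = (\<lambda>n. g (map \<xi> [0..<Suc n]) ! n)"

definition orbit :: "(nat \<Rightarrow> bool) \<Rightarrow> (nat \<Rightarrow> bool) set" where
  "orbit \<xi> = {bdry g \<xi> | g. g \<in> grigorchuk_group}"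

definition ones :: "nat \<Rightarrow> bool" where
  "ones = (\<lambda>_. True)"

definition bernoulli_measure :: "(nat \<Rightarrow> bool) measure" where
  "bernoulli_measure = Pi\<^sub>M UNIV (\<lambda>_. measure_pmf (bernoulli_pmf (1/2)))"

text \<open>
  An undirected edge labeled \<open>s\<close> between \<open>p\<close> and \<open>q\<close> is represented by the two triples
  \<open>(s, p, q)\<close> and \<open>(s, q, p)\<close>, a loop at \<open>p\<close> by the single triple \<open>(s, p, p)\<close>. Thus
  the edges emanating from \<open>p\<close> correspond to the triples with middle component \<open>p\<close>, with
  loops counted once. Multiple edges occur with different labels.
\<close>

record 'v lgraph =
  verts :: "'v set"
  edges :: "(gen \<times> 'v \<times> 'v) set"

type_synonym 'v rgraph = "'v lgraph \<times> 'v"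

definition adjacency :: "'v lgraph \<Rightarrow> ('v \<times> 'v) set" where
  "adjacency \<Gamma> = {(p, q). \<exists>s. (s, p, q) \<in> edges \<Gamma>}"

definition emanating :: "'v lgraph \<Rightarrow> 'v \<Rightarrow> (gen \<times> 'v) set" where
  "emanating \<Gamma> p = {(s, q). (s, p, q) \<in> edges \<Gamma>}"

definition rooted_connected_graph :: "'v rgraph \<Rightarrow> bool" where
  "rooted_connected_graph = (\<lambda>(\<Gamma>, x).
     x \<in> verts \<Gamma> \<and>
     edges \<Gamma> \<subseteq> UNIV \<times> verts \<Gamma> \<times> verts \<Gamma> \<and>
     (\<forall>s p q. (s, p, q) \<in> edges \<Gamma> \<longrightarrow> (s, q, p) \<in> edges \<Gamma>) \<and>
     (\<forall>p\<in>verts \<Gamma>. finite (emanating \<Gamma> p)) \<and>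
     (\<forall>p\<in>verts \<Gamma>. \<forall>q\<in>verts \<Gamma>. (p, q) \<in> (adjacency \<Gamma>)\<^sup>*))"

definition rooted_iso :: "'v rgraph \<Rightarrow> 'w rgraph \<Rightarrow> bool" where
  "rooted_iso = (\<lambda>(\<Gamma>, x) (\<Delta>, y).
     \<exists>f. bij_betw f (verts \<Gamma>) (verts \<Delta>) \<and> f x = y \<and>
         (\<forall>s. \<forall>p\<in>verts \<Gamma>. \<forall>q\<in>verts \<Gamma>.
            (s, p, q) \<in> edges \<Gamma> \<longleftrightarrow> (s, f p, f q) \<in> edges \<Delta>))"

definition graph_ball :: "nat \<Rightarrow> 'v rgraph \<Rightarrow> 'v rgraph" where
  "graph_ball n = (\<lambda>(\<Gamma>, x).
     let S = {q \<in> verts \<Gamma>. \<exists>k\<le>n. (x, q) \<in> adjacency \<Gamma> ^^ k}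
     in (\<lparr>verts = S, edges = edges \<Gamma> \<inter> (UNIV \<times> S \<times> S)\<rparr>, x))"

text \<open>
  Connected locally finite graphs are countable, so each isomorphism class has representatives
  whose vertices are natural numbers. An isomorphism class is the set of all these representatives.
\<close>

definition iso_class :: "'v rgraph \<Rightarrow> nat rgraph set" where
  "iso_class R = {R'. rooted_connected_graph R' \<and> rooted_iso R R'}"

definition rep :: "nat rgraph set \<Rightarrow> nat rgraph" where
  "rep x = (SOME R. R \<in> x)"

definition Gstar :: "nat rgraph set set" where
  "Gstar = {iso_class R | R :: nat rgraph. rooted_connected_graph R}"

definition local_nbhd :: "nat \<Rightarrow> nat rgraph set \<Rightarrow> nat rgraph set set" where
  "local_nbhd n x =
     {y \<in> Gstar. \<exists>R\<in>x. \<exists>R'\<in>y. rooted_iso (graph_ball n R) (graph_ball n R')}"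

definition Gstar_topology :: "nat rgraph set topology" where
  "Gstar_topology = topology_generated_by {local_nbhd n x | n x. x \<in> Gstar}"

definition schreier :: "(nat \<Rightarrow> bool) \<Rightarrow> (nat \<Rightarrow> bool) lgraph" where
  "schreier \<xi> = \<lparr>verts = orbit \<xi>,
     edges = {(s, p, q). p \<in> orbit \<xi> \<and> q \<in> orbit \<xi> \<and> bdry (gen_word s) p = q}\<rparr>"

definition schreier_class :: "(nat \<Rightarrow> bool) \<Rightarrow> nat rgraph set" where
  "schreier_class \<xi> = iso_class (schreier \<xi>, \<xi>)"

definition X :: "nat rgraph set set" where
  "X = (let K = Gstar_topology closure_of range schreier_class
        in K - {x \<in> K. openin (subtopology Gstar_topology K) {x}})"

definition move_root :: "gen \<Rightarrow> nat rgraph set \<Rightarrow> nat rgraph set" where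
  "move_root s x = (let (\<Gamma>, p) = rep x in iso_class (\<Gamma>, THE q. (s, p, q) \<in> edges \<Gamma>))"

definition X_borel :: "nat rgraph set measure" where
  "X_borel = sigma X {U. openin (subtopology Gstar_topology X) U}"

text \<open>
  Borel probability measures on \<open>X\<close> invariant under the group. Since the group acts through its
  generators, invariance under these suffices.
\<close>

definition invariant_probability :: "nat rgraph set measure \<Rightarrow> bool" where
  "invariant_probability \<nu> \<longleftrightarrow> prob_space \<nu> \<and> space \<nu> = X \<and> sets \<nu> = sets X_borel \<and>
     (\<forall>s. move_root s \<in> measurable \<nu> \<nu> \<and> distr \<nu> \<nu> (move_root s) = \<nu>)"

text \<open>
  Two copies of the Schreier graph of \<open>ones\<close>, indexed by \<open>bool\<close>: for labels in \<open>J\<close> the loops at the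
  two copies of \<open>ones\<close> are replaced by one edge joining these copies.
\<close>

definition doubled :: "gen set \<Rightarrow> ((nat \<Rightarrow> bool) \<times> bool) lgraph" where
  "doubled J = \<lparr>verts = orbit ones \<times> UNIV,
     edges = {(s, (p, i), (q, i)) | s p q i.
                (s, p, q) \<in> edges (schreier ones) \<and> \<not> (s \<in> J \<and> p = ones \<and> q = ones)}
           \<union> {(s, (ones, i), (ones, \<not> i)) | s i. s \<in> J}\<rparr>"

definition X1 :: "nat rgraph set set" where
  "X1 = {iso_class (doubled J, p) | J p.
           J \<in> {{gen_b, gen_c}, {gen_b, gen_d}, {gen_c, gen_d}} \<and> p \<in> verts (doubled J)}"

definition params :: "(real \<times> real \<times> real \<times> real) set" where
  "params = {(t, u, v, w). t \<noteq> 0 \<and> u + v \<noteq> 0 \<and> u + w \<noteq> 0 \<and> v + w \<noteq> 0}"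

fun weight :: "real \<Rightarrow> real \<Rightarrow> real \<Rightarrow> real \<Rightarrow> gen \<Rightarrow> real" where
  "weight t u v w gen_a = t"
| "weight t u v w gen_b = u"
| "weight t u v w gen_c = v"
| "weight t u v w gen_d = w"

text \<open>Functions on \<open>V\<close> are extended by 0 to the whole type.\<close>

definition ell2 :: "'v set \<Rightarrow> ('v \<Rightarrow> complex) set" where
  "ell2 V = {\<phi>. (\<forall>p. p \<notin> V \<longrightarrow> \<phi> p = 0) \<and> (\<lambda>p. (cmod (\<phi> p))\<^sup>2) summable_on V}"

definition laplacian ::
  "'v lgraph \<Rightarrow> real \<Rightarrow> real \<Rightarrow> real \<Rightarrow> real \<Rightarrow> ('v \<Rightarrow> complex) \<Rightarrow> ('v \<Rightarrow> complex)" where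
  "laplacian \<Gamma> t u v w \<phi> =
     (\<lambda>p. if p \<in> verts \<Gamma>
          then \<Sum>(s, q)\<in>emanating \<Gamma> p. complex_of_real (weight t u v w s) * \<phi> q
          else 0)"

definition has_eigenvalues :: "'v set \<Rightarrow> (('v \<Rightarrow> complex) \<Rightarrow> ('v \<Rightarrow> complex)) \<Rightarrow> bool" where
  "has_eigenvalues V T \<longleftrightarrow>
     (\<exists>l :: complex. \<exists>\<phi>\<in>ell2 V. \<phi> \<noteq> (\<lambda>_. 0) \<and> T \<phi> = (\<lambda>p. l * \<phi> p))"

definition laplacian_has_eigenvalues ::
  "'v lgraph \<Rightarrow> real \<Rightarrow> real \<Rightarrow> real \<Rightarrow> real \<Rightarrow> bool" where
  "laplacian_has_eigenvalues \<Gamma> t u v w \<longleftrightarrow>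
     has_eigenvalues (verts \<Gamma>) (laplacian \<Gamma> t u v w)"

end

theory Submission
  imports Defs "HOL-Computational_Algebra.Squarefree"
begin

text \<open>
  Along a Schreier graph the letters of the boundary points form a binary Gray code: edges labeled
  \<open>a\<close> alternate with double edges whose type (the missing label) at the edge between the positions
  \<open>j\<close> and \<open>j + 1\<close> depends on the 2-adic valuation of \<open>j + 1\<close> modulo 3. The eigenvalue equation is
  therefore a second order recurrence with nonvanishing off-diagonal coefficients. If the letters of
  \<open>\<xi>\<close> at \<open>n, \<dots>, n + 3\<close> are \<open>1, 1, 0, 1\<close>, then around \<open>\<xi>\<close> four blocks of length \<open>2 ^ n\<close> are
  joined by three edges of the same type, because the valuations \<open>n\<close> and \<open>n + 3\<close> agree modulo 3.
  So the coefficients are periodic there, and Gordon's three-block argument bounds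
  \<open>\<bar>\<phi> \<xi>\<bar>\<close> by two values of \<open>\<phi>\<close> at distance at least \<open>2 ^ n\<close>. If this happens for infinitely many
  \<open>n\<close>, every square summable eigenfunction vanishes at \<open>\<xi>\<close>. Almost every sequence contains the
  pattern infinitely often. In the graphs of \<open>X1\<close> the same periodicity occurs around the join of
  the two copies for every \<open>n\<close> in a residue class modulo 3. For an invariant measure \<open>\<nu>\<close> on \<open>X\<close>,
  words of the group that move exactly the points of one cylinder show that the letters of \<open>\<xi>\<close> can
  be read off from balls; this gives an equivariant map from \<open>X\<close> to the boundary, and
  transitivity on the levels of the tree forces the image of \<open>\<nu>\<close> to be the Bernoulli measure.
\<close>

section \<open>The action on the boundary\<close>

text \<open>Counted in blocks of length \<open>2 ^ n\<close>, the pattern says that the point lies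
  in block 7: Gray letters record agreement of neighbouring digits, and 7 has the digits 1, 1, 1, 0,
  0. The joints 7, 8 and 9 have valuations n, n + 3 and n, whereas 6 and 10 have valuation n + 1. So
  the four blocks from 6 to 10 are the longest stretch around joint 8 whose joints have equal types,
  and Gordon's argument has to fit into it: from a point left of the centre it looks one period to
  the left and one or two periods to the right, and it is mirrored for points on the other side. A
  graph in \<open>X\<close> is only a limit of Schreier graphs, and the approximating Schreier graph
  changes with the radius. Hence nothing is transferred globally: at each scale one finite segment
  is carried over by an isomorphism of balls. An eigenfunction has to vanish at every vertex and not
  only at the root; this works because a walk changes finitely many letters, so that patterns far
  enough out are seen from every vertex.\<close>

definition sact :: "gen \<Rightarrow> (nat \<Rightarrow> bool) \<Rightarrow> (nat \<Rightarrow> bool)" where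
  "sact s = bdry (gen_word s)"

definition wact :: "gen list \<Rightarrow> (nat \<Rightarrow> bool) \<Rightarrow> (nat \<Rightarrow> bool)" where
  "wact l = foldr sact l"

definition scons :: "bool \<Rightarrow> (nat \<Rightarrow> bool) \<Rightarrow> (nat \<Rightarrow> bool)" where
  "scons x \<xi> = case_nat x \<xi>"

text \<open>These two conditions make the prefixes of the boundary image the images of the prefixes,
  which is what lets \<open>bdry\<close> respect composition.\<close>

definition tree_aut :: "(bool list \<Rightarrow> bool list) \<Rightarrow> bool" where
  "tree_aut g \<longleftrightarrow> (\<forall>w. length (g w) = length w) \<and> (\<forall>w k. take k (g w) = g (take k w))"

lemma UNIV_gen: "(UNIV :: gen set) = {gen_a, gen_b, gen_c, gen_d}"
  using gen.exhaust by auto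

lemma gen_word_gen_word [simp]: "gen_word s (gen_word s w) = w"
proof (induction w arbitrary: s)
  case (Cons x w)
  then show ?case by (cases s; cases x) auto
qed simp

lemma tree_aut_gen_word: "tree_aut (gen_word s)"
proof -
  have "length (gen_word s w) = length w" for s w
  proof (induction w arbitrary: s)
    case (Cons x w)
    then show ?case by (cases s; cases x) auto
  qed simp
  moreover have "take k (gen_word s w) = gen_word s (take k w)" for s k w
  proof (induction w arbitrary: s k)
    case (Cons x w)
    then show ?case by (cases s; cases x; cases k) auto
  qed simp
  ultimately show ?thesis by (auto simp: tree_aut_def)
qed

lemma tree_aut_comp: "tree_aut g \<Longrightarrow> tree_aut h \<Longrightarrow> tree_aut (g \<circ> h)"
  by (auto simp: tree_aut_def)

lemma bdry_comp:
  assumes "tree_aut h"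
  shows "bdry (g \<circ> h) \<xi> = bdry g (bdry h \<xi>)"
proof -
  have "map (bdry h \<xi>) [0..<Suc n] = h (map \<xi> [0..<Suc n])" for n
  proof (rule nth_equalityI)
    show len: "length (map (bdry h \<xi>) [0..<Suc n]) = length (h (map \<xi> [0..<Suc n]))"
      using assms by (simp add: tree_aut_def)
    fix i assume "i < length (map (bdry h \<xi>) [0..<Suc n])"
    then have i: "i \<le> n" by simp
    have "h (map \<xi> [0..<Suc n]) ! i = take (Suc i) (h (map \<xi> [0..<Suc n])) ! i"
      by simp
    also have "\<dots> = h (take (Suc i) (map \<xi> [0..<Suc n])) ! i"
      using assms unfolding tree_aut_def by presburger
    also have "take (Suc i) (map \<xi> [0..<Suc n]) = map \<xi> [0..<Suc i]"
      using i by (simp add: take_map min_def del: upt_Suc)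
    finally show "map (bdry h \<xi>) [0..<Suc n] ! i = h (map \<xi> [0..<Suc n]) ! i"
      using i by (simp add: bdry_def del: upt_Suc)
  qed
  then show ?thesis by (simp add: bdry_def fun_eq_iff del: upt_Suc)
qed

lemma sact_sact [simp]: "sact s (sact s \<xi>) = \<xi>"
proof -
  have "gen_word s \<circ> gen_word s = id" by auto
  then have "sact s (sact s \<xi>) = bdry id \<xi>"
    using bdry_comp[OF tree_aut_gen_word, of "gen_word s" s \<xi>] by (simp add: sact_def)
  then show ?thesis by (simp add: bdry_def fun_eq_iff del: upt_Suc)
qed

lemma wact_Nil [simp]: "wact [] \<xi> = \<xi>"
  and wact_Cons [simp]: "wact (s # l) \<xi> = sact s (wact l \<xi>)"
  and wact_append [simp]: "wact (k @ l) \<xi> = wact k (wact l \<xi>)"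
  by (simp_all add: wact_def)

lemma wact_rev_wact [simp]: "wact (rev l) (wact l \<xi>) = \<xi>"
  by (induction l arbitrary: \<xi>) auto

lemma wact_wact_rev [simp]: "wact l (wact (rev l) \<xi>) = \<xi>"
  using wact_rev_wact[of "rev l"] by simp

section \<open>Group elements as words in the generators\<close>

lemma gen_word_Bij: "gen_word s \<in> Bij UNIV"
  by (auto simp: Bij_def intro!: o_bij[of "gen_word s"])

primrec word_fun :: "gen list \<Rightarrow> bool list \<Rightarrow> bool list" where
  "word_fun [] = id"
| "word_fun (s # l) = gen_word s \<circ> word_fun l"

lemma grigorchuk_group_eq: "grigorchuk_group = range word_fun"
proof (rule antisym)
  have app: "word_fun (k @ l) = word_fun k \<circ> word_fun l" for k l
    by (induction k) auto
  have mult: "f \<otimes>\<^bsub>BijGroup UNIV\<^esub> g = f \<circ> g" if "f \<in> Bij UNIV" "g \<in> Bij UNIV" for f g :: "bool list \<Rightarrow> bool list"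
    using that by (simp add: BijGroup_def compose_def comp_def fun_eq_iff)
  have word_Bij: "word_fun l \<in> Bij UNIV" for l
  proof (induction l)
    case Nil
    then show ?case using bij_id by (simp add: Bij_def id_def)
  next
    case (Cons s l)
    then show ?case using gen_word_Bij[of s] bij_comp[of "word_fun l" "gen_word s"] by (simp add: Bij_def comp_def)
  qed
  show "grigorchuk_group \<subseteq> range word_fun"
  proof
    fix g assume "g \<in> grigorchuk_group"
    then have "g \<in> generate (BijGroup UNIV) (range gen_word)" by (simp add: grigorchuk_group_def)
    then show "g \<in> range word_fun"
    proof induction
      case one
      have "\<one>\<^bsub>BijGroup UNIV\<^esub> = word_fun []" by (simp add: BijGroup_def fun_eq_iff)
      then show ?case by blast
    next
      case (incl h)
      then obtain s where "h = word_fun [s]" by auto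
      then show ?case by blast
    next
      case (inv h)
      then obtain s where s: "h = gen_word s" by auto
      have "inv_into UNIV (gen_word s) = gen_word s"
        by (rule inv_unique_comp) auto
      moreover have "inv\<^bsub>BijGroup UNIV\<^esub> h = (\<lambda>x\<in>UNIV. inv_into UNIV (gen_word s) x)"
        unfolding s by (rule inv_BijGroup[OF gen_word_Bij])
      ultimately have "inv\<^bsub>BijGroup UNIV\<^esub> h = word_fun [s]"
        by (simp add: restrict_def fun_eq_iff)
      then show ?case by blast
    next
      case (eng h1 h2)
      then obtain k l where "h1 = word_fun k" "h2 = word_fun l" by auto
      then have "h1 \<otimes>\<^bsub>BijGroup UNIV\<^esub> h2 = word_fun (k @ l)"
        using mult word_Bij app by simp
      then show ?case by blast
    qed
  qed
  have "word_fun l \<in> grigorchuk_group" for l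
  proof (induction l)
    case Nil
    have "\<one>\<^bsub>BijGroup UNIV\<^esub> = word_fun []" by (simp add: BijGroup_def fun_eq_iff)
    then show ?case unfolding grigorchuk_group_def using generate.one by metis
  next
    case (Cons s l)
    have "gen_word s \<in> grigorchuk_group"
      unfolding grigorchuk_group_def by (rule generate.incl) simp
    with Cons have "gen_word s \<otimes>\<^bsub>BijGroup UNIV\<^esub> word_fun l \<in> grigorchuk_group"
      unfolding grigorchuk_group_def by (intro generate.eng)
    then show ?case using mult[OF gen_word_Bij word_Bij] by (simp add: comp_def)
  qed
  then show "range word_fun \<subseteq> grigorchuk_group" by blast
qed

lemma orbit_eq: "orbit \<xi> = range (\<lambda>l. wact l \<xi>)"
proof -
  have aut: "tree_aut (word_fun l)" for l
    
  proof (induction l)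
    case Nil
    then show ?case by (simp add: tree_aut_def)
  next
    case (Cons s l)
    then show ?case using tree_aut_comp[OF tree_aut_gen_word, of "word_fun l" s] by (simp add: comp_def)
  qed
  have "bdry (word_fun l) \<xi> = wact l \<xi>" for l
  proof (induction l)
    case Nil
    then show ?case by (simp add: bdry_def fun_eq_iff del: upt_Suc)
  next
    case (Cons s l)
    then show ?case using bdry_comp[OF aut[of l], of "gen_word s" \<xi>] by (simp add: sact_def comp_def)
  qed
  then show ?thesis unfolding orbit_def grigorchuk_group_eq by (auto simp flip: \<open>\<And>l. bdry (word_fun l) \<xi> = wact l \<xi>\<close>)
qed

lemma self_in_orbit [simp]: "\<xi> \<in> orbit \<xi>"
  unfolding orbit_eq by (rule range_eqI[of _ _ "[]"]) simp

lemma sact_in_orbit: "p \<in> orbit \<xi> \<Longrightarrow> sact s p \<in> orbit \<xi>"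
  unfolding orbit_eq by (auto simp flip: wact_Cons)

lemma wact_in_orbit: "p \<in> orbit \<xi> \<Longrightarrow> wact l p \<in> orbit \<xi>"
  by (induction l) (auto simp: sact_in_orbit)

lemma orbit_subset: "p \<in> orbit \<xi> \<Longrightarrow> orbit p \<subseteq> orbit \<xi>"
  unfolding orbit_eq[of p] using wact_in_orbit by auto

lemma orbit_cong: "p \<in> orbit \<xi> \<Longrightarrow> orbit p = orbit \<xi>"
proof -
  assume p: "p \<in> orbit \<xi>"
  then obtain l where "p = wact l \<xi>" unfolding orbit_eq by auto
  then have "\<xi> = wact (rev l) p" by simp
  then have "\<xi> \<in> orbit p" unfolding orbit_eq by blast
  with p show ?thesis using orbit_subset by blast
qed

lemma scons_0 [simp]: "scons x \<xi> 0 = x" and scons_Suc [simp]: "scons x \<xi> (Suc n) = \<xi> n"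
  by (simp_all add: scons_def)

lemma scons_collapse: "scons (\<xi> 0) (\<lambda>n. \<xi> (Suc n)) = \<xi>"
  by (auto simp: scons_def fun_eq_iff split: nat.split)

lemma scons_eq_iff [simp]: "scons x \<xi> = scons y \<eta> \<longleftrightarrow> x = y \<and> \<xi> = \<eta>"
  by (auto simp: fun_eq_iff scons_def split: nat.splits)

lemma scons_exhaust: obtains x \<eta> where "\<xi> = scons x \<eta>"
  using scons_collapse[of \<xi>] by metis

lemma map_scons: "map (scons x \<xi>) [0..<Suc n] = x # map \<xi> [0..<n]"
  by (simp add: map_upt_Suc del: upt_Suc)

lemma bdry_scons:
  assumes "\<And>w. gen_word s (x # w) = y # h w"
  shows "sact s (scons x \<xi>) = scons y (bdry h \<xi>)"
proof
  fix n
  show "sact s (scons x \<xi>) n = scons y (bdry h \<xi>) n"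
    unfolding sact_def bdry_def map_scons assms by (cases n) (simp_all del: upt_Suc)
qed

lemma bdry_id: "bdry (\<lambda>w. w) \<xi> = \<xi>"
  by (simp add: bdry_def fun_eq_iff del: upt_Suc)

lemma sact_scons [simp]:
  "sact gen_a (scons x \<xi>) = scons (\<not> x) \<xi>"
  "sact gen_b (scons x \<xi>) = scons x (sact (if x then gen_c else gen_a) \<xi>)"
  "sact gen_c (scons x \<xi>) = scons x (sact (if x then gen_d else gen_a) \<xi>)"
  "sact gen_d (scons x \<xi>) = scons x (if x then sact gen_b \<xi> else \<xi>)"
  using bdry_scons[of gen_a x "\<not> x" "\<lambda>w. w" \<xi>]
    bdry_scons[of gen_b x x "gen_word (if x then gen_c else gen_a)" \<xi>]
    bdry_scons[of gen_c x x "gen_word (if x then gen_d else gen_a)" \<xi>]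
    bdry_scons[of gen_d x x "if x then gen_word gen_b else (\<lambda>w. w)" \<xi>]
  by (cases x; simp add: sact_def bdry_id)+

section \<open>Gray code\<close>

text \<open>
  \<open>lab k\<close> is the generator fixing a sequence that starts with exactly \<open>k - 1\<close> ones; the index is
  shifted so that \<open>k\<close> is the position of the letter which the other two generators flip.
\<close>

definition lab :: "nat \<Rightarrow> gen" where
  "lab k = (if k mod 3 = 1 then gen_d else if k mod 3 = 2 then gen_c else gen_b)"

lemma lab_neq_a [simp]: "lab k \<noteq> gen_a" "gen_a \<noteq> lab k"
  by (auto simp: lab_def)

lemma lab_add_3 [simp]: "lab (k + 3) = lab k"
  by (simp add: lab_def)

lemma sact_a: "sact gen_a \<xi> = \<xi>(0 := \<not> \<xi> 0)"
proof -
  obtain x \<eta> where "\<xi> = scons x \<eta>" by (rule scons_exhaust)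
  moreover have "(scons x \<eta>)(0 := \<not> x) = scons (\<not> x) \<eta>"
    by (auto simp: scons_def fun_eq_iff split: nat.split)
  ultimately show ?thesis by simp
qed

lemma scons_upd: "(scons x \<eta>)(Suc n := y) = scons x (\<eta>(n := y))"
  by (auto simp: scons_def fun_eq_iff split: nat.split)

lemma lab_Suc:
  "lab (Suc (Suc h)) = gen_b \<longleftrightarrow> lab (Suc h) = gen_c"
  "lab (Suc (Suc h)) = gen_c \<longleftrightarrow> lab (Suc h) = gen_d"
  "lab (Suc (Suc h)) = gen_d \<longleftrightarrow> lab (Suc h) = gen_b"
proof -
  have "h mod 3 = 0 \<or> h mod 3 = 1 \<or> h mod 3 = 2" by linarith
  then show "lab (Suc (Suc h)) = gen_b \<longleftrightarrow> lab (Suc h) = gen_c"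
    "lab (Suc (Suc h)) = gen_c \<longleftrightarrow> lab (Suc h) = gen_d"
    "lab (Suc (Suc h)) = gen_d \<longleftrightarrow> lab (Suc h) = gen_b"
    by (auto simp: lab_def mod_Suc)
qed

text \<open>Each leading one shifts the generator along the cycle b, c, d, and the first zero turns
  the result into a or, for d, into the identity on the rest. So only the letter just behind the
  first zero can change, and one of the three generators leaves it alone.\<close>

lemma sact_first_zero:
  assumes "\<forall>i<h. \<xi> i" "\<not> \<xi> h" "s \<noteq> gen_a"
  shows "sact s \<xi> = (if s = lab (Suc h) then \<xi> else \<xi>(Suc h := \<not> \<xi> (Suc h)))"
  using assms
proof (induction h arbitrary: s \<xi>)
  case 0
  obtain x \<eta> where \<xi>: "\<xi> = scons x \<eta>" by (rule scons_exhaust)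
  with 0 have "\<not> x" by simp
  with \<xi> 0(3) show ?case by (cases s) (auto simp: sact_a scons_upd lab_def)
next
  case (Suc h)
  obtain x \<eta> where \<xi>: "\<xi> = scons x \<eta>" by (rule scons_exhaust)
  have x: "x" using Suc.prems(1) \<xi> by auto
  have h: "\<forall>i<h. \<eta> i" "\<not> \<eta> h" using Suc.prems \<xi> by auto
  note IH = Suc.IH[OF h]
  from x \<xi> IH[of gen_b] IH[of gen_c] IH[of gen_d] Suc.prems(3) show ?case
    by (cases s) (auto simp: scons_upd lab_Suc eq_commute[of _ "lab _"])
qed

lemma sact_ones:
  assumes "s \<noteq> gen_a"
  shows "sact s ones = ones"
proof
  fix n
  have ones: "ones = scons True ones" by (auto simp: ones_def scons_def fun_eq_iff split: nat.split)
  from assms show "sact s ones n = ones n"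
  proof (induction n arbitrary: s)
    case 0
    then show ?case by (subst ones, subst (2) ones) (cases s; simp)
  next
    case (Suc n)
    then show ?case by (subst ones, subst (2) ones) (cases s; simp)
  qed
qed

text \<open>
  The letter \<open>i\<close> is 1 iff the binary digits \<open>i\<close> and \<open>i + 1\<close> of \<open>j\<close> agree (two's complement for
  negative \<open>j\<close>).
\<close>

definition gray :: "int \<Rightarrow> nat \<Rightarrow> bool" where
  "gray j i = even ((j + 2 ^ i) div 2 ^ Suc i)"

lemma add_1_div_int:
  fixes x d :: int
  assumes "d > 0"
  shows "(x + 1) div d = x div d + (if d dvd x + 1 then 1 else 0)"
proof (cases "d dvd x + 1")
  case True
  then obtain c where c: "x + 1 = d * c" by auto
  then have "x = d * (c - 1) + (d - 1)" by (simp add: algebra_simps)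
  then have "x div d = (d * (c - 1) + (d - 1)) div d" by simp
  also have "\<dots> = c - 1" using assms by (subst div_mult_self4) auto
  finally show ?thesis using c assms True by simp
next
  case False
  have "(x mod d + 1) < d"
  proof (rule ccontr)
    assume "\<not> ?thesis"
    then have "x mod d = d - 1" using assms pos_mod_bound[of d x] by linarith
    then have "x + 1 = d * (x div d + 1)"
      using mult_div_mod_eq[of d x] unfolding distrib_left by linarith
    with False show False by simp
  qed
  moreover have "0 \<le> x mod d + 1" using assms by (simp add: add_nonneg_nonneg)
  moreover have "x + 1 = d * (x div d) + (x mod d + 1)" by simp
  ultimately have "(x + 1) div d = x div d" by (metis int_div_pos_eq)
  with False show ?thesis by simp
qed

text \<open>The quotients of x and x + 1 by d differ only if d divides x + 1. For x =
  \<open>j + 2 ^ i\<close> and d = \<open>2 ^ Suc i\<close> this happens at i = k alone, so one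
  parity changes.\<close>

lemma gray_Suc:
  assumes "j + 1 = 2 ^ k * m" "odd m"
  shows "gray (j + 1) = (gray j)(k := \<not> gray j k)"
proof
  fix i
  have "(2 :: int) ^ Suc i dvd 2 ^ k * m + 2 ^ i \<longleftrightarrow> i = k"
  proof (cases i k rule: linorder_cases)
    case less
    then obtain d where k: "k = i + Suc d" by (metis less_iff_Suc_add add_Suc_right)
    have "(2 :: int) ^ k * m + 2 ^ i = 2 ^ i * (2 * (2 ^ d * m) + 1)" by (simp add: k power_add algebra_simps)
    moreover have "(2 :: int) ^ Suc i = 2 ^ i * 2" by simp
    moreover have "\<not> (2 :: int) dvd 2 * (2 ^ d * m) + 1" by simp
    ultimately show ?thesis using less by (metis dvd_mult_cancel_left nat_neq_iff power_not_zero zero_neq_numeral)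
  next
    case equal
    have "(2 :: int) ^ k * m + 2 ^ k = 2 ^ k * (m + 1)" by (simp add: algebra_simps)
    moreover have "(2 :: int) ^ Suc k = 2 ^ k * 2" by simp
    moreover have "(2 :: int) dvd m + 1" using assms(2) by simp
    ultimately show ?thesis using equal by (metis mult_dvd_mono dvd_refl)
  next
    case greater
    then obtain d where i: "i = k + Suc d" by (metis less_iff_Suc_add add_Suc_right)
    have "(2 :: int) ^ k * m + 2 ^ i = 2 ^ k * (m + 2 * 2 ^ d)" by (simp add: i power_add algebra_simps)
    moreover have "(2 :: int) ^ Suc i = 2 ^ k * (2 * 2 ^ Suc d)" by (simp add: i power_add)
    moreover have "\<not> (2 :: int) * 2 ^ Suc d dvd m + 2 * 2 ^ d" 
      using assms(2) by (metis dvd_mult_left even_add even_mult_iff dvd_refl)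
    ultimately show ?thesis using greater by (metis dvd_mult_cancel_left nat_neq_iff power_not_zero zero_neq_numeral)
  qed
  moreover have e: "j + 2 ^ i + 1 = 2 ^ k * m + 2 ^ i" using assms(1) by simp
  ultimately have "(j + 2 ^ i + 1) div 2 ^ Suc i = (j + 2 ^ i) div 2 ^ Suc i + (if i = k then 1 else 0)"
    using add_1_div_int[of "2 ^ Suc i" "j + 2 ^ i"] unfolding e by simp
  moreover have "j + 1 + 2 ^ i = j + 2 ^ i + 1" by simp
  ultimately have "(j + 1 + 2 ^ i) div 2 ^ Suc i = (j + 2 ^ i) div 2 ^ Suc i + (if i = k then 1 else 0)"
    by argo
  then show "gray (j + 1) i = ((gray j)(k := \<not> gray j k)) i"
    unfolding gray_def by simp
qed

text \<open>The lowest k digits of j are ones and digit k is zero. Neighbouring digits therefore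
  agree up to the last pair, which gives k - 1 ones followed by a zero: the shape for which b, c, d
  act on letter k.\<close>

lemma gray_leading:
  assumes "j + 1 = 2 ^ k * m" "odd m" "i < k"
  shows "gray j i \<longleftrightarrow> Suc i < k"
proof -
  obtain d where k: "k = Suc i + d" using assms(3) by (metis less_iff_Suc_add add_Suc add.commute)
  have "j + 2 ^ i = 2 ^ Suc i * (2 ^ d * m) + (2 ^ i - 1)"
    using assms(1) by (simp add: k power_add algebra_simps)
  moreover have "0 < (2 :: int) ^ i" by simp
  then have "0 \<le> (2 :: int) ^ i - 1" "(2 :: int) ^ i - 1 < 2 ^ Suc i" unfolding power_Suc by linarith+
  ultimately have "(j + 2 ^ i) div 2 ^ Suc i = 2 ^ d * m" by (intro int_div_pos_eq)
  then show ?thesis using assms(2) k by (auto simp: gray_def)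
qed

text \<open>Passing from j to -1 - j complements all digits in two's complement, which does not
  affect whether neighbours agree.\<close>

lemma gray_reflect: "gray (- 1 - j) = gray j"
proof
  fix i
  have "- 1 - j + 2 ^ i = - 1 - (j + 2 ^ i) + 2 ^ Suc i * 1" by simp
  then have "(- 1 - j + 2 ^ i) div 2 ^ Suc i = (- 1 - (j + 2 ^ i)) div 2 ^ Suc i + 1"
    by (metis add.commute div_mult_self2 power_not_zero zero_neq_numeral)
  also have "(- 1 - (j + 2 ^ i)) div 2 ^ Suc i = - 1 - (j + 2 ^ i) div (2 ^ Suc i :: int)"
  proof -
    let ?x = "j + 2 ^ i" and ?d = "2 ^ Suc i :: int"
    have d: "?d > 0" by simp
    have "- 1 - ?x = ?d * (- 1 - ?x div ?d) + (?d - 1 - ?x mod ?d)"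
      using mult_div_mod_eq[of ?d ?x] by (simp add: algebra_simps)
    moreover have "0 \<le> ?d - 1 - ?x mod ?d" "?d - 1 - ?x mod ?d < ?d"
      using pos_mod_bound[OF d, of ?x] pos_mod_sign[OF d, of ?x] by linarith+
    ultimately show ?thesis by (intro int_div_pos_eq)
  qed
  finally show "gray (- 1 - j) i = gray j i" by (simp add: gray_def)
qed

lemma gray_period:
  assumes "i < N"
  shows "gray (2 ^ Suc N * c + j) i = gray j i"
proof -
  obtain d where N: "N = Suc i + d" using assms by (metis less_iff_Suc_add add_Suc add.commute)
  have "2 ^ Suc N * c + j + 2 ^ i = (j + 2 ^ i) + 2 ^ Suc i * (2 * 2 ^ d * c)"
    by (simp add: N power_add algebra_simps)
  then have "(2 ^ Suc N * c + j + 2 ^ i) div 2 ^ Suc i = (j + 2 ^ i) div 2 ^ Suc i + 2 * 2 ^ d * c"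
    by (metis add.commute div_mult_self2 power_not_zero zero_neq_numeral)
  then show ?thesis by (simp add: gray_def)
qed

lemma gray_top:
  assumes "0 \<le> j" "j < 2 ^ Suc N"
  shows "gray j N \<longleftrightarrow> j < 2 ^ N"
proof (cases "j < 2 ^ N")
  case True
  then show ?thesis using assms by (simp add: gray_def)
next
  case False
  then have "(j + 2 ^ N) div 2 ^ Suc N = 1" using assms by (intro int_div_pos_eq[where r = "j - 2 ^ N"]) auto
  then show ?thesis using False by (simp add: gray_def)
qed

lemma gray_reflect_top:
  assumes "i < N"
  shows "gray (2 ^ Suc N - 1 - j) i = gray j i"
  using gray_period[OF assms, of 1 "- 1 - j"] gray_reflect[of j] by (simp add: algebra_simps)

text \<open>This is the reflected construction of the Gray code: the second half of the list for N +
  1 letters is the mirrored list for N letters with the new letter switched.\<close>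

lemma gray_surj: "\<exists>j. 0 \<le> j \<and> j < 2 ^ N \<and> (\<forall>i<N. gray j i = \<xi> i)"
proof (induction N)
  case 0
  show ?case by (rule exI[of _ 0]) simp
next
  case (Suc N)
  then obtain j where j: "0 \<le> j" "j < 2 ^ N" "\<forall>i<N. gray j i = \<xi> i" by blast
  show ?case
  proof (cases "\<xi> N")
    case True
    then show ?thesis using j gray_top[of j N] by (intro exI[of _ j]) (auto simp: less_Suc_eq)
  next
    case False
    let ?j = "2 ^ Suc N - 1 - j"
    have "\<not> gray ?j N" using j gray_top[of ?j N] by simp
    then show ?thesis using j False gray_reflect_top[of _ N j] by (intro exI[of _ ?j]) (auto simp: less_Suc_eq)
  qed
qed

lemma gray_inj:
  assumes "0 \<le> j" "j < 2 ^ N" "0 \<le> j'" "j' < 2 ^ N" "\<forall>i<N. gray j i = gray j' i"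
  shows "j = j'"
  using assms
proof (induction N arbitrary: j j')
  case (Suc N)
  have top: "j < 2 ^ N \<longleftrightarrow> j' < 2 ^ N" using Suc.prems gray_top[of j N] gray_top[of j' N] by simp
  show ?case
  proof (cases "j < 2 ^ N")
    case True
    then show ?thesis using Suc top by auto
  next
    case False
    have "2 ^ Suc N - 1 - j = 2 ^ Suc N - 1 - j'"
      using False top Suc.prems by (intro Suc.IH) (auto simp: gray_reflect_top simp del: power_Suc, auto)
    then show ?thesis by simp
  qed
qed simp

section \<open>Edges between consecutive Gray positions\<close>

lemma mult_2_decomp:
  fixes m :: int
  assumes "m \<noteq> 0"
  obtains o' where "m = 2 ^ multiplicity 2 m * o'" "odd o'"
  using multiplicity_decompose'[of m 2] assms by auto

lemma mult_2_eqI: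
  fixes m :: int
  assumes "odd m"
  shows "multiplicity 2 (2 ^ k * m) = k"
  using assms by (intro multiplicity_eqI) auto

lemma gray_edge_even:
  assumes "even j" "\<eta> 0 = gray j 0" "\<eta>' = \<eta>(0 := gray (j + 1) 0)"
  shows "sact gen_a \<eta> = \<eta>'" "sact gen_a \<eta>' = \<eta>"
proof -
  have "gray (j + 1) 0 \<noteq> gray j 0" using gray_Suc[of j 0 "j + 1"] assms(1) by simp
  then show "sact gen_a \<eta> = \<eta>'" "sact gen_a \<eta>' = \<eta>"
    using assms(2,3) by (auto simp: sact_a fun_eq_iff)
qed

lemma gray_edge_odd:
  assumes "odd j" "j + 1 \<noteq> 0" "k = multiplicity 2 (j + 1)"
    and "\<forall>i\<le>k. \<eta> i = gray j i" "\<eta>' = \<eta>(k := gray (j + 1) k)" "s \<noteq> gen_a"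
  shows "sact s \<eta> = (if s = lab k then \<eta> else \<eta>')"
    and "sact s \<eta>' = (if s = lab k then \<eta>' else \<eta>)"
proof -
  obtain m where m: "j + 1 = 2 ^ k * m" "odd m" using mult_2_decomp[OF assms(2)] assms(3) by metis
  have "k \<noteq> 0" using m assms(1) by (metis even_plus_one_iff mult_1 power_0)
  then obtain h where h: "k = Suc h" by (metis not0_implies_Suc)
  have flip: "gray (j + 1) k = (\<not> \<eta> k)" using gray_Suc[OF m] assms(4) by simp
  have lead: "\<forall>i<h. \<eta> i" "\<not> \<eta> h" using gray_leading[OF m] assms(4) h by auto
  then have lead': "\<forall>i<h. \<eta>' i" "\<not> \<eta>' h" using assms(5) h by auto
  have unflip: "\<eta>'(k := \<not> \<eta>' k) = \<eta>" using flip assms(5) by (auto simp: fun_eq_iff)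
  show "sact s \<eta> = (if s = lab k then \<eta> else \<eta>')"
    using sact_first_zero[OF lead assms(6)] h flip assms(5) by simp
  show "sact s \<eta>' = (if s = lab k then \<eta>' else \<eta>)"
    using sact_first_zero[OF lead' assms(6)] unflip h by simp
qed

definition gpath :: "nat \<Rightarrow> (nat \<Rightarrow> bool) \<Rightarrow> int \<Rightarrow> nat \<Rightarrow> bool" where
  "gpath N \<zeta> j i = (if i < N then gray j i else \<zeta> i)"

lemma gpath_a:
  assumes "even j" "N > 0"
  shows "sact gen_a (gpath N \<zeta> j) = gpath N \<zeta> (j + 1)" "sact gen_a (gpath N \<zeta> (j + 1)) = gpath N \<zeta> j"
proof -
  have "gpath N \<zeta> (j + 1) = (gpath N \<zeta> j)(0 := gray (j + 1) 0)"
    using gray_Suc[of j 0 "j + 1"] assms by (auto simp: gpath_def fun_eq_iff)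
  then show "sact gen_a (gpath N \<zeta> j) = gpath N \<zeta> (j + 1)" "sact gen_a (gpath N \<zeta> (j + 1)) = gpath N \<zeta> j"
    using gray_edge_even[of j "gpath N \<zeta> j" "gpath N \<zeta> (j + 1)"] assms by (auto simp: gpath_def[of _ _ _ 0])
qed

lemma gpath_bcd:
  assumes "odd j" "0 < j + 1" "j + 1 < 2 ^ N" "s \<noteq> gen_a"
  defines "k \<equiv> multiplicity 2 (j + 1)"
  shows "sact s (gpath N \<zeta> j) = (if s = lab k then gpath N \<zeta> j else gpath N \<zeta> (j + 1))"
    and "sact s (gpath N \<zeta> (j + 1)) = (if s = lab k then gpath N \<zeta> (j + 1) else gpath N \<zeta> j)"
proof -
  obtain m where m: "j + 1 = 2 ^ k * m" "odd m" using mult_2_decomp[of "j + 1"] assms(2) k_def by force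
  have "m > 0" using m(1) assms(2) by (metis zero_less_mult_pos zero_less_numeral zero_less_power)
  then have "(2 :: int) ^ k * 1 \<le> 2 ^ k * m" by (intro mult_left_mono) auto
  then have "(2 :: int) ^ k < 2 ^ N" using m assms(3) by linarith
  then have k: "k < N" by simp
  then have "gpath N \<zeta> (j + 1) = (gpath N \<zeta> j)(k := gray (j + 1) k)"
    using gray_Suc[OF m] by (auto simp: gpath_def fun_eq_iff)
  moreover have "\<forall>i\<le>k. gpath N \<zeta> j i = gray j i" using k by (auto simp: gpath_def)
  ultimately show "sact s (gpath N \<zeta> j) = (if s = lab k then gpath N \<zeta> j else gpath N \<zeta> (j + 1))"
    "sact s (gpath N \<zeta> (j + 1)) = (if s = lab k then gpath N \<zeta> (j + 1) else gpath N \<zeta> j)"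
    using gray_edge_odd[of j k "gpath N \<zeta> j" "gpath N \<zeta> (j + 1)" s] assms by auto
qed

section \<open>Gordon's argument\<close>

text \<open>The discrete Wronskian with weight e is conserved, so the determinant is the quotient of
  \<open>e 0\<close> by \<open>e L\<close>; it is stated without division. The matrix is chosen
  before f because one matrix has to serve several translates of the same solution.\<close>

lemma transfer_matrix:
  fixes e q :: "nat \<Rightarrow> complex"
  assumes "\<And>i. e i \<noteq> 0"
  shows "\<exists>\<alpha> \<beta> \<gamma> \<delta>. e L * (\<alpha> * \<delta> - \<beta> * \<gamma>) = e 0 \<and>
    (\<forall>f. (\<forall>i<L. e (Suc i) * f (Suc (Suc i)) + e i * f i = q i * f (Suc i)) \<longrightarrow>
      f L = \<alpha> * f 0 + \<beta> * f 1 \<and> f (Suc L) = \<gamma> * f 0 + \<delta> * f 1)"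
proof (induction L)
  case 0
  show ?case by (rule exI[of _ 1], rule exI[of _ 0], rule exI[of _ 0], rule exI[of _ 1]) simp
next
  case (Suc L)
  then obtain \<alpha> \<beta> \<gamma> \<delta> where det: "e L * (\<alpha> * \<delta> - \<beta> * \<gamma>) = e 0"
    and sol: "\<And>f. \<forall>i<L. e (Suc i) * f (Suc (Suc i)) + e i * f i = q i * f (Suc i) \<Longrightarrow>
      f L = \<alpha> * f 0 + \<beta> * f 1 \<and> f (Suc L) = \<gamma> * f 0 + \<delta> * f 1"
    by blast
  let ?e = "e (Suc L)"
  show ?case
  proof (intro exI conjI allI impI)
    show "?e * (\<gamma> * ((q L * \<delta> - e L * \<beta>) / ?e) - \<delta> * ((q L * \<gamma> - e L * \<alpha>) / ?e)) = e 0"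
      using assms[of "Suc L"] det by (simp add: field_simps)
    fix f assume f: "\<forall>i<Suc L. e (Suc i) * f (Suc (Suc i)) + e i * f i = q i * f (Suc i)"
    then have IH: "f L = \<alpha> * f 0 + \<beta> * f 1" "f (Suc L) = \<gamma> * f 0 + \<delta> * f 1" using sol by auto
    show "f (Suc L) = \<gamma> * f 0 + \<delta> * f 1" by (fact IH)
    have "?e * f (Suc (Suc L)) = q L * f (Suc L) - e L * f L" using f by (metis add_diff_cancel_right' lessI)
    then have "f (Suc (Suc L)) = (q L * f (Suc L) - e L * f L) / ?e"
      using assms[of "Suc L"] by (simp add: field_simps)
    then show "f (Suc (Suc L)) = (q L * \<gamma> - e L * \<alpha>) / ?e * f 0 + (q L * \<delta> - e L * \<beta>) / ?e * f 1"
      unfolding IH by (simp add: algebra_simps diff_divide_distrib add_divide_distrib)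
  qed
qed

text \<open>Cayley--Hamilton for the monodromy matrix, whose determinant is 1 by periodicity.\<close>

lemma periodic_recurrence:
  fixes e q :: "int \<Rightarrow> complex" and L :: nat
  assumes e: "\<And>i. e i \<noteq> 0" "\<And>i. e (i + int L) = e i" and q: "\<And>i. q (i + int L) = q i"
  shows "\<exists>\<Delta>. \<forall>(f :: int \<Rightarrow> complex) k. (\<forall>i. b + k * int L < i \<and> i \<le> b + k * int L + 2 * int L \<longrightarrow>
      e i * f (i + 1) + e (i - 1) * f (i - 1) = q i * f i) \<longrightarrow>
    (\<forall>c\<in>{0, 1}. f (b + k * int L + 2 * int L + c) + f (b + k * int L + c) = \<Delta> * f (b + k * int L + int L + c))"
proof -
  have per: "e (i + k * int L) = e i" "q (i + k * int L) = q i" for i k :: int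
  proof -
    have "e (i + int m * int L) = e i \<and> q (i + int m * int L) = q i" for m :: nat and i :: int
    proof (induction m)
      case (Suc m)
      then show ?case using e(2)[of "i + int m * int L"] q[of "i + int m * int L"] by (simp add: algebra_simps)
    qed simp
    then have *: "e (i + k * int L) = e i \<and> q (i + k * int L) = q i" if "k \<ge> 0" for i k :: int
      using that by (metis nonneg_int_cases)
    show "e (i + k * int L) = e i" "q (i + k * int L) = q i"
      using *[of k i] *[of "- k" "i + k * int L"] by (cases "k \<ge> 0"; simp)+
  qed
  obtain \<alpha> \<beta> \<gamma> \<delta> where det: "e (b + int L) * (\<alpha> * \<delta> - \<beta> * \<gamma>) = e b"
    and sol: "\<And>f. \<forall>i<L. e (b + int (Suc i)) * f (Suc (Suc i)) + e (b + int i) * f i = q (b + int (Suc i)) * f (Suc i) \<Longrightarrow>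
      f L = \<alpha> * f 0 + \<beta> * f 1 \<and> f (Suc L) = \<gamma> * f 0 + \<delta> * f 1"
    using transfer_matrix[of "\<lambda>i. e (b + int i)" L "\<lambda>i. q (b + int (Suc i))"] e(1) by auto
  have det1: "\<alpha> * \<delta> = 1 + \<beta> * \<gamma>" proof -
    have "e b * (\<alpha> * \<delta> - \<beta> * \<gamma>) = e b * 1" using det e(2)[of b] by simp
    then have "\<alpha> * \<delta> - \<beta> * \<gamma> = 1" using e(1)[of b] mult_left_cancel by blast
    then show ?thesis by (simp add: algebra_simps)
  qed
  \<comment> \<open>The constant is the trace, which is the same for all f and k, so relations for
    consecutive k can be combined. The index c selects one of the two coordinates of the vector of
    neighbouring values.\<close>
  have "\<forall>c\<in>{0, 1}. f (b + k * int L + 2 * int L + c) + f (b + k * int L + c) = (\<alpha> + \<delta>) * f (b + k * int L + int L + c)"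
    if f: "\<forall>i. b + k * int L < i \<and> i \<le> b + k * int L + 2 * int L \<longrightarrow>
      e i * f (i + 1) + e (i - 1) * f (i - 1) = q i * f i" for f k
  proof -
    have sol': "f (b + r * int L + int L) = \<alpha> * f (b + r * int L) + \<beta> * f (b + r * int L + 1)"
      "f (b + r * int L + int L + 1) = \<gamma> * f (b + r * int L) + \<delta> * f (b + r * int L + 1)" if r: "r = k \<or> r = k + 1" for r
    proof -
      have "e (b + int (Suc i)) * f (b + r * int L + int (Suc (Suc i))) + e (b + int i) * f (b + r * int L + int i)
        = q (b + int (Suc i)) * f (b + r * int L + int (Suc i))" if i: "i < L" for i
      proof -
        let ?i = "b + r * int L + int (Suc i)"
        have "b + k * int L < ?i" "?i \<le> b + k * int L + 2 * int L" using r i by (auto simp: algebra_simps)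
        then have "e ?i * f (?i + 1) + e (?i - 1) * f (?i - 1) = q ?i * f ?i" using f by blast
        moreover have "e ?i = e (b + int (Suc i))" "q ?i = q (b + int (Suc i))" "e (?i - 1) = e (b + int i)"
          using per[of "b + int (Suc i)" r] per[of "b + int i" r] by (simp_all add: algebra_simps)
        moreover have "?i + 1 = b + r * int L + int (Suc (Suc i))" "?i - 1 = b + r * int L + int i" by simp_all
        ultimately show ?thesis by metis
      qed
      then show "f (b + r * int L + int L) = \<alpha> * f (b + r * int L) + \<beta> * f (b + r * int L + 1)"
        "f (b + r * int L + int L + 1) = \<gamma> * f (b + r * int L) + \<delta> * f (b + r * int L + 1)"
        using sol[of "\<lambda>i. f (b + r * int L + int i)"] by (auto simp: algebra_simps)
    qed
    let ?x = "f (b + k * int L)" and ?y = "f (b + k * int L + 1)"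
    have 1: "f (b + k * int L + int L) = \<alpha> * ?x + \<beta> * ?y" "f (b + k * int L + int L + 1) = \<gamma> * ?x + \<delta> * ?y"
      using sol'[of k] by simp_all
    have idx: "b + (k + 1) * int L + int L = b + k * int L + 2 * int L" "b + (k + 1) * int L = b + k * int L + int L"
      by (simp_all add: algebra_simps)
    have 2: "f (b + k * int L + 2 * int L) = \<alpha> * (\<alpha> * ?x + \<beta> * ?y) + \<beta> * (\<gamma> * ?x + \<delta> * ?y)"
      "f (b + k * int L + 2 * int L + 1) = \<gamma> * (\<alpha> * ?x + \<beta> * ?y) + \<delta> * (\<gamma> * ?x + \<delta> * ?y)"
      using sol'[of "k + 1"] unfolding idx 1 by (simp_all add: ac_simps)
    have "f (b + k * int L + 2 * int L) + ?x = (\<alpha> + \<delta>) * f (b + k * int L + int L)"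
    proof -
      have "(\<alpha> * \<delta>) * ?x = (1 + \<beta> * \<gamma>) * ?x" using det1 by simp
      then show ?thesis unfolding 1 2 by (simp add: algebra_simps)
    qed
    moreover have "f (b + k * int L + 2 * int L + 1) + ?y = (\<alpha> + \<delta>) * f (b + k * int L + int L + 1)"
    proof -
      have "(\<alpha> * \<delta>) * ?y = (1 + \<beta> * \<gamma>) * ?y" using det1 by simp
      then show ?thesis unfolding 1 2 by (simp add: algebra_simps)
    qed
    ultimately show ?thesis by simp
  qed
  then show ?thesis by blast
qed

text \<open>The trace depends on the eigenvalue and on the scale, and nothing is known about it. If
  its modulus is at least 1, the first relation bounds x1; otherwise the second expresses x1 by x3
  and by x2 with a coefficient of modulus below 1.\<close>

lemma gordon_inequality:
  fixes x0 x1 x2 x3 \<Delta> :: complex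
  assumes "x2 + x0 = \<Delta> * x1" "x3 + x1 = \<Delta> * x2"
  shows "cmod x1 \<le> cmod x0 + cmod x2 \<or> cmod x1 \<le> cmod x2 + cmod x3"
proof (cases "cmod \<Delta> \<ge> 1")
  case True
  then have "1 * cmod x1 \<le> cmod \<Delta> * cmod x1" by (intro mult_right_mono) auto
  also have "\<dots> = cmod (x2 + x0)" using assms(1) by (simp add: norm_mult)
  also have "\<dots> \<le> cmod x2 + cmod x0" by (rule norm_triangle_ineq)
  finally show ?thesis by simp
next
  case False
  have "x1 = \<Delta> * x2 - x3" using assms(2) by (simp add: algebra_simps)
  then have "cmod x1 \<le> cmod \<Delta> * cmod x2 + cmod x3" by (metis norm_mult norm_triangle_ineq4)
  also have "cmod \<Delta> * cmod x2 \<le> 1 * cmod x2" using False by (intro mult_right_mono) auto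
  finally show ?thesis by simp
qed

text \<open>
  Truncating the valuation at \<open>n\<close> makes it periodic with period \<open>2 ^ n\<close>.
\<close>

definition ruler :: "nat \<Rightarrow> int \<Rightarrow> nat" where
  "ruler n m = (if 2 ^ n dvd m then n else multiplicity 2 m)"

lemma ruler_add: "ruler n (m + 2 ^ n * c) = ruler n m"
proof (cases "2 ^ n dvd m")
  case True
  then show ?thesis by (simp add: ruler_def)
next
  case False
  then have "m \<noteq> 0" by auto
  then obtain m' where m': "m = 2 ^ multiplicity 2 m * m'" "odd m'" by (rule mult_2_decomp)
  let ?k = "multiplicity 2 m"
  have "?k < n" using False multiplicity_dvd'[of n 2 m] by (meson leI)
  then obtain d where n: "n = ?k + Suc d" by (metis less_iff_Suc_add add_Suc_right)
  have "(2 :: int) ^ n = 2 ^ ?k * (2 * 2 ^ d)" by (subst n) (simp add: power_add)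
  then have "2 ^ n * c = 2 ^ ?k * (2 * 2 ^ d * c)" by simp
  then have "m + 2 ^ n * c = 2 ^ ?k * (m' + 2 * 2 ^ d * c)" using m'(1) unfolding distrib_left by linarith
  moreover have "odd (m' + 2 * 2 ^ d * c)" using m'(2) by simp
  ultimately have "multiplicity 2 (m + 2 ^ n * c) = ?k" by (metis mult_2_eqI)
  moreover have "\<not> 2 ^ n dvd m + 2 ^ n * c" using False by (simp add: dvd_add_left_iff)
  ultimately show ?thesis using False by (simp add: ruler_def)
qed

section \<open>Segments with periodic coefficients\<close>

lemma ruler_minus: "ruler n (- m) = ruler n m"
  by (simp add: ruler_def multiplicity_uminus_right)

text \<open>Joints sit at even m, between the positions m - 1 and m; the two labels other than the
  loop label cross the joint. Using the truncated valuation at every joint, including 0, is the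
  periodicity that Gordon's argument requires.\<close>

definition segment_nbr :: "nat \<Rightarrow> (int \<Rightarrow> 'v) \<Rightarrow> int \<Rightarrow> gen \<Rightarrow> 'v" where
  "segment_nbr n Q i s =
    (if s = gen_a then Q (if even i then i + 1 else i - 1)
     else if s = lab (ruler n (if even i then i else i + 1)) then Q i
     else Q (if even i then i - 1 else i + 1))"

text \<open>Four blocks around joint 0. The edges at the two outermost positions are left open
  because they leave the segment. This local model is shared by Schreier graphs, two-ended graphs
  and all graphs that agree with them on balls.\<close>

definition segment :: "'v lgraph \<Rightarrow> nat \<Rightarrow> (int \<Rightarrow> 'v) \<Rightarrow> bool" where
  "segment \<Gamma> n Q \<longleftrightarrow>
    (\<forall>i. - 2 * 2 ^ n \<le> i \<and> i < 2 * 2 ^ n \<longrightarrow> Q i \<in> verts \<Gamma>) \<and>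
    (\<forall>i. - 2 * 2 ^ n < i \<and> i < 2 * 2 ^ n - 1 \<longrightarrow>
      emanating \<Gamma> (Q i) = range (\<lambda>s. (s, segment_nbr n Q i s)))"

text \<open>The reflection exchanges even and odd positions and sends joint m to joint -m, which has
  the same truncated valuation. It reduces the estimate to negative positions.\<close>

lemma segment_reflect:
  assumes "segment \<Gamma> n Q"
  shows "segment \<Gamma> n (\<lambda>i. Q (- 1 - i))"
proof -
  have "segment_nbr n (\<lambda>i. Q (- 1 - i)) i = segment_nbr n Q (- 1 - i)" for i
    using ruler_minus[of n i] ruler_minus[of n "i + 1"]
    by (auto simp: segment_nbr_def fun_eq_iff algebra_simps)
  with assms show ?thesis by (auto simp: segment_def)
qed

lemma laplacian_range:
  assumes "p \<in> verts \<Gamma>" "emanating \<Gamma> p = range (\<lambda>s. (s, g s))"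
  shows "laplacian \<Gamma> t u v w \<phi> p = (\<Sum>s\<in>UNIV. complex_of_real (weight t u v w s) * \<phi> (g s))"
proof -
  have "inj (\<lambda>s. (s, g s))" by (auto simp: inj_def)
  then show ?thesis using assms by (simp add: laplacian_def sum.reindex)
qed

text \<open>The two values come from the positions i - L, i + L and i + 2L, where L is the period.
  For i in the block just left of the centre all three stay inside the four blocks.\<close>

lemma segment_gordon_left:
  assumes params: "(t, u, v, w) \<in> params" and n: "n > 0" and seg: "segment \<Gamma> n Q"
    and eig: "laplacian \<Gamma> t u v w \<phi> = (\<lambda>p. l * \<phi> p)"
    and i: "- (2 ^ n) \<le> i" "i < 0"
  shows "\<exists>i1 i2. \<bar>i1 - i\<bar> \<ge> 2 ^ n \<and> \<bar>i2 - i\<bar> \<ge> 2 ^ n \<and> {i1, i2} \<subseteq> {- 2 * 2 ^ n..<2 * 2 ^ n} \<and>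
    cmod (\<phi> (Q i)) \<le> cmod (\<phi> (Q i1)) + cmod (\<phi> (Q i2))"
proof -
  define L where "L = (2 ^ n :: nat)"
  have L: "int L = 2 ^ n" by (simp add: L_def)
  have L2: "L \<ge> 2" using n power_increasing[of 1 n "2 :: nat"] by (simp add: L_def)
  then have L2': "int L \<ge> 2" by linarith
  have evenL: "even (int L)" using n by (simp add: L)
  define W where "W = weight t u v w"
  \<comment> \<open>The total weight of the double edge across a joint of type k; it is one of u +
    v, u + w, v + w, which \<open>params\<close> keeps away from 0.\<close>
  define E where "E = (\<lambda>k. u + v + w - W (lab k))"
  have E0: "E k \<noteq> 0" for k
    using params by (auto simp: E_def W_def lab_def params_def)
  \<comment> \<open>Here \<open>e i\<close> is the total weight between the positions i and i + 1,
    and \<open>q i\<close> is the eigenvalue minus the weight of the loop at i.\<close>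
  define e where "e = (\<lambda>i. complex_of_real (if even i then t else E (ruler n (i + 1))))"
  define q where "q = (\<lambda>i. l - W (lab (ruler n (if even i then i else i + 1))))"
  have e0: "e i \<noteq> 0" for i using E0 params by (simp add: e_def params_def)
  have ruler_per: "ruler n (i + int L) = ruler n i" for i using ruler_add[of n i 1] by (simp add: L)
  have eper: "e (i + int L) = e i" for i
    using ruler_per[of "i + 1"] evenL by (simp add: e_def algebra_simps)
  have qper: "q (i + int L) = q i" for i
    using ruler_per[of "i + 1"] ruler_per[of i] evenL by (simp add: q_def algebra_simps)
  define f where "f = (\<lambda>i. \<phi> (Q i))"
  have sum4: "(\<Sum>s\<in>UNIV. h s) = h gen_a + h gen_b + h gen_c + h gen_d" for h :: "gen \<Rightarrow> complex"
    unfolding UNIV_gen by (simp add: algebra_simps)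
  have rec: "e i * f (i + 1) + e (i - 1) * f (i - 1) = q i * f i" if "- 2 * int L < i" "i < 2 * int L - 1" for i :: int
  proof -
    let ?r = "ruler n (if even i then i else i + 1)"
    let ?a = "f (if even i then i + 1 else i - 1)" and ?o = "f (if even i then i - 1 else i + 1)"
    have "l * f i = (\<Sum>s\<in>UNIV. complex_of_real (W s) * \<phi> (segment_nbr n Q i s))"
      using seg that laplacian_range[of "Q i" \<Gamma> "segment_nbr n Q i" t u v w \<phi>]
      unfolding W_def f_def by (simp add: segment_def eig L)
    also have "\<dots> = complex_of_real t * ?a + complex_of_real (W (lab ?r)) * f i + complex_of_real (E ?r) * ?o"
      unfolding sum4 segment_nbr_def f_def E_def
      by (cases "lab ?r") (auto simp: W_def algebra_simps simp del: lab_neq_a, (metis lab_neq_a)+)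
    finally show ?thesis by (cases "even i") (simp_all add: e_def q_def algebra_simps)
  qed
  \<comment> \<open>The second relation uses the recurrence at positions up to b + 3L, and the last
    admissible one is 2L - 2. The base i - L violates this only for i = -1; there the base moves one
    step left and the second coordinate, c = 1, is read. The lower end then requires L to be at
    least 2.\<close>
  define b where "b = (if i = - 1 then - 2 else i) - int L"
  define c :: int where "c = (if i = - 1 then 1 else 0)"
  have bc: "i = b + int L + c" "c \<in> {0, 1}" "b \<ge> - 2 * int L" "b + 3 * int L + 1 \<le> 2 * int L - 1"
    using i L2' L by (auto simp: b_def c_def)
  obtain \<Delta> where \<Delta>: "\<And>k. \<forall>i. b + k * int L < i \<and> i \<le> b + k * int L + 2 * int L \<longrightarrow>
      e i * f (i + 1) + e (i - 1) * f (i - 1) = q i * f i \<Longrightarrow>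
    (\<forall>c\<in>{0, 1}. f (b + k * int L + 2 * int L + c) + f (b + k * int L + c) = \<Delta> * f (b + k * int L + int L + c))"
    using periodic_recurrence[of e L q b, OF e0 eper qper] by meson
  have "f (b + 2 * int L + c) + f (b + c) = \<Delta> * f (b + int L + c)"
    using \<Delta>[of 0] rec bc by auto
  moreover have "f (b + 3 * int L + c) + f (b + int L + c) = \<Delta> * f (b + 2 * int L + c)"
    using \<Delta>[of 1] rec bc by (auto simp: algebra_simps)
  ultimately have *: "cmod (f i) \<le> cmod (f (b + c)) + cmod (f (b + 2 * int L + c)) \<or>
      cmod (f i) \<le> cmod (f (b + 2 * int L + c)) + cmod (f (b + 3 * int L + c))"
    using gordon_inequality bc(1) by metis
  show ?thesis
  proof (cases "cmod (f i) \<le> cmod (f (b + c)) + cmod (f (b + 2 * int L + c))")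
    case True
    with bc show ?thesis
      by (intro exI[of _ "b + c"] exI[of _ "b + 2 * int L + c"]) (auto simp: L[symmetric] f_def)
  next
    case False
    with * bc show ?thesis
      by (intro exI[of _ "b + 2 * int L + c"] exI[of _ "b + 3 * int L + c"]) (auto simp: L[symmetric] f_def)
  qed
qed

lemma segment_gordon:
  assumes params: "(t, u, v, w) \<in> params" and n: "n > 0" and seg: "segment \<Gamma> n Q"
    and eig: "laplacian \<Gamma> t u v w \<phi> = (\<lambda>p. l * \<phi> p)"
    and i: "- (2 ^ n) \<le> i" "i < 2 ^ n"
  shows "\<exists>i1 i2. \<bar>i1 - i\<bar> \<ge> 2 ^ n \<and> \<bar>i2 - i\<bar> \<ge> 2 ^ n \<and> {i1, i2} \<subseteq> {- 2 * 2 ^ n..<2 * 2 ^ n} \<and>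
    cmod (\<phi> (Q i)) \<le> cmod (\<phi> (Q i1)) + cmod (\<phi> (Q i2))"
proof (cases "i < 0")
  case True
  then show ?thesis using segment_gordon_left[OF params n seg eig] i by blast
next
  case False
  then obtain i1 i2 where "\<bar>i1 - (- 1 - i)\<bar> \<ge> 2 ^ n" "\<bar>i2 - (- 1 - i)\<bar> \<ge> 2 ^ n"
    "{i1, i2} \<subseteq> {- 2 * 2 ^ n..<2 * 2 ^ n}" "cmod (\<phi> (Q i)) \<le> cmod (\<phi> (Q (- 1 - i1))) + cmod (\<phi> (Q (- 1 - i2)))"
    using segment_gordon_left[OF params n segment_reflect[OF seg] eig, of "- 1 - i"] i by auto
  then show ?thesis
    by (intro exI[of _ "- 1 - i1"] exI[of _ "- 1 - i2"]) auto
qed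

section \<open>Local isomorphisms\<close>

definition wf_lgraph :: "'v lgraph \<Rightarrow> bool" where
  "wf_lgraph \<Gamma> \<longleftrightarrow> edges \<Gamma> \<subseteq> UNIV \<times> verts \<Gamma> \<times> verts \<Gamma>"

definition vball :: "nat \<Rightarrow> 'v lgraph \<Rightarrow> 'v \<Rightarrow> 'v set" where
  "vball n \<Gamma> x = {q \<in> verts \<Gamma>. \<exists>k\<le>n. (x, q) \<in> adjacency \<Gamma> ^^ k}"

text \<open>Isomorphism of balls with an explicit map, so that one and the same map can be
  restricted to smaller balls around other vertices.\<close>

definition ball_iso :: "nat \<Rightarrow> ('v \<Rightarrow> 'w) \<Rightarrow> 'v lgraph \<Rightarrow> 'v \<Rightarrow> 'w lgraph \<Rightarrow> 'w \<Rightarrow> bool" where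
  "ball_iso n f \<Gamma> x \<Delta> y \<longleftrightarrow> bij_betw f (vball n \<Gamma> x) (vball n \<Delta> y) \<and> f x = y \<and>
    (\<forall>s. \<forall>p\<in>vball n \<Gamma> x. \<forall>q\<in>vball n \<Gamma> x. (s, p, q) \<in> edges \<Gamma> \<longleftrightarrow> (s, f p, f q) \<in> edges \<Delta>)"

lemma rooted_iso_graph_ball:
  "rooted_iso (graph_ball n (\<Gamma>, x)) (graph_ball n (\<Delta>, y)) \<longleftrightarrow> (\<exists>f. ball_iso n f \<Gamma> x \<Delta> y)"
  unfolding rooted_iso_def graph_ball_def ball_iso_def Let_def vball_def[symmetric]
  by (simp add: bij_betw_def) (smt (verit, best) image_eqI)

lemma rooted_iso_refl: "rooted_iso R R"
  unfolding rooted_iso_def by (cases R) (auto intro!: exI[of _ id])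

lemma rooted_iso_sym:
  assumes "rooted_iso (\<Gamma>, x) (\<Delta>, y)" "x \<in> verts \<Gamma>"
  shows "rooted_iso (\<Delta>, y) (\<Gamma>, x)"
proof -
  obtain f where f: "bij_betw f (verts \<Gamma>) (verts \<Delta>)" "f x = y"
    "\<And>s p q. p \<in> verts \<Gamma> \<Longrightarrow> q \<in> verts \<Gamma> \<Longrightarrow> (s, p, q) \<in> edges \<Gamma> \<longleftrightarrow> (s, f p, f q) \<in> edges \<Delta>"
    using assms(1) by (auto simp: rooted_iso_def)
  let ?g = "inv_into (verts \<Gamma>) f"
  have "bij_betw ?g (verts \<Delta>) (verts \<Gamma>)" by (rule bij_betw_inv_into[OF f(1)])
  moreover have "?g y = x" using f(1,2) assms(2) by (metis bij_betw_imp_inj_on inv_into_f_f)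
  moreover have "(s, p, q) \<in> edges \<Delta> \<longleftrightarrow> (s, ?g p, ?g q) \<in> edges \<Gamma>"
    if "p \<in> verts \<Delta>" "q \<in> verts \<Delta>" for s p q
    using that f(3)[of "?g p" "?g q" s] bij_betw_inv_into_right[OF f(1)]
      bij_betwE[OF bij_betw_inv_into[OF f(1)]] by simp
  ultimately show ?thesis by (auto simp: rooted_iso_def)
qed

lemma rooted_iso_trans:
  assumes "rooted_iso R S" "rooted_iso S T"
  shows "rooted_iso R T"
proof -
  obtain \<Gamma> x \<Delta> y \<Theta> z where R: "R = (\<Gamma>, x)" and S: "S = (\<Delta>, y)" and T: "T = (\<Theta>, z)"
    by (metis surj_pair)
  obtain f where f: "bij_betw f (verts \<Gamma>) (verts \<Delta>)" "f x = y"
    "\<And>s p q. p \<in> verts \<Gamma> \<Longrightarrow> q \<in> verts \<Gamma> \<Longrightarrow> (s, p, q) \<in> edges \<Gamma> \<longleftrightarrow> (s, f p, f q) \<in> edges \<Delta>"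
    using assms(1) by (auto simp: rooted_iso_def R S)
  obtain g where g: "bij_betw g (verts \<Delta>) (verts \<Theta>)" "g y = z"
    "\<And>s p q. p \<in> verts \<Delta> \<Longrightarrow> q \<in> verts \<Delta> \<Longrightarrow> (s, p, q) \<in> edges \<Delta> \<longleftrightarrow> (s, g p, g q) \<in> edges \<Theta>"
    using assms(2) by (auto simp: rooted_iso_def S T)
  have "bij_betw (g \<circ> f) (verts \<Gamma>) (verts \<Theta>)" using f(1) g(1) by (rule bij_betw_trans)
  moreover have "(s, p, q) \<in> edges \<Gamma> \<longleftrightarrow> (s, g (f p), g (f q)) \<in> edges \<Theta>"
    if "p \<in> verts \<Gamma>" "q \<in> verts \<Gamma>" for s p q
    using that f(3)[of p q s] g(3)[of "f p" "f q" s] bij_betwE[OF f(1)] by blast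
  ultimately show ?thesis using f(2) g(2) by (auto simp: rooted_iso_def R T intro!: exI[of _ "g \<circ> f"])
qed

lemma relpow_in_verts:
  assumes "wf_lgraph \<Gamma>" "x \<in> verts \<Gamma>" "(x, q) \<in> adjacency \<Gamma> ^^ k"
  shows "q \<in> verts \<Gamma>"
  using assms by (cases k) (auto simp: wf_lgraph_def adjacency_def)

lemma in_vball:
  assumes "wf_lgraph \<Gamma>" "x \<in> verts \<Gamma>" "(x, q) \<in> adjacency \<Gamma> ^^ k" "k \<le> n"
  shows "q \<in> vball n \<Gamma> x"
  using assms relpow_in_verts[OF assms(1-3)] by (auto simp: vball_def)

lemma relpow_add_trans: "(x, y) \<in> R ^^ m \<Longrightarrow> (y, z) \<in> R ^^ k \<Longrightarrow> (x, z) \<in> R ^^ (m + k)"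
  by (auto simp: relpow_add)

lemma ball_iso_sym:
  assumes "ball_iso n f \<Gamma> x \<Delta> y" "x \<in> verts \<Gamma>"
  obtains g where "ball_iso n g \<Delta> y \<Gamma> x" "\<And>p. p \<in> vball n \<Gamma> x \<Longrightarrow> g (f p) = p"
    "\<And>q. q \<in> vball n \<Delta> y \<Longrightarrow> f (g q) = q"
proof
  let ?g = "inv_into (vball n \<Gamma> x) f"
  have bij: "bij_betw f (vball n \<Gamma> x) (vball n \<Delta> y)" and fx: "f x = y"
    and e: "\<And>s p q. p \<in> vball n \<Gamma> x \<Longrightarrow> q \<in> vball n \<Gamma> x \<Longrightarrow> (s, p, q) \<in> edges \<Gamma> \<longleftrightarrow> (s, f p, f q) \<in> edges \<Delta>"
    using assms(1) by (auto simp: ball_iso_def)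
  have x: "x \<in> vball n \<Gamma> x" using assms(2) by (auto simp: vball_def intro!: exI[of _ 0])
  show gf: "?g (f p) = p" if "p \<in> vball n \<Gamma> x" for p using bij that by (simp add: bij_betw_inv_into_left)
  show fg: "f (?g q) = q" if "q \<in> vball n \<Delta> y" for q using bij that by (simp add: bij_betw_inv_into_right)
  have bij': "bij_betw ?g (vball n \<Delta> y) (vball n \<Gamma> x)" by (rule bij_betw_inv_into[OF bij])
  have "(s, p, q) \<in> edges \<Delta> \<longleftrightarrow> (s, ?g p, ?g q) \<in> edges \<Gamma>"
    if "p \<in> vball n \<Delta> y" "q \<in> vball n \<Delta> y" for s p q
    using that e[of "?g p" "?g q" s] fg bij_betwE[OF bij'] by simp
  with bij' gf[OF x] fx show "ball_iso n ?g \<Delta> y \<Gamma> x" by (simp add: ball_iso_def)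
qed

text \<open>A walk of length k that starts within distance m of the root never leaves the ball, and
  inside the ball the map preserves edges.\<close>

lemma ball_iso_relpow:
  assumes "ball_iso n f \<Gamma> x \<Delta> y" "wf_lgraph \<Gamma>" "x \<in> verts \<Gamma>"
    and "(x, p) \<in> adjacency \<Gamma> ^^ m" "(p, q) \<in> adjacency \<Gamma> ^^ k" "m + k \<le> n"
  shows "(f p, f q) \<in> adjacency \<Delta> ^^ k"
  using assms(5,6)
proof (induction k arbitrary: q)
  case (Suc k)
  then obtain q' s where q': "(p, q') \<in> adjacency \<Gamma> ^^ k" "(s, q', q) \<in> edges \<Gamma>"
    by (auto simp: adjacency_def)
  have "q' \<in> vball n \<Gamma> x"
    using in_vball[OF assms(2,3) relpow_add_trans[OF assms(4) q'(1)]] Suc.prems by simp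
  moreover have "q \<in> vball n \<Gamma> x"
    using in_vball[OF assms(2,3) relpow_add_trans[OF assms(4) Suc.prems(1)]] Suc.prems by simp
  ultimately have "(s, f q', f q) \<in> edges \<Delta>" using assms(1) q'(2) by (auto simp: ball_iso_def)
  moreover have "(f p, f q') \<in> adjacency \<Delta> ^^ k" using Suc.IH[OF q'(1)] Suc.prems by simp
  ultimately show ?case by (auto simp: adjacency_def)
qed simp

lemma ball_iso_root: "ball_iso n f \<Gamma> x \<Delta> y \<Longrightarrow> x \<in> verts \<Gamma> \<Longrightarrow> f x = y \<and> y \<in> verts \<Delta>"
proof -
  assume f: "ball_iso n f \<Gamma> x \<Delta> y" and "x \<in> verts \<Gamma>"
  then have "x \<in> vball n \<Gamma> x" by (auto simp: vball_def intro!: exI[of _ 0])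
  then have "f x \<in> vball n \<Delta> y" using f by (auto simp: ball_iso_def bij_betw_def)
  then show ?thesis using f by (simp add: ball_iso_def vball_def)
qed

lemma ball_iso_dist:
  assumes "ball_iso n f \<Gamma> x \<Delta> y" "wf_lgraph \<Gamma>" "x \<in> verts \<Gamma>" "(x, q) \<in> adjacency \<Gamma> ^^ k" "k \<le> n"
  shows "(y, f q) \<in> adjacency \<Delta> ^^ k"
  using ball_iso_relpow[OF assms(1-3) relpow_0_I assms(4)] assms(5) ball_iso_root[OF assms(1,3)] by simp

text \<open>Moving the root by m steps costs m units of radius. That the smaller ball is hit
  completely follows by applying the walk argument to the inverse map.\<close>

lemma ball_iso_restrict:
  assumes f: "ball_iso N f \<Gamma> x \<Delta> y" and wf: "wf_lgraph \<Gamma>" "wf_lgraph \<Delta>" and x: "x \<in> verts \<Gamma>"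
    and p: "(x, p) \<in> adjacency \<Gamma> ^^ m" and mn: "m + n \<le> N"
  shows "ball_iso n f \<Gamma> p \<Delta> (f p)"
proof -
  have y: "y \<in> verts \<Delta>" using ball_iso_root[OF f x] by simp
  obtain g where g: "ball_iso N g \<Delta> y \<Gamma> x" and gf: "\<And>p. p \<in> vball N \<Gamma> x \<Longrightarrow> g (f p) = p"
    and fg: "\<And>q. q \<in> vball N \<Delta> y \<Longrightarrow> f (g q) = q" using ball_iso_sym[OF f x] by blast
  have fp: "(y, f p) \<in> adjacency \<Delta> ^^ m" using ball_iso_dist[OF f wf(1) x p] mn by simp
  have sub: "vball n \<Gamma> p \<subseteq> vball N \<Gamma> x"
  proof
    fix q assume "q \<in> vball n \<Gamma> p"
    then obtain k where k: "k \<le> n" "(p, q) \<in> adjacency \<Gamma> ^^ k" by (auto simp: vball_def)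
    show "q \<in> vball N \<Gamma> x" using in_vball[OF wf(1) x relpow_add_trans[OF p k(2)]] k mn by simp
  qed
  have "f ` vball n \<Gamma> p = vball n \<Delta> (f p)"
  proof (intro antisym subsetI)
    fix q' assume "q' \<in> f ` vball n \<Gamma> p"
    then obtain q k where q: "q' = f q" "k \<le> n" "(p, q) \<in> adjacency \<Gamma> ^^ k" by (auto simp: vball_def)
    have "(f p, f q) \<in> adjacency \<Delta> ^^ k" using ball_iso_relpow[OF f wf(1) x p q(3)] q mn by simp
    then show "q' \<in> vball n \<Delta> (f p)"
      using q in_vball[OF wf(2) relpow_in_verts[OF wf(2) y fp]] by simp
  next
    fix q' assume "q' \<in> vball n \<Delta> (f p)"
    then obtain k where k: "k \<le> n" "(f p, q') \<in> adjacency \<Delta> ^^ k" by (auto simp: vball_def)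
    have "(g (f p), g q') \<in> adjacency \<Gamma> ^^ k" using ball_iso_relpow[OF g wf(2) y fp k(2)] k mn by simp
    moreover have "g (f p) = p" using gf in_vball[OF wf(1) x p] mn by simp
    ultimately have "g q' \<in> vball n \<Gamma> p" using in_vball[OF wf(1) relpow_in_verts[OF wf(1) x p]] k by simp
    moreover have "f (g q') = q'"
      using fg in_vball[OF wf(2) y relpow_add_trans[OF fp k(2)]] k mn by simp
    ultimately show "q' \<in> f ` vball n \<Gamma> p" by force
  qed
  moreover have "inj_on f (vball n \<Gamma> p)" using f sub by (auto simp: ball_iso_def bij_betw_def inj_on_subset)
  ultimately show ?thesis using f sub by (auto simp: ball_iso_def bij_betw_def subset_iff)
qed

text \<open>The strict bound on m keeps all neighbours of p within the ball; for a vertex on its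
  boundary, edges leading outwards would be lost.\<close>

lemma ball_iso_emanating:
  assumes f: "ball_iso n f \<Gamma> x \<Delta> y" and wf: "wf_lgraph \<Gamma>" "wf_lgraph \<Delta>" and x: "x \<in> verts \<Gamma>"
    and p: "(x, p) \<in> adjacency \<Gamma> ^^ m" and mn: "m < n"
  shows "emanating \<Delta> (f p) = (\<lambda>(s, q). (s, f q)) ` emanating \<Gamma> p"
proof (intro antisym subsetI)
  have pv: "p \<in> vball n \<Gamma> x" using in_vball[OF wf(1) x p] mn by simp
  { fix e assume "e \<in> emanating \<Delta> (f p)"
    then obtain s q' where e: "e = (s, q')" "(s, f p, q') \<in> edges \<Delta>" by (auto simp: emanating_def)
    have "(y, f p) \<in> adjacency \<Delta> ^^ m" using ball_iso_dist[OF f wf(1) x p] mn by simp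
    then have "(y, q') \<in> adjacency \<Delta> ^^ Suc m" using e(2) by (auto simp: adjacency_def)
    then have "q' \<in> vball n \<Delta> y" using in_vball[OF wf(2) _ _, of y q' "Suc m" n] ball_iso_root[OF f x] mn by simp
    then have "q' \<in> f ` vball n \<Gamma> x" using f by (auto simp: ball_iso_def bij_betw_def)
    then obtain q where q: "q \<in> vball n \<Gamma> x" "q' = f q" by blast
    then have "(s, p, q) \<in> edges \<Gamma>" using f pv e(2) by (auto simp: ball_iso_def)
    then show "e \<in> (\<lambda>(s, q). (s, f q)) ` emanating \<Gamma> p" using e q by (force simp: emanating_def) }
  { fix e assume "e \<in> (\<lambda>(s, q). (s, f q)) ` emanating \<Gamma> p"
    then obtain s q where e: "e = (s, f q)" "(s, p, q) \<in> edges \<Gamma>" by (auto simp: emanating_def)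
    then have "(x, q) \<in> adjacency \<Gamma> ^^ Suc m" using p by (auto simp: adjacency_def)
    from in_vball[OF wf(1) x this, of n] have "q \<in> vball n \<Gamma> x" using mn by simp
    then show "e \<in> emanating \<Delta> (f p)" using e pv f by (auto simp: emanating_def ball_iso_def) }
qed

lemma ball_iso_mono:
  assumes "ball_iso N f \<Gamma> x \<Delta> y" "wf_lgraph \<Gamma>" "wf_lgraph \<Delta>" "x \<in> verts \<Gamma>" "n \<le> N"
  shows "ball_iso n f \<Gamma> x \<Delta> y"
  using ball_iso_restrict[OF assms(1-4) relpow_0_I, of n] assms(5) ball_iso_root[OF assms(1,4)] by simp

lemma rooted_iso_imp_ball_iso:
  assumes "rooted_iso (\<Gamma>, x) (\<Delta>, y)" "wf_lgraph \<Gamma>" "wf_lgraph \<Delta>" "x \<in> verts \<Gamma>"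
  shows "\<exists>f. ball_iso n f \<Gamma> x \<Delta> y"
proof -
  obtain f where f: "bij_betw f (verts \<Gamma>) (verts \<Delta>)" "f x = y"
    "\<And>s p q. p \<in> verts \<Gamma> \<Longrightarrow> q \<in> verts \<Gamma> \<Longrightarrow> (s, p, q) \<in> edges \<Gamma> \<longleftrightarrow> (s, f p, f q) \<in> edges \<Delta>"
    using assms(1) by (auto simp: rooted_iso_def)
  have adj: "(p, q) \<in> adjacency \<Gamma> \<longleftrightarrow> (f p, f q) \<in> adjacency \<Delta>" if "p \<in> verts \<Gamma>" "q \<in> verts \<Gamma>" for p q
    using f(3)[OF that] by (auto simp: adjacency_def)
  have 1: "(f x, f q) \<in> adjacency \<Delta> ^^ k" if "(x, q) \<in> adjacency \<Gamma> ^^ k" for q k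
    using that
  proof (induction k arbitrary: q)
    case (Suc k)
    then obtain q' where q': "(x, q') \<in> adjacency \<Gamma> ^^ k" "(q', q) \<in> adjacency \<Gamma>" by auto
    have "(f q', f q) \<in> adjacency \<Delta>"
      using adj q' relpow_in_verts[OF assms(2,4)] Suc.prems by blast
    with Suc.IH[OF q'(1)] show ?case by auto
  qed simp
  have y: "y \<in> verts \<Delta>" using f(1,2) assms(4) by (auto simp: bij_betw_def)
  have 2: "\<exists>q. (x, q) \<in> adjacency \<Gamma> ^^ k \<and> q' = f q" if "(y, q') \<in> adjacency \<Delta> ^^ k" for q' k
    using that
  proof (induction k arbitrary: q')
    case (Suc k)
    then obtain r' where r': "(y, r') \<in> adjacency \<Delta> ^^ k" "(r', q') \<in> adjacency \<Delta>" by auto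
    then obtain r where r: "(x, r) \<in> adjacency \<Gamma> ^^ k" "r' = f r" using Suc.IH by blast
    obtain q where q: "q \<in> verts \<Gamma>" "q' = f q"
      using f(1) relpow_in_verts[OF assms(3) y Suc.prems] by (auto simp: bij_betw_def)
    have "(r, q) \<in> adjacency \<Gamma>" using adj[of r q] relpow_in_verts[OF assms(2,4) r(1)] q r' r by simp
    with r(1) q(2) show ?case by auto
  qed (use f(2) in auto)
  have "f ` vball n \<Gamma> x = vball n \<Delta> y"
  proof (intro antisym subsetI)
    fix q' assume "q' \<in> f ` vball n \<Gamma> x"
    then show "q' \<in> vball n \<Delta> y" using 1 f(1,2) by (fastforce simp: vball_def bij_betw_def)
  next
    fix q' assume "q' \<in> vball n \<Delta> y"
    then obtain k where "k \<le> n" "(y, q') \<in> adjacency \<Delta> ^^ k" by (auto simp: vball_def)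
    then obtain q where "(x, q) \<in> adjacency \<Gamma> ^^ k" "q' = f q" "k \<le> n" using 2 by blast
    then show "q' \<in> f ` vball n \<Gamma> x" using in_vball[OF assms(2,4)] by blast
  qed
  moreover have "inj_on f (vball n \<Gamma> x)" using f(1) by (auto simp: bij_betw_def vball_def intro: inj_on_subset)
  ultimately have "ball_iso n f \<Gamma> x \<Delta> y" using f(2,3) by (auto simp: ball_iso_def bij_betw_def vball_def)
  then show ?thesis by blast
qed

lemma ball_iso_comp:
  assumes "ball_iso n f \<Gamma> x \<Delta> y" "ball_iso n g \<Delta> y \<Theta> z"
  shows "ball_iso n (g \<circ> f) \<Gamma> x \<Theta> z"
proof -
  have "\<forall>p\<in>vball n \<Gamma> x. f p \<in> vball n \<Delta> y" using assms(1) by (auto simp: ball_iso_def bij_betw_def)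
  then show ?thesis using assms unfolding ball_iso_def by (auto intro: bij_betw_trans)
qed

section \<open>Vanishing of eigenfunctions\<close>

lemma verts_schreier [simp]: "verts (schreier \<xi>) = orbit \<xi>"
  by (simp add: schreier_def)

lemma edges_schreier [simp]: "(s, p, q) \<in> edges (schreier \<xi>) \<longleftrightarrow> p \<in> orbit \<xi> \<and> q = sact s p"
  using sact_in_orbit[of p \<xi> s] by (auto simp: schreier_def sact_def)

lemma wf_schreier: "wf_lgraph (schreier \<xi>)"
  by (auto simp: wf_lgraph_def sact_in_orbit)

lemma emanating_schreier: "p \<in> orbit \<xi> \<Longrightarrow> emanating (schreier \<xi>) p = range (\<lambda>s. (s, sact s p))"
  by (auto simp: emanating_def)

lemma schreier_cong: "p \<in> orbit \<xi> \<Longrightarrow> schreier p = schreier \<xi>"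
  by (simp add: schreier_def orbit_cong)

lemma relpow_schreier:
  assumes "p \<in> orbit \<xi>"
  shows "(p, q) \<in> adjacency (schreier \<xi>) ^^ k \<longleftrightarrow> (\<exists>l. length l = k \<and> q = wact l p)"
proof (induction k arbitrary: q)
  case (Suc k)
  show ?case
  proof
    assume "(p, q) \<in> adjacency (schreier \<xi>) ^^ Suc k"
    then obtain r s where "(p, r) \<in> adjacency (schreier \<xi>) ^^ k" "q = sact s r"
      by (auto simp: adjacency_def)
    then obtain l where "length l = k" "q = sact s (wact l p)" using Suc.IH[of r] by auto
    then have "length (s # l) = Suc k \<and> q = wact (s # l) p" by simp
    then show "\<exists>l. length l = Suc k \<and> q = wact l p" by blast
  next
    assume "\<exists>l. length l = Suc k \<and> q = wact l p"
    then obtain s l where l: "length l = k" "q = sact s (wact l p)" by (auto simp: length_Suc_conv)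
    then have "(p, wact l p) \<in> adjacency (schreier \<xi>) ^^ k" using Suc.IH[of "wact l p"] by auto
    moreover have "(wact l p, q) \<in> adjacency (schreier \<xi>)"
      using l wact_in_orbit[OF assms] by (auto simp: adjacency_def)
    ultimately show "(p, q) \<in> adjacency (schreier \<xi>) ^^ Suc k" by auto
  qed
qed auto

lemma schreier_reachable:
  assumes "p \<in> orbit \<xi>" "q \<in> orbit \<xi>"
  shows "\<exists>k. (p, q) \<in> adjacency (schreier \<xi>) ^^ k"
proof -
  have "q \<in> orbit p" using assms orbit_cong by simp
  then obtain l where "q = wact l p" by (auto simp: orbit_eq)
  then show ?thesis using relpow_schreier[OF assms(1)] by blast
qed

lemma segment_adjacent:
  assumes seg: "segment \<Gamma> n Q" and i: "- 2 * 2 ^ n < i" "i < 2 * 2 ^ n - 1"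
  shows "(Q i, q) \<in> adjacency \<Gamma> \<Longrightarrow> \<exists>i'. \<bar>i' - i\<bar> \<le> 1 \<and> q = Q i'"
    and "(Q i, Q (i + 1)) \<in> adjacency \<Gamma>" "(Q i, Q (i - 1)) \<in> adjacency \<Gamma>"
proof -
  have em: "emanating \<Gamma> (Q i) = range (\<lambda>s. (s, segment_nbr n Q i s))"
    using seg i by (simp add: segment_def)
  show "\<exists>i'. \<bar>i' - i\<bar> \<le> 1 \<and> q = Q i'" if adj: "(Q i, q) \<in> adjacency \<Gamma>"
  proof -
    obtain s where "(s, q) \<in> emanating \<Gamma> (Q i)" using adj by (auto simp: adjacency_def emanating_def)
    then have "q = segment_nbr n Q i s" using em by auto
    moreover have "\<exists>i'\<in>{i - 1, i, i + 1}. segment_nbr n Q i s = Q i'"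
      by (auto simp: segment_nbr_def)
    ultimately obtain i' where "i' \<in> {i - 1, i, i + 1}" "q = Q i'" by metis
    then show ?thesis by (intro exI[of _ i']) auto
  qed
  let ?k = "ruler n (if even i then i else i + 1)"
  have "\<exists>s. s \<noteq> gen_a \<and> s \<noteq> lab ?k" by (cases "lab ?k = gen_b") auto
  then obtain s where s: "s \<noteq> gen_a" "s \<noteq> lab ?k" by blast
  have edge: "(Q i, segment_nbr n Q i r) \<in> adjacency \<Gamma>" for r
    using em by (auto simp: adjacency_def emanating_def set_eq_iff)
  show "(Q i, Q (i + 1)) \<in> adjacency \<Gamma>" "(Q i, Q (i - 1)) \<in> adjacency \<Gamma>"
    using edge[of gen_a] edge[of s] s by (auto simp: segment_nbr_def split: if_splits)
qed

lemma segment_dist: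
  assumes seg: "segment \<Gamma> n Q" and i: "- 2 * 2 ^ n < i" "i < 2 * 2 ^ n - 1"
    and i': "- 2 * 2 ^ n \<le> i'" "i' < 2 * 2 ^ n"
  shows "(Q i, Q i') \<in> adjacency \<Gamma> ^^ nat \<bar>i' - i\<bar>"
proof -
  have up: "i + int k < 2 * 2 ^ n \<Longrightarrow> (Q i, Q (i + int k)) \<in> adjacency \<Gamma> ^^ k" for k
  proof (induction k)
    case (Suc k)
    then have "(Q (i + int k), Q (i + int k + 1)) \<in> adjacency \<Gamma>"
      using i by (intro segment_adjacent[OF seg]) auto
    then have "(Q i, Q (i + int k + 1)) \<in> adjacency \<Gamma> ^^ Suc k" using Suc by auto
    moreover have "i + int (Suc k) = i + int k + 1" by simp
    ultimately show ?case by (simp only:)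
  qed simp
  have down: "- 2 * 2 ^ n \<le> i - int k \<Longrightarrow> (Q i, Q (i - int k)) \<in> adjacency \<Gamma> ^^ k" for k
  proof (induction k)
    case (Suc k)
    then have "(Q (i - int k), Q (i - int k - 1)) \<in> adjacency \<Gamma>"
      using i by (intro segment_adjacent[OF seg]) auto
    then have "(Q i, Q (i - int k - 1)) \<in> adjacency \<Gamma> ^^ Suc k" using Suc by auto
    moreover have "i - int (Suc k) = i - int k - 1" by simp
    ultimately show ?case by (simp only:)
  qed simp
  show ?thesis
  proof (cases "i' \<ge> i")
    case True
    then show ?thesis using up[of "nat (i' - i)"] i' by simp
  next
    case False
    then show ?thesis using down[of "nat (i - i')"] i' by (simp add: abs_minus_commute)
  qed
qed

text \<open>Inside the segment an edge changes the position by at most one, and fewer than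
  \<open>2 ^ n\<close> steps from a central block cannot reach the ends. For injective Q this bounds
  graph distances from below by differences of positions.\<close>

lemma segment_walk:
  assumes seg: "segment \<Gamma> n Q" and i: "- (2 ^ n) \<le> i" "i < 2 ^ n"
    and k: "int k < 2 ^ n" "(Q i, q) \<in> adjacency \<Gamma> ^^ k"
  shows "\<exists>i'. \<bar>i' - i\<bar> \<le> k \<and> q = Q i'"
  using k
proof (induction k arbitrary: q)
  case (Suc k)
  then obtain r where r: "(Q i, r) \<in> adjacency \<Gamma> ^^ k" "(r, q) \<in> adjacency \<Gamma>" by auto
  have "int k < 2 ^ n" using Suc.prems(1) by linarith
  then obtain j where j: "\<bar>j - i\<bar> \<le> k" "r = Q j" using Suc.IH[OF _ r(1)] by blast
  have "- 2 * 2 ^ n < j" "j < 2 * 2 ^ n - 1" using j i Suc.prems(1) by auto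
  then obtain i' where "\<bar>i' - j\<bar> \<le> 1" "q = Q i'" using segment_adjacent(1)[OF seg] r j by blast
  then show ?case using j(1) by (intro exI[of _ i']) auto
qed auto

text \<open>The vertex has to lie in one of the two central blocks, where Gordon's estimate applies.
  Injectivity ensures that distant positions are distant vertices.\<close>

definition rich :: "'v lgraph \<Rightarrow> 'v \<Rightarrow> bool" where
  "rich \<Gamma> p \<longleftrightarrow> (\<forall>m. \<exists>n\<ge>m. \<exists>Q i. segment \<Gamma> n Q \<and> inj_on Q {- 2 * 2 ^ n..<2 * 2 ^ n} \<and>
    - (2 ^ n) \<le> i \<and> i < 2 ^ n \<and> Q i = p)"

lemma finite_large_values:
  fixes \<phi> :: "'v \<Rightarrow> complex"
  assumes "\<phi> \<in> ell2 V" "\<epsilon> > 0"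
  shows "finite {p \<in> V. cmod (\<phi> p) \<ge> \<epsilon>}"
proof (rule ccontr)
  assume inf: "infinite {p \<in> V. cmod (\<phi> p) \<ge> \<epsilon>}"
  let ?f = "\<lambda>p. (cmod (\<phi> p))\<^sup>2"
  have sum: "?f summable_on V" using assms(1) by (simp add: ell2_def)
  obtain m :: nat where m: "infsum ?f V < m * \<epsilon>\<^sup>2"
    using ex_less_of_nat_mult[of "\<epsilon>\<^sup>2" "infsum ?f V"] assms(2) by auto
  obtain F where F: "F \<subseteq> {p \<in> V. cmod (\<phi> p) \<ge> \<epsilon>}" "finite F" "card F = m"
    using infinite_arbitrarily_large[OF inf] by blast
  have "m * \<epsilon>\<^sup>2 = (\<Sum>p\<in>F. \<epsilon>\<^sup>2)" using F by simp
  also have "\<dots> \<le> (\<Sum>p\<in>F. ?f p)" using F assms(2) by (intro sum_mono power_mono) auto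
  also have "\<dots> \<le> infsum ?f V" using F sum by (intro finite_sum_le_infsum) auto
  finally show False using m by simp
qed

text \<open>If \<phi> p were nonzero, only finitely many vertices would carry at least half of its
  modulus, all within some distance D. As soon as \<open>2 ^ n\<close> exceeds D, both values in
  Gordon's estimate are below one half, and their sum is too small.\<close>

lemma rich_vanish:
  assumes params: "(t, u, v, w) \<in> params" and rich: "rich \<Gamma> p"
    and reach: "\<And>q. q \<in> verts \<Gamma> \<Longrightarrow> \<exists>k. (p, q) \<in> adjacency \<Gamma> ^^ k"
    and \<phi>: "\<phi> \<in> ell2 (verts \<Gamma>)" "laplacian \<Gamma> t u v w \<phi> = (\<lambda>p. l * \<phi> p)"
  shows "\<phi> p = 0"
proof (rule ccontr)
  assume nz: "\<phi> p \<noteq> 0"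
  define \<epsilon> where "\<epsilon> = cmod (\<phi> p) / 2"
  define F where "F = {q \<in> verts \<Gamma>. cmod (\<phi> q) \<ge> \<epsilon>}"
  have \<epsilon>: "\<epsilon> > 0" using nz by (simp add: \<epsilon>_def)
  then have "finite F" unfolding F_def using finite_large_values[OF \<phi>(1)] by blast
  then have "\<exists>D. \<forall>q\<in>F. \<exists>k\<le>D. (p, q) \<in> adjacency \<Gamma> ^^ k"
  proof -
    obtain d where d: "\<And>q. q \<in> verts \<Gamma> \<Longrightarrow> (p, q) \<in> adjacency \<Gamma> ^^ d q" using reach by metis
    have "\<forall>q\<in>F. d q \<le> Max (d ` F) \<and> (p, q) \<in> adjacency \<Gamma> ^^ d q"
      using d \<open>finite F\<close> by (auto simp: F_def)
    then show ?thesis by blast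
  qed
  then obtain D where D: "\<And>q. q \<in> F \<Longrightarrow> \<exists>k\<le>D. (p, q) \<in> adjacency \<Gamma> ^^ k" by blast
  obtain n Q i where n: "n \<ge> Suc D" and seg: "segment \<Gamma> n Q" and inj: "inj_on Q {- 2 * 2 ^ n..<2 * 2 ^ n}"
    and i: "- (2 ^ n) \<le> i" "i < 2 ^ n" "Q i = p"
    using rich unfolding rich_def by meson
  have DL: "int D < 2 ^ n"
  proof -
    have "D < 2 ^ n" using n less_exp[of n] by linarith
    then have "int D < int (2 ^ n)" by linarith
    then show ?thesis by simp
  qed
  have far: "cmod (\<phi> (Q j)) < \<epsilon>" if j: "\<bar>j - i\<bar> \<ge> 2 ^ n" "j \<in> {- 2 * 2 ^ n..<2 * 2 ^ n}" for j
  proof (rule ccontr)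
    assume "\<not> ?thesis"
    moreover have "Q j \<in> verts \<Gamma>" using seg j by (auto simp: segment_def)
    ultimately have "Q j \<in> F" by (simp add: F_def)
    then obtain k where k: "k \<le> D" "(p, Q j) \<in> adjacency \<Gamma> ^^ k" using D by blast
    then have "int k < 2 ^ n" using DL by linarith
    with k obtain i' where i': "\<bar>i' - i\<bar> \<le> k" "Q j = Q i'"
      using segment_walk[OF seg i(1,2), of k "Q j"] DL i(3) by auto
    have "i' \<in> {- 2 * 2 ^ n..<2 * 2 ^ n}" unfolding atLeastLessThan_iff
      using i'(1) i(1,2) \<open>int k < 2 ^ n\<close> by linarith
    then have "j = i'" using inj_onD[OF inj i'(2)] j by blast
    with i' k DL j show False by linarith
  qed
  have "n > 0" using n by simp
  then obtain i1 i2 where "\<bar>i1 - i\<bar> \<ge> 2 ^ n" "\<bar>i2 - i\<bar> \<ge> 2 ^ n" "{i1, i2} \<subseteq> {- 2 * 2 ^ n..<2 * 2 ^ n}"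
    "cmod (\<phi> (Q i)) \<le> cmod (\<phi> (Q i1)) + cmod (\<phi> (Q i2))"
    using segment_gordon[OF params _ seg \<phi>(2) i(1,2)] by blast
  then have "cmod (\<phi> p) < \<epsilon> + \<epsilon>" using far[of i1] far[of i2] i(3) by auto
  then show False by (simp add: \<epsilon>_def)
qed

lemma no_eigenvalues_if_rich:
  assumes params: "(t, u, v, w) \<in> params" and rich: "\<And>p. p \<in> verts \<Gamma> \<Longrightarrow> rich \<Gamma> p"
    and reach: "\<And>p q. p \<in> verts \<Gamma> \<Longrightarrow> q \<in> verts \<Gamma> \<Longrightarrow> \<exists>k. (p, q) \<in> adjacency \<Gamma> ^^ k"
  shows "\<not> laplacian_has_eigenvalues \<Gamma> t u v w"
proof
  assume "laplacian_has_eigenvalues \<Gamma> t u v w"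
  then obtain l \<phi> where \<phi>: "\<phi> \<in> ell2 (verts \<Gamma>)" "\<phi> \<noteq> (\<lambda>_. 0)" "laplacian \<Gamma> t u v w \<phi> = (\<lambda>p. l * \<phi> p)"
    by (auto simp: laplacian_has_eigenvalues_def has_eigenvalues_def)
  have "\<phi> p = 0" for p
  proof (cases "p \<in> verts \<Gamma>")
    case True
    then show ?thesis using rich_vanish[OF params rich reach \<phi>(1,3)] by blast
  next
    case False
    then show ?thesis using \<phi>(1) by (simp add: ell2_def)
  qed
  with \<phi>(2) show False by auto
qed

text \<open>From a central block, every position of the segment is at most 3L - 1 steps away, where
  L = \<open>2 ^ n\<close>. The radius 4L therefore also contains the neighbours of all vertices of
  the segment.\<close>

lemma segment_ball_iso:
  assumes seg: "segment \<Gamma> n Q" and inj: "inj_on Q {- 2 * 2 ^ n..<2 * 2 ^ n}"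
    and i: "- (2 ^ n) \<le> i" "i < 2 ^ n" "Q i = p" and n: "n > 0"
    and f: "ball_iso (4 * 2 ^ n) f \<Gamma> p \<Delta> y" and wf: "wf_lgraph \<Gamma>" "wf_lgraph \<Delta>"
  shows "segment \<Delta> n (f \<circ> Q) \<and> inj_on (f \<circ> Q) {- 2 * 2 ^ n..<2 * 2 ^ n} \<and> (f \<circ> Q) i = y"
proof -
  have L2: "(2 :: int) ^ n \<ge> 2" using n power_increasing[of 1 n "2 :: int"] by simp
  have p: "p \<in> verts \<Gamma>" using seg i L2 by (auto simp: segment_def)
  have dist: "(p, Q j) \<in> adjacency \<Gamma> ^^ nat \<bar>j - i\<bar>" "nat \<bar>j - i\<bar> < 4 * 2 ^ n"
    if "- 2 * 2 ^ n \<le> j" "j < 2 * 2 ^ n" for j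
  proof -
    show "(p, Q j) \<in> adjacency \<Gamma> ^^ nat \<bar>j - i\<bar>"
      using segment_dist[OF seg _ _ that, of i] i L2 by auto
    show "nat \<bar>j - i\<bar> < 4 * 2 ^ n" using that i by (auto simp: nat_less_iff)
  qed
  have vb: "Q j \<in> vball (4 * 2 ^ n) \<Gamma> p" if "- 2 * 2 ^ n \<le> j" "j < 2 * 2 ^ n" for j
    using in_vball[OF wf(1) p dist(1)[OF that]] dist(2)[OF that] by simp
  have "inj_on f (vball (4 * 2 ^ n) \<Gamma> p)" using f by (simp add: ball_iso_def bij_betw_def)
  then have "inj_on f (Q ` {- 2 * 2 ^ n..<2 * 2 ^ n})" using vb by (elim inj_on_subset) auto
  then have "inj_on (f \<circ> Q) {- 2 * 2 ^ n..<2 * 2 ^ n}" using inj by (rule comp_inj_on[rotated])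
  moreover have "segment \<Delta> n (f \<circ> Q)"
    unfolding segment_def
  proof (intro conjI allI impI)
    fix j assume "- 2 * 2 ^ n \<le> j \<and> j < 2 * (2 :: int) ^ n"
    then have "f (Q j) \<in> vball (4 * 2 ^ n) \<Delta> y" using vb f by (auto simp: ball_iso_def bij_betw_def)
    then show "(f \<circ> Q) j \<in> verts \<Delta>" by (simp add: vball_def)
  next
    fix j assume j: "- 2 * 2 ^ n < j \<and> j < 2 * (2 :: int) ^ n - 1"
    have nbr: "segment_nbr n (f \<circ> Q) j s = f (segment_nbr n Q j s)" for s
      by (simp add: segment_nbr_def)
    have "emanating \<Delta> (f (Q j)) = (\<lambda>(s, q). (s, f q)) ` emanating \<Gamma> (Q j)"
      using ball_iso_emanating[OF f wf p dist(1)] dist(2) j by auto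
    also have "\<dots> = range (\<lambda>s. (s, segment_nbr n (f \<circ> Q) j s))"
      using seg j unfolding nbr by (simp add: segment_def image_image)
    finally show "emanating \<Delta> ((f \<circ> Q) j) = range (\<lambda>s. (s, segment_nbr n (f \<circ> Q) j s))" by simp
  qed
  ultimately show ?thesis using i(3) f by (simp add: ball_iso_def)
qed

section \<open>Segments in Schreier graphs from the letters 1, 1, 0, 1\<close>

definition pattern :: "nat \<Rightarrow> (nat \<Rightarrow> bool) \<Rightarrow> bool" where
  "pattern n \<xi> \<longleftrightarrow> \<xi> n \<and> \<xi> (n + 1) \<and> \<not> \<xi> (n + 2) \<and> \<xi> (n + 3)"

text \<open>Off the multiples of \<open>2 ^ n\<close>, adding \<open>8 * 2 ^ n\<close> leaves the
  valuation unchanged. Among the multiples, the centre is the one joint where only the label agrees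
  and not the valuation; the strict bounds exclude the joints 6 and 10.\<close>

lemma lab_ruler:
  fixes m :: int
  assumes "- 2 * 2 ^ n < m" "m < 2 * 2 ^ n"
  shows "lab (multiplicity 2 (8 * 2 ^ n + m)) = lab (ruler n m)"
proof (cases "2 ^ n dvd m")
  case True
  then obtain c where c: "m = 2 ^ n * c" by auto
  have "- 2 < c" "c < 2"
  proof -
    have "(2 :: int) ^ n * (- 2) < 2 ^ n * c" "(2 :: int) ^ n * c < 2 ^ n * 2" using assms c by simp_all
    then show "- 2 < c" "c < 2" by (simp_all only: mult_less_cancel_left_pos zero_less_power zero_less_numeral)
  qed
  then have "c = - 1 \<or> c = 0 \<or> c = 1" by linarith
  moreover have "multiplicity 2 (8 * 2 ^ n + m) = n" if "c = - 1 \<or> c = 1"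
  proof -
    have "8 * 2 ^ n + m = 2 ^ n * (8 + c)" by (simp add: c algebra_simps)
    moreover have "odd (8 + c)" using that by auto
    ultimately show ?thesis using mult_2_eqI by metis
  qed
  moreover have "multiplicity 2 (8 * 2 ^ n + m) = n + 3" if "c = 0"
  proof -
    have "8 * 2 ^ n + m = 2 ^ (n + 3) * 1" by (simp add: c that power_add)
    then show ?thesis using mult_2_eqI odd_one by metis
  qed
  ultimately show ?thesis using True by (auto simp: ruler_def)
next
  case False
  then have "\<not> 2 ^ n dvd 8 * 2 ^ n + m" by (simp add: dvd_add_right_iff)
  then have "ruler n (8 * 2 ^ n + m) = multiplicity 2 (8 * 2 ^ n + m)" by (simp add: ruler_def)
  moreover have "ruler n (8 * 2 ^ n + m) = ruler n m" using ruler_add[of n m 8] by (simp add: algebra_simps)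
  ultimately show ?thesis by simp
qed

lemma pattern_index:
  assumes "pattern n \<xi>"
  shows "\<exists>j. 7 * 2 ^ n \<le> j \<and> j < 8 * 2 ^ n \<and> gpath (n + 4) \<xi> j = \<xi>"
proof -
  obtain j where j: "0 \<le> j" "j < 2 ^ n" "\<forall>i<n. gray j i = \<xi> i" using gray_surj by blast
  \<comment> \<open>Block 7 has an odd number, so the Gray code runs through its low letters
    backwards; the offset in the block is the reflection of j.\<close>
  define r where "r = 2 ^ n - 1 - j"
  have r: "0 \<le> r" "r < 2 ^ n" using j by (auto simp: r_def)
  let ?j = "7 * 2 ^ n + r"
  have "gray ?j i = \<xi> i" if i: "i < n" for i
  proof -
    have "?j = 2 ^ Suc n * 4 + (- 1 - j)" by (simp add: r_def algebra_simps)
    then show ?thesis using gray_period[OF i, of 4 "- 1 - j"] gray_reflect[of j] j i by simp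
  qed
  moreover have "gray ?j n"
  proof -
    have "(?j + 2 ^ n) div 2 ^ Suc n = 4" using r by (intro int_div_pos_eq[where r = r]) auto
    then show ?thesis by (simp add: gray_def)
  qed
  moreover have "gray ?j (n + 1)"
  proof -
    have "(?j + 2 ^ (n + 1)) div 2 ^ Suc (n + 1) = 2"
      using r by (intro int_div_pos_eq[where r = "2 ^ n + r"]) auto
    then show ?thesis by (simp add: gray_def)
  qed
  moreover have "\<not> gray ?j (n + 2)"
  proof -
    have "(?j + 2 ^ (n + 2)) div 2 ^ Suc (n + 2) = 1"
      using r by (intro int_div_pos_eq[where r = "3 * 2 ^ n + r"]) (auto simp: power_add)
    then show ?thesis by (simp add: gray_def)
  qed
  moreover have "gray ?j (n + 3)"
  proof -
    have "(?j + 2 ^ (n + 3)) div 2 ^ Suc (n + 3) = 0"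
      using r by (intro div_pos_pos_trivial) (auto simp: power_add)
    then show ?thesis by (simp add: gray_def)
  qed
  ultimately have digits: "gray ?j i = \<xi> i" if "i < n + 4" for i
  proof -
    have "i < n \<or> i = n \<or> i = n + 1 \<or> i = n + 2 \<or> i = n + 3" using that by linarith
    then show ?thesis
      using assms \<open>\<And>i. i < n \<Longrightarrow> gray ?j i = \<xi> i\<close> \<open>gray ?j n\<close> \<open>gray ?j (n + 1)\<close>
        \<open>\<not> gray ?j (n + 2)\<close> \<open>gray ?j (n + 3)\<close> unfolding pattern_def by metis
  qed
  have "gpath (n + 4) \<xi> ?j = \<xi>" using digits by (auto simp: gpath_def fun_eq_iff)
  with r show ?thesis by (intro exI[of _ ?j]) auto
qed

text \<open>The generator is chosen before the tail. This uniformity lets a single generator carry a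
  whole cylinder to the next one, as needed for test words and for invariant measures.\<close>

lemma gpath_edge:
  assumes "0 \<le> j" "j + 1 < 2 ^ N"
  shows "\<exists>s. \<forall>\<zeta>. sact s (gpath N \<zeta> j) = gpath N \<zeta> (j + 1)"
proof (cases "even j")
  case True
  have "N > 0" using assms by (cases N) auto
  then show ?thesis using gpath_a[OF True] by blast
next
  case False
  let ?k = "multiplicity 2 (j + 1)"
  have "\<exists>s. s \<noteq> gen_a \<and> s \<noteq> lab ?k" by (cases "lab ?k = gen_b") auto
  then show ?thesis using gpath_bcd(1)[OF False _ assms(2)] assms(1) by force
qed

lemma gpath_walk:
  assumes "0 \<le> j" "j + int k < 2 ^ N"
  shows "\<exists>l. length l = k \<and> (\<forall>\<zeta>. wact l (gpath N \<zeta> j) = gpath N \<zeta> (j + int k))"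
  using assms(2)
proof (induction k)
  case (Suc k)
  then obtain l where "length l = k" "\<forall>\<zeta>. wact l (gpath N \<zeta> j) = gpath N \<zeta> (j + int k)" by auto
  moreover obtain s where "\<forall>\<zeta>. sact s (gpath N \<zeta> (j + int k)) = gpath N \<zeta> (j + int k + 1)"
    using gpath_edge[of "j + int k" N] Suc.prems assms(1) by auto
  moreover have "j + int (Suc k) = j + int k + 1" by simp
  ultimately have "length (s # l) = Suc k \<and> (\<forall>\<zeta>. wact (s # l) (gpath N \<zeta> j) = gpath N \<zeta> (j + int (Suc k)))"
    by (simp only: wact_Cons list.size) simp
  then show ?case by blast
qed simp

lemma gpath_orbit:
  assumes "0 \<le> j" "j < 2 ^ N" "0 \<le> j'" "j' < 2 ^ N"
  shows "gpath N \<zeta> j' \<in> orbit (gpath N \<zeta> j)"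
proof -
  have *: "gpath N \<zeta> b \<in> orbit (gpath N \<zeta> a)" if ab: "0 \<le> a" "a \<le> b" "b < 2 ^ N" for a b
  proof -
    have "a + int (nat (b - a)) = b" using ab by simp
    then obtain l where "wact l (gpath N \<zeta> a) = gpath N \<zeta> b"
      using gpath_walk[of a "nat (b - a)" N] ab(1,3) by metis
    then show ?thesis unfolding orbit_eq by (metis rangeI)
  qed
  show ?thesis using *[of j j'] *[of j' j] assms orbit_cong self_in_orbit by (metis linorder_linear)
qed

lemma pattern_segment:
  assumes pat: "pattern n \<xi>" and n: "n > 0"
  obtains Q i where "segment (schreier \<xi>) n Q" "inj_on Q {- 2 * 2 ^ n..<2 * 2 ^ n}"
    "- (2 ^ n) \<le> i" "i < 2 ^ n" "Q i = \<xi>"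
proof -
  obtain j where j: "7 * 2 ^ n \<le> j" "j < 8 * 2 ^ n" "gpath (n + 4) \<xi> j = \<xi>" using pattern_index[OF pat] by blast
  define P where "P = gpath (n + 4) \<xi>"
  \<comment> \<open>Joint 8 is moved to position 0. The segment ends before
    \<open>10 * 2 ^ n\<close>, hence below \<open>2 ^ (n + 4)\<close>, so \<open>n + 4\<close>
    letters suffice to describe it.\<close>
  define Q where "Q = (\<lambda>i. P (8 * 2 ^ n + i))"
  have L16: "(2 :: int) ^ (n + 4) = 16 * 2 ^ n" by (simp add: power_add)
  have pos: "(0 :: int) < 2 ^ n" by simp
  have ev: "even (8 * 2 ^ n + i) \<longleftrightarrow> even i" for i :: int by simp
  have orb: "Q i \<in> orbit \<xi>" if "- 2 * 2 ^ n \<le> i" "i < 2 * 2 ^ n" for i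
    using gpath_orbit[of j "n + 4" "8 * 2 ^ n + i" \<xi>] j that pos unfolding L16 Q_def P_def by simp
  have "segment (schreier \<xi>) n Q"
    unfolding segment_def
  proof (intro conjI allI impI)
    show "Q i \<in> verts (schreier \<xi>)" if "- 2 * 2 ^ n \<le> i \<and> i < 2 * 2 ^ n" for i
      using orb that by simp
    fix i assume i: "- 2 * 2 ^ n < i \<and> i < 2 * (2 :: int) ^ n - 1"
    have "sact s (Q i) = segment_nbr n Q i s" for s
    proof (cases "s = gen_a")
      case True
      have "n + 4 > 0" by simp
      note a = gpath_a[OF _ this, of "8 * 2 ^ n + i" \<xi>] gpath_a[OF _ this, of "8 * 2 ^ n + i - 1" \<xi>]
      show ?thesis using a True by (cases "even i") (auto simp: segment_nbr_def Q_def P_def algebra_simps)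
    next
      case False
      define m where "m = (if even i then i else i + 1)"
      have m: "even m" "- 2 * 2 ^ n < m" "m < 2 * 2 ^ n" using i by (auto simp: m_def)
      have odd: "odd (8 * 2 ^ n + m - 1)" using m n by simp
      have "sact s (P (8 * 2 ^ n + m - 1)) = (if s = lab (ruler n m) then P (8 * 2 ^ n + m - 1) else P (8 * 2 ^ n + m))"
        "sact s (P (8 * 2 ^ n + m)) = (if s = lab (ruler n m) then P (8 * 2 ^ n + m) else P (8 * 2 ^ n + m - 1))"
        using gpath_bcd[OF odd _ _ False, of "n + 4" \<xi>] lab_ruler[OF m(2,3)] m pos unfolding P_def L16 by auto
      then show ?thesis using False by (cases "even i") (auto simp: segment_nbr_def Q_def m_def algebra_simps)
    qed
    then show "emanating (schreier \<xi>) (Q i) = range (\<lambda>s. (s, segment_nbr n Q i s))"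
      using emanating_schreier[OF orb, of i] i by auto
  qed
  moreover have "inj_on Q {- 2 * 2 ^ n..<2 * 2 ^ n}"
  proof (rule inj_onI)
    fix a b assume ab: "a \<in> {- 2 * 2 ^ n..<2 * (2 :: int) ^ n}" "b \<in> {- 2 * 2 ^ n..<2 * (2 :: int) ^ n}" "Q a = Q b"
    have "\<forall>i<n + 4. gray (8 * 2 ^ n + a) i = gray (8 * 2 ^ n + b) i"
      using ab(3) unfolding Q_def P_def gpath_def fun_eq_iff by metis
    then have "8 * 2 ^ n + a = 8 * 2 ^ n + b"
      using ab pos by (intro gray_inj[of _ "n + 4"]) (auto simp: L16)
    then show "a = b" by simp
  qed
  moreover have "Q (j - 8 * 2 ^ n) = \<xi>" using j by (simp add: Q_def P_def)
  moreover have "- (2 ^ n) \<le> j - 8 * 2 ^ n" "j - 8 * 2 ^ n < 2 ^ n" using j by auto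
  ultimately show thesis using that by blast
qed

text \<open>Each scale may come with its own sequence \<xi> and its own map; this freedom is what
  makes the criterion applicable to limits of Schreier graphs.\<close>

lemma rich_if_patterns:
  assumes wf: "wf_lgraph \<Gamma>"
    and pat: "\<And>m. \<exists>n\<ge>m. \<exists>\<xi> f. pattern n \<xi> \<and> ball_iso (4 * 2 ^ n) f (schreier \<xi>) \<xi> \<Gamma> p"
  shows "rich \<Gamma> p"
  unfolding rich_def
proof
  fix m
  obtain n \<xi> f where n: "n \<ge> Suc m" "pattern n \<xi>" and f: "ball_iso (4 * 2 ^ n) f (schreier \<xi>) \<xi> \<Gamma> p"
    using pat[of "Suc m"] by blast
  obtain Q i where Q: "segment (schreier \<xi>) n Q" "inj_on Q {- 2 * 2 ^ n..<2 * 2 ^ n}"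
    "- (2 ^ n) \<le> i" "i < 2 ^ n" "Q i = \<xi>" using pattern_segment[OF n(2)] n(1) by auto
  have "segment \<Gamma> n (f \<circ> Q) \<and> inj_on (f \<circ> Q) {- 2 * 2 ^ n..<2 * 2 ^ n} \<and> (f \<circ> Q) i = p"
    using segment_ball_iso[OF Q _ f wf_schreier wf] n(1) by simp
  then show "\<exists>n\<ge>m. \<exists>Q i. segment \<Gamma> n Q \<and> inj_on Q {- 2 * 2 ^ n..<2 * 2 ^ n} \<and>
    - (2 ^ n) \<le> i \<and> i < 2 ^ n \<and> Q i = p"
    using Q(3,4) n(1) by (intro exI[of _ n] conjI exI[of _ "f \<circ> Q"] exI[of _ i]) auto
qed

section \<open>The two-ended graphs\<close>

lemma gray_0: "gray 0 = ones"
  by (auto simp: gray_def ones_def)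

lemma gray_minus_1: "gray (- 1) = ones"
  using gray_reflect[of 0] gray_0 by simp

lemma sact_gray_a:
  assumes "even j"
  shows "sact gen_a (gray j) = gray (j + 1)" "sact gen_a (gray (j + 1)) = gray j"
proof -
  have "gray (j + 1) = (gray j)(0 := gray (j + 1) 0)"
    using gray_Suc[of j 0 "j + 1"] assms by auto
  then show "sact gen_a (gray j) = gray (j + 1)" "sact gen_a (gray (j + 1)) = gray j"
    using gray_edge_even[OF assms, of "gray j" "gray (j + 1)"] by auto
qed

lemma sact_gray_bcd:
  assumes "odd j" "j + 1 \<noteq> 0" "s \<noteq> gen_a"
  defines "k \<equiv> multiplicity 2 (j + 1)"
  shows "sact s (gray j) = (if s = lab k then gray j else gray (j + 1))"
    and "sact s (gray (j + 1)) = (if s = lab k then gray (j + 1) else gray j)"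
proof -
  obtain m where m: "j + 1 = 2 ^ k * m" "odd m" using mult_2_decomp[OF assms(2)] k_def by metis
  have "gray (j + 1) = (gray j)(k := gray (j + 1) k)"
    using gray_Suc[OF m] by auto
  then show "sact s (gray j) = (if s = lab k then gray j else gray (j + 1))"
    "sact s (gray (j + 1)) = (if s = lab k then gray (j + 1) else gray j)"
    using gray_edge_odd[OF assms(1,2) _ _ _ assms(3), of k "gray j" "gray (j + 1)"] k_def by auto
qed

lemma gray_nonneg_inj:
  assumes "0 \<le> i" "0 \<le> j" "gray i = gray j"
  shows "i = j"
proof -
  have "i < 2 ^ nat (i + j + 1)" "j < 2 ^ nat (i + j + 1)"
  proof -
    have "nat (i + j + 1) < 2 ^ nat (i + j + 1)" by (rule less_exp)
    then have "int (nat (i + j + 1)) < int (2 ^ nat (i + j + 1))" by (simp only: of_nat_less_iff)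
    then show "i < 2 ^ nat (i + j + 1)" "j < 2 ^ nat (i + j + 1)" using assms(1,2) by simp_all
  qed
  then show ?thesis using assms by (intro gray_inj[of i _ j]) auto
qed

lemma sact_gray_nonneg:
  assumes "0 \<le> j"
  shows "\<exists>j'\<ge>0. sact s (gray j) = gray j'"
proof (cases "s = gen_a")
  case True
  show ?thesis
  proof (cases "even j")
    case False
    then have "0 \<le> j - 1" using assms by presburger
    then show ?thesis using sact_gray_a(2)[of "j - 1"] False True by (intro exI[of _ "j - 1"]) auto
  qed (use sact_gray_a(1)[of j] True assms in \<open>auto intro!: exI[of _ "j + 1"]\<close>)
next
  case False
  show ?thesis
  proof (cases "even j")
    case True
    show ?thesis
    proof (cases "j = 0")
      case True
      then show ?thesis using sact_ones[OF False] gray_0 by (intro exI[of _ 0]) auto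
    next
      case j: False
      have odd: "odd (j - 1)" using True by simp
      have "sact s (gray j) = gray j \<or> sact s (gray j) = gray (j - 1)"
        using sact_gray_bcd(2)[OF odd _ False] j by auto
      moreover have "0 \<le> j - 1" using j assms by simp
      ultimately show ?thesis using assms by blast
    qed
  next
    case odd: False
    have "sact s (gray j) = gray j \<or> sact s (gray j) = gray (j + 1)"
      using sact_gray_bcd(1)[OF odd _ False] assms by auto
    then show ?thesis using assms by (metis add_nonneg_nonneg zero_le_one)
  qed
qed

text \<open>Generators move a nonnegative position by at most one, and b, c, d fix position 0, so
  the orbit is a ray that starts at \<open>ones\<close>.\<close>

lemma orbit_ones: "orbit ones = gray ` {0..}"
proof (intro antisym subsetI)
  fix p assume "p \<in> orbit ones"
  then obtain l where "p = wact l ones" by (auto simp: orbit_eq)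
  moreover have "wact l ones \<in> gray ` {0..}"
  proof (induction l)
    case Nil
    then show ?case using gray_0 by (auto intro!: image_eqI[of _ _ 0])
  next
    case (Cons s l)
    then obtain j where "j \<ge> 0" "wact l ones = gray j" by auto
    then show ?case using sact_gray_nonneg[of j s] by auto
  qed
  ultimately show "p \<in> gray ` {0..}" by simp
next
  have "gray (int n) \<in> orbit ones" for n
  proof (induction n)
    case 0
    then show ?case by (simp add: gray_0)
  next
    case (Suc n)
    have "\<exists>s. gray (int n + 1) = sact s (gray (int n))"
    proof (cases "even n")
      case True
      then show ?thesis using sact_gray_a(1)[of "int n"] by (metis even_of_nat)
    next
      case False
      let ?k = "multiplicity 2 (int n + 1)"
      have "\<exists>s. s \<noteq> gen_a \<and> s \<noteq> lab ?k" by (cases "lab ?k = gen_b") auto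
      then obtain s where "s \<noteq> gen_a" "s \<noteq> lab ?k" by blast
      then show ?thesis using sact_gray_bcd(1)[of "int n" s] False by (intro exI[of _ s]) simp
    qed
    then show ?case using Suc sact_in_orbit by (metis add.commute of_nat_Suc)
  qed
  then show "p \<in> orbit ones" if "p \<in> gray ` {0..}" for p
    using that by (metis atLeast_iff image_iff nonneg_int_cases)
qed

text \<open>
  Since \<open>gray (- 1 - j) = gray j\<close>, the two-ended graph is parametrized by the integers, and its
  two copies of the vertex \<open>ones\<close> are at 0 and -1.
\<close>

definition line :: "int \<Rightarrow> (nat \<Rightarrow> bool) \<times> bool" where
  "line i = (gray i, i < 0)"

lemma gray_in_orbit_ones: "gray i \<in> orbit ones"
proof (cases "i \<ge> 0")
  case False
  then have "gray (- 1 - i) \<in> orbit ones" unfolding orbit_ones by simp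
  then show ?thesis by (simp add: gray_reflect)
qed (simp add: orbit_ones)

lemma inj_line: "inj line"
proof (rule injI)
  fix i j assume "line i = line j"
  then have *: "gray i = gray j" "i < 0 \<longleftrightarrow> j < 0" by (auto simp: line_def)
  show "i = j"
  proof (cases "i < 0")
    case True
    then have "- 1 - i = - 1 - j" using * by (intro gray_nonneg_inj) (auto simp: gray_reflect)
    then show ?thesis by simp
  next
    case False
    then show ?thesis using * gray_nonneg_inj by auto
  qed
qed

lemma range_line: "range line = orbit ones \<times> UNIV"
proof (intro antisym subsetI)
  fix p assume "p \<in> orbit ones \<times> (UNIV :: bool set)"
  then obtain j b where j: "j \<ge> 0" "p = (gray j, b)" by (auto simp: orbit_ones)
  then have "p = line (if b then - 1 - j else j)" by (simp add: line_def gray_reflect)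
  then show "p \<in> range line" by blast
qed (auto simp: line_def gray_in_orbit_ones)

lemma gray_eq_ones_iff: "gray i = ones \<longleftrightarrow> i = 0 \<or> i = - 1"
proof
  assume "gray i = ones"
  then have "line i = line 0 \<or> line i = line (- 1)"
    by (simp add: line_def gray_0 gray_minus_1)
  then show "i = 0 \<or> i = - 1" using inj_line by (auto dest: injD)
qed (auto simp: gray_0 gray_minus_1)

lemma edges_doubled:
  "(s, (p, i), (q, k)) \<in> edges (doubled J) \<longleftrightarrow>
    (k = i \<and> p \<in> orbit ones \<and> q = sact s p \<and> \<not> (s \<in> J \<and> p = ones \<and> q = ones)) \<or>
    (s \<in> J \<and> p = ones \<and> q = ones \<and> k = (\<not> i))"
  by (auto simp: doubled_def)

lemma verts_doubled: "verts (doubled J) = range line"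
  by (simp add: doubled_def range_line)

lemma wf_doubled: "wf_lgraph (doubled J)"
  by (auto simp: wf_lgraph_def verts_doubled range_line edges_doubled sact_in_orbit)

lemma ruler_small:
  fixes m :: int
  assumes "- 2 * 2 ^ n < m" "m < 2 * 2 ^ n" "m \<noteq> 0"
  shows "ruler n m = multiplicity 2 m"
proof (cases "2 ^ n dvd m")
  case True
  then obtain c where c: "m = 2 ^ n * c" by auto
  have "(2 :: int) ^ n * (- 2) < 2 ^ n * c" "(2 :: int) ^ n * c < 2 ^ n * 2" using assms c by simp_all
  then have "- 2 < c" "c < 2" by (simp_all only: mult_less_cancel_left_pos zero_less_power zero_less_numeral)
  moreover have "c \<noteq> 0" using c assms(3) by auto
  ultimately have "odd c" by presburger
  with c True show ?thesis by (simp add: ruler_def mult_2_eqI)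
qed (simp add: ruler_def)

text \<open>At the join the kept loop carries \<open>lab n\<close>, which is the label prescribed at
  joint 0 because \<open>ruler n 0 = n\<close>. Away from the join the valuation in the segment
  never exceeds n, so truncation changes nothing.\<close>

lemma segment_doubled:
  assumes "n > 0"
  shows "segment (doubled (UNIV - {gen_a, lab n})) n line"
  unfolding segment_def
proof (intro conjI allI impI)
  let ?J = "UNIV - {gen_a, lab n}"
  show "line i \<in> verts (doubled ?J)" for i by (simp add: verts_doubled)
  fix i assume i: "- 2 * 2 ^ n < i \<and> i < 2 * (2 :: int) ^ n - 1"
  have a: "(sact gen_a (gray i), i < 0) = line (if even i then i + 1 else i - 1)"
  proof (cases "even i")
    case True
    then have "i < 0 \<longleftrightarrow> i + 1 < 0" by presburger
    with True show ?thesis using sact_gray_a(1)[of i] by (simp add: line_def)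
  next
    case False
    then have "i < 0 \<longleftrightarrow> i - 1 < 0" by presburger
    with False show ?thesis using sact_gray_a(2)[of "i - 1"] by (simp add: line_def)
  qed
  have "(s, line i, q) \<in> edges (doubled ?J) \<longleftrightarrow> q = segment_nbr n line i s" for s q
  proof (cases "s = gen_a")
    case True
    have "(s, line i, q) \<in> edges (doubled ?J) \<longleftrightarrow> q = (sact gen_a (gray i), i < 0)"
      using True by (cases q) (auto simp: line_def edges_doubled gray_in_orbit_ones)
    then show ?thesis using a True by (simp add: segment_nbr_def)
  next
    case s: False
    show ?thesis
    proof (cases "i = 0 \<or> i = - 1")
      case True
      then have "gray i = ones" by (simp add: gray_eq_ones_iff)
      then have "(s, line i, q) \<in> edges (doubled ?J) \<longleftrightarrow> q = (if s = lab n then line i else (ones, \<not> i < 0))"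
        using s gray_in_orbit_ones[of i] sact_ones[OF s] by (cases q) (auto simp: line_def edges_doubled)
      moreover have "(ones, \<not> i < 0) = line (if i = 0 then - 1 else 0)"
        using True by (auto simp: line_def gray_0 gray_minus_1)
      moreover have "ruler n 0 = n" by (simp add: ruler_def)
      ultimately show ?thesis using s True by (auto simp: segment_nbr_def)
    next
      case False
      define m where "m = (if even i then i else i + 1)"
      have m: "even m" "- 2 * 2 ^ n < m" "m < 2 * 2 ^ n" "m \<noteq> 0" using i False by (auto simp: m_def)
      have sgn: "m - 1 < 0 \<longleftrightarrow> i < 0" "m < 0 \<longleftrightarrow> i < 0" using False unfolding m_def by presburger+
      have odd: "odd (m - 1)" using m by simp
      have "sact s (gray (m - 1)) = (if s = lab (ruler n m) then gray (m - 1) else gray m)"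
        "sact s (gray m) = (if s = lab (ruler n m) then gray m else gray (m - 1))"
        using sact_gray_bcd[OF odd _ s] ruler_small[OF m(2-4)] m by auto
      then have "(sact s (gray i), i < 0) = segment_nbr n line i s"
        using s sgn by (cases "even i") (auto simp: segment_nbr_def line_def m_def)
      moreover have "gray i \<noteq> ones" using False by (simp add: gray_eq_ones_iff)
      then have "(s, line i, q) \<in> edges (doubled ?J) \<longleftrightarrow> q = (sact s (gray i), i < 0)"
        by (cases q) (auto simp: line_def edges_doubled gray_in_orbit_ones)
      ultimately show ?thesis by simp
    qed
  qed
  then show "emanating (doubled ?J) (line i) = range (\<lambda>s. (s, segment_nbr n line i s))"
    by (auto simp: emanating_def)
qed

lemma lab_add_3_mult: "lab (k + 3 * m) = lab k"
  by (simp add: lab_def)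

lemma doubled_large_segment:
  fixes a :: int
  obtains n where "n \<ge> m" "\<bar>a\<bar> < 2 ^ n" "segment (doubled (UNIV - {gen_a, lab k})) n line"
proof
  \<comment> \<open>The increment is a multiple of 3, so the label of the kept loop is preserved;
    its size takes care of both bounds.\<close>
  let ?n = "k + 3 * (m + nat \<bar>a\<bar> + 1)"
  show "?n \<ge> m" by simp
  have "nat \<bar>a\<bar> \<le> ?n" by simp
  also have "?n < 2 ^ ?n" by (rule less_exp)
  finally have "int (nat \<bar>a\<bar>) < int (2 ^ ?n)" by (simp only: of_nat_less_iff)
  then show "\<bar>a\<bar> < 2 ^ ?n" by simp
  show "segment (doubled (UNIV - {gen_a, lab k})) ?n line"
    using segment_doubled[of ?n] unfolding lab_add_3_mult by simp
qed

lemma rich_doubled: "rich (doubled (UNIV - {gen_a, lab k})) (line i)"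
  unfolding rich_def
proof
  fix m
  obtain n where "n \<ge> m" "\<bar>i\<bar> < 2 ^ n" "segment (doubled (UNIV - {gen_a, lab k})) n line"
    by (rule doubled_large_segment)
  moreover have "inj_on line {- 2 * 2 ^ n..<2 * 2 ^ n}" using inj_line by (rule inj_on_subset) simp
  ultimately show "\<exists>n\<ge>m. \<exists>Q j. segment (doubled (UNIV - {gen_a, lab k})) n Q \<and>
    inj_on Q {- 2 * 2 ^ n..<2 * 2 ^ n} \<and> - (2 ^ n) \<le> j \<and> j < 2 ^ n \<and> Q j = line i"
    by (intro exI[of _ n] conjI exI[of _ line] exI[of _ i]) auto
qed

lemma doubled_reachable: "\<exists>d. (line i, line j) \<in> adjacency (doubled (UNIV - {gen_a, lab k})) ^^ d"
proof -
  obtain n where n: "\<bar>\<bar>i\<bar> + \<bar>j\<bar> + 1\<bar> < 2 ^ n" "segment (doubled (UNIV - {gen_a, lab k})) n line"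
    by (rule doubled_large_segment)
  then have "(line i, line j) \<in> adjacency (doubled (UNIV - {gen_a, lab k})) ^^ nat \<bar>j - i\<bar>"
    by (intro segment_dist[OF n(2)]) auto
  then show ?thesis by blast
qed

section \<open>Representatives on the natural numbers\<close>

lemma rooted_connected_doubled:
  assumes "p \<in> verts (doubled (UNIV - {gen_a, lab k}))"
  shows "rooted_connected_graph (doubled (UNIV - {gen_a, lab k}), p)"
  unfolding rooted_connected_graph_def prod.case
proof (intro conjI ballI allI impI)
  let ?G = "doubled (UNIV - {gen_a, lab k})"
  show "p \<in> verts ?G" by (fact assms)
  show "edges ?G \<subseteq> UNIV \<times> verts ?G \<times> verts ?G" using wf_doubled by (simp add: wf_lgraph_def)
  show "(s, y, x) \<in> edges ?G" if "(s, x, y) \<in> edges ?G" for s x y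
    using that by (cases x; cases y) (auto simp: edges_doubled sact_in_orbit)
  show "finite (emanating ?G x)" if xv: "x \<in> verts ?G" for x
  proof -
    obtain i where x: "x = line i" using xv by (auto simp: verts_doubled)
    obtain n where n: "\<bar>\<bar>i\<bar> + 1\<bar> < 2 ^ n" "segment ?G n line" by (rule doubled_large_segment)
    have "- 2 * 2 ^ n < i \<and> i < 2 * 2 ^ n - 1" using n(1) by linarith
    then have "emanating ?G x = range (\<lambda>s. (s, segment_nbr n line i s))"
      using n(2) unfolding segment_def x by blast
    then show ?thesis by (simp add: UNIV_gen)
  qed
  show "(x, y) \<in> (adjacency ?G)\<^sup>*" if "x \<in> verts ?G" "y \<in> verts ?G" for x y
  proof -
    obtain i j where "x = line i" "y = line j" using \<open>x \<in> verts ?G\<close> \<open>y \<in> verts ?G\<close> by (auto simp: verts_doubled)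
    then show ?thesis using doubled_reachable[of i j k] relpow_imp_rtrancl by blast
  qed
qed

text \<open>An \<open>iso_class\<close> contains only graphs on natural numbers. For a graph on
  another type such a copy must be produced before \<open>rep\<close> is known to select a member of
  the class.\<close>

lemma nat_representative:
  assumes conn: "rooted_connected_graph (\<Gamma>, x)" and count: "countable (verts \<Gamma>)"
  shows "\<exists>R :: nat rgraph. rooted_connected_graph R \<and> rooted_iso (\<Gamma>, x) R"
proof -
  define h where "h = to_nat_on (verts \<Gamma>)"
  have inj: "inj_on h (verts \<Gamma>)" unfolding h_def using count by (rule inj_on_to_nat_on)
  define \<Delta> where "\<Delta> = \<lparr>verts = h ` verts \<Gamma>, edges = (\<lambda>(s, p, q). (s, h p, h q)) ` edges \<Gamma>\<rparr>"
  have wf: "edges \<Gamma> \<subseteq> UNIV \<times> verts \<Gamma> \<times> verts \<Gamma>" using conn by (simp add: rooted_connected_graph_def)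
  have edge: "(s, h p, h q) \<in> edges \<Delta> \<longleftrightarrow> (s, p, q) \<in> edges \<Gamma>" if "p \<in> verts \<Gamma>" "q \<in> verts \<Gamma>" for s p q
  proof
    assume "(s, h p, h q) \<in> edges \<Delta>"
    then obtain p' q' where *: "(s, p', q') \<in> edges \<Gamma>" "h p = h p'" "h q = h q'" by (auto simp: \<Delta>_def)
    then have "p' \<in> verts \<Gamma>" "q' \<in> verts \<Gamma>" using wf by auto
    then show "(s, p, q) \<in> edges \<Gamma>" using * that inj by (metis inj_onD)
  qed (force simp: \<Delta>_def)
  have iso: "rooted_iso (\<Gamma>, x) (\<Delta>, h x)"
  proof -
    have "bij_betw h (verts \<Gamma>) (verts \<Delta>)" using inj by (simp add: \<Delta>_def inj_on_imp_bij_betw)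
    then show ?thesis using edge by (auto simp: rooted_iso_def)
  qed
  have rtr: "(h p, h q) \<in> (adjacency \<Delta>)\<^sup>*" if "(p, q) \<in> (adjacency \<Gamma>)\<^sup>*" for p q
    using that
  proof induction
    case (step q r)
    then have "(h q, h r) \<in> adjacency \<Delta>" by (force simp: adjacency_def \<Delta>_def)
    with step.IH show ?case by (rule rtrancl_into_rtrancl)
  qed simp
  have "rooted_connected_graph (\<Delta>, h x)"
    unfolding rooted_connected_graph_def prod.case
  proof (intro conjI ballI allI impI)
    show "h x \<in> verts \<Delta>" using conn by (simp add: \<Delta>_def rooted_connected_graph_def)
    show "edges \<Delta> \<subseteq> UNIV \<times> verts \<Delta> \<times> verts \<Delta>" using wf by (auto simp: \<Delta>_def)
    show "(s, q, p) \<in> edges \<Delta>" if e: "(s, p, q) \<in> edges \<Delta>" for s p q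
    proof -
      obtain p' q' where "(s, p', q') \<in> edges \<Gamma>" "p = h p'" "q = h q'" using e by (auto simp: \<Delta>_def)
      moreover from this have "(s, q', p') \<in> edges \<Gamma>" using conn by (simp add: rooted_connected_graph_def)
      ultimately show ?thesis by (force simp: \<Delta>_def)
    qed
    show "finite (emanating \<Delta> p)" if pv: "p \<in> verts \<Delta>" for p
    proof -
      obtain p' where p': "p' \<in> verts \<Gamma>" "p = h p'" using pv by (auto simp: \<Delta>_def)
      have "emanating \<Delta> p \<subseteq> (\<lambda>(s, q). (s, h q)) ` emanating \<Gamma> p'"
      proof
        fix e assume "e \<in> emanating \<Delta> p"
        then obtain s r q where e: "e = (s, h q)" "h r = h p'" "(s, r, q) \<in> edges \<Gamma>"
          using p'(2) by (auto simp: emanating_def \<Delta>_def)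
        then have "r = p'" using inj wf p'(1) by (auto dest: inj_onD)
        with e show "e \<in> (\<lambda>(s, q). (s, h q)) ` emanating \<Gamma> p'" by (force simp: emanating_def)
      qed
      moreover have "finite (emanating \<Gamma> p')" using conn p'(1) by (simp add: rooted_connected_graph_def)
      ultimately show ?thesis by (meson finite_imageI finite_subset)
    qed
    show "(p, q) \<in> (adjacency \<Delta>)\<^sup>*" if "p \<in> verts \<Delta>" "q \<in> verts \<Delta>" for p q
      using that rtr conn by (auto simp: \<Delta>_def rooted_connected_graph_def)
  qed
  with iso show ?thesis by blast
qed

lemma rooted_connected_wf: "rooted_connected_graph (\<Gamma>, x) \<Longrightarrow> wf_lgraph \<Gamma> \<and> x \<in> verts \<Gamma>"
  by (simp add: rooted_connected_graph_def wf_lgraph_def)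

lemma rooted_connected_reach:
  "rooted_connected_graph (\<Gamma>, x) \<Longrightarrow> p \<in> verts \<Gamma> \<Longrightarrow> q \<in> verts \<Gamma> \<Longrightarrow> \<exists>k. (p, q) \<in> adjacency \<Gamma> ^^ k"
  by (simp add: rooted_connected_graph_def rtrancl_imp_relpow)

lemma rich_iso:
  assumes "rich \<Gamma> p" "\<And>n. \<exists>f. ball_iso n f \<Gamma> p \<Delta> y" "wf_lgraph \<Gamma>" "wf_lgraph \<Delta>"
  shows "rich \<Delta> y"
  unfolding rich_def
proof
  fix m
  obtain n Q i where n: "n \<ge> Suc m" and Q: "segment \<Gamma> n Q" "inj_on Q {- 2 * 2 ^ n..<2 * 2 ^ n}"
    "- (2 ^ n) \<le> i" "i < 2 ^ n" "Q i = p"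
    using assms(1) unfolding rich_def by meson
  obtain f where f: "ball_iso (4 * 2 ^ n) f \<Gamma> p \<Delta> y" using assms(2) by blast
  have "segment \<Delta> n (f \<circ> Q) \<and> inj_on (f \<circ> Q) {- 2 * 2 ^ n..<2 * 2 ^ n} \<and> (f \<circ> Q) i = y"
    using segment_ball_iso[OF Q _ f assms(3,4)] n by simp
  then show "\<exists>n\<ge>m. \<exists>Q i. segment \<Delta> n Q \<and> inj_on Q {- 2 * 2 ^ n..<2 * 2 ^ n} \<and>
    - (2 ^ n) \<le> i \<and> i < 2 ^ n \<and> Q i = y"
    using Q(3,4) n by (intro exI[of _ n] conjI exI[of _ "f \<circ> Q"] exI[of _ i]) auto
qed

lemma X1_no_eigenvalues:
  assumes params: "(t, u, v, w) \<in> params" and x: "x \<in> X1"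
  shows "\<not> laplacian_has_eigenvalues (fst (rep x)) t u v w"
proof -
  obtain J p where J: "J \<in> {{gen_b, gen_c}, {gen_b, gen_d}, {gen_c, gen_d}}"
    and p: "p \<in> verts (doubled J)" and xJ: "x = iso_class (doubled J, p)"
    using x by (auto simp: X1_def)
  \<comment> \<open>The values k = 1, 2, 3 stand for the kept loops d, c and b.\<close>
  have "\<exists>k. J = UNIV - {gen_a, lab k}"
    using J by (auto simp: UNIV_gen lab_def intro: exI[of _ 1] exI[of _ 2] exI[of _ 3])
  then obtain k where k: "J = UNIV - {gen_a, lab k}" by blast
  have conn: "rooted_connected_graph (doubled J, p)" using rooted_connected_doubled p k by blast
  have "\<exists>R. R \<in> x"
    using nat_representative[OF conn] by (auto simp: xJ iso_class_def verts_doubled)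
  then have "rep x \<in> x" unfolding rep_def by (rule someI_ex)
  moreover obtain \<Gamma> y where \<Gamma>: "rep x = (\<Gamma>, y)" by fastforce
  ultimately have \<Gamma>conn: "rooted_connected_graph (\<Gamma>, y)" and iso: "rooted_iso (doubled J, p) (\<Gamma>, y)"
    by (auto simp: xJ iso_class_def)
  have rich: "rich \<Gamma> q'" if q': "q' \<in> verts \<Gamma>" for q'
  proof -
    obtain f where f: "bij_betw f (verts (doubled J)) (verts \<Gamma>)"
      "\<forall>s. \<forall>p\<in>verts (doubled J). \<forall>q\<in>verts (doubled J). (s, p, q) \<in> edges (doubled J) \<longleftrightarrow> (s, f p, f q) \<in> edges \<Gamma>"
      using iso by (auto simp: rooted_iso_def)
    have "q' \<in> f ` verts (doubled J)" using f(1) q' by (auto simp: bij_betw_def)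
    then obtain q where q: "q \<in> verts (doubled J)" "q' = f q" by blast
    then have "rooted_iso (doubled J, q) (\<Gamma>, q')" using f by (auto simp: rooted_iso_def)
    note iso_q = rooted_iso_imp_ball_iso[OF this wf_doubled _ q(1)]
    have "\<exists>g. ball_iso n g (doubled J) q \<Gamma> q'" for n
      by (rule iso_q) (use rooted_connected_wf[OF \<Gamma>conn] in simp)
    moreover obtain i where "q = line i" using q(1) by (auto simp: verts_doubled)
    ultimately show ?thesis
      using rich_iso[of "doubled J" q \<Gamma> q'] rich_doubled k wf_doubled rooted_connected_wf[OF \<Gamma>conn] by simp
  qed
  show ?thesis unfolding \<Gamma> fst_conv
    using params rich rooted_connected_reach[OF \<Gamma>conn] by (intro no_eigenvalues_if_rich)
qed

section \<open>Almost sure occurrence of the pattern\<close>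

text \<open>Only the probabilities of cylinders enter, so the statement serves both for the boundary
  itself and for letters read off from graphs. Independence is replaced by counting words.\<close>

lemma AE_patterns:
  fixes Y :: "'a \<Rightarrow> nat \<Rightarrow> bool"
  assumes M: "prob_space M"
    and meas: "\<And>N w. {x \<in> space M. \<forall>i<N. Y x i = w i} \<in> sets M"
    and prob: "\<And>N w. measure M {x \<in> space M. \<forall>i<N. Y x i = w i} = 1 / 2 ^ N"
  shows "AE x in M. \<forall>m. \<exists>n\<ge>m. pattern n (Y x)"
proof -
  interpret prob_space M by (fact M)
  define E where "E = (\<lambda>N S. {x \<in> space M. map (Y x) [0..<N] \<in> S})"
  have single: "E N {l} = {x \<in> space M. \<forall>i<N. Y x i = l ! i}" if "length l = N" for N l
    using that by (auto simp: E_def list_eq_iff_nth_eq)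
  have E_UN: "E N S = (\<Union>l\<in>S. E N {l})" for N S by (auto simp: E_def)
  have E_sets: "E N S \<in> sets M" and E_prob: "prob (E N S) = card S / 2 ^ N"
    if S: "S \<subseteq> {l. length l = N}" for N S
  proof -
    have "finite {l :: bool list. length l = N}" using finite_lists_length_eq[of "UNIV :: bool set" N] by simp
    then have fin: "finite S" using S by (rule finite_subset[rotated])
    have len: "length l = N" if "l \<in> S" for l using that S by auto
    have sets1: "E N {l} \<in> sets M" if "l \<in> S" for l
      unfolding single[OF len[OF that]] by (rule meas)
    have prob1: "prob (E N {l}) = 1 / 2 ^ N" if "l \<in> S" for l
      unfolding single[OF len[OF that]] by (rule prob)
    show "E N S \<in> sets M" using sets1 fin by (subst E_UN) (intro sets.finite_UN, auto)
    have "prob (\<Union>l\<in>S. E N {l}) = (\<Sum>l\<in>S. prob (E N {l}))"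
    proof (rule finite_measure_finite_Union[OF fin])
      show "(\<lambda>l. E N {l}) ` S \<subseteq> sets M" using sets1 by blast
      show "disjoint_family_on (\<lambda>l. E N {l}) S" by (auto simp: disjoint_family_on_def E_def)
    qed
    then have "prob (E N S) = (\<Sum>l\<in>S. prob (E N {l}))" using E_UN by metis
    also have "\<dots> = (\<Sum>l\<in>S. 1 / 2 ^ N)" using prob1 by (intro sum.cong) auto
    finally show "prob (E N S) = card S / 2 ^ N" by simp
  qed
  have "AE x in M. \<exists>n\<ge>m. pattern n (Y x)" for m
  proof -
    \<comment> \<open>The windows of four letters starting at m + 4k are disjoint, so avoiding the
      pattern in one more window multiplies the number of words by 15.\<close>
    define S where "S = (\<lambda>K. {l :: bool list. length l = m + 4 * K \<and> (\<forall>k<K. \<not> pattern (m + 4 * k) ((!) l))})"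
    let ?B = "\<lambda>K. E (m + 4 * K) (S K)"
    have pat_map: "pattern n ((!) (map (Y x) [0..<N])) \<longleftrightarrow> pattern n (Y x)" if "n + 3 < N" for n N x
      using that by (simp add: pattern_def)
    have B: "?B K = {x \<in> space M. \<forall>k<K. \<not> pattern (m + 4 * k) (Y x)}" for K
      using pat_map[of "m + 4 * _" "m + 4 * K"] by (auto simp: E_def S_def)
    have S_len: "S K \<subseteq> {l. length l = m + 4 * K}" for K by (auto simp: S_def)
    have "prob (?B K) = (15 / 16) ^ K" for K
    proof (induction K)
      case 0
      have "?B 0 = space M" unfolding B by simp
      then show ?case by (simp add: prob_space)
    next
      case (Suc K)
      \<comment> \<open>Of the 16 continuations by four letters exactly this one has to be
        discarded.\<close>
      let ?app = "\<lambda>l. l @ [True, True, False, True]"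
      let ?C = "E (m + 4 * Suc K) (?app ` S K)"
      have app_len: "?app ` S K \<subseteq> {l. length l = m + 4 * Suc K}" by (auto simp: S_def)
      have C: "?C = {x \<in> ?B K. pattern (m + 4 * K) (Y x)}"
      proof -
        have "map (Y x) [0..<m + 4 * Suc K] \<in> ?app ` S K \<longleftrightarrow>
            map (Y x) [0..<m + 4 * K] \<in> S K \<and> pattern (m + 4 * K) (Y x)" for x
        proof -
          have split: "map (Y x) [0..<m + 4 * Suc K] = map (Y x) [0..<m + 4 * K] @
            [Y x (m + 4 * K), Y x (m + 4 * K + 1), Y x (m + 4 * K + 2), Y x (m + 4 * K + 3)]"
            by (simp add: numeral_eq_Suc)
          have "map (Y x) [0..<m + 4 * Suc K] = ?app l \<longleftrightarrow>
            map (Y x) [0..<m + 4 * K] = l \<and> pattern (m + 4 * K) (Y x)" if "l \<in> S K" for l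
            using that unfolding split pattern_def by (subst append_eq_append_conv) (auto simp: S_def)
          then show ?thesis by auto
        qed
        then show ?thesis by (auto simp: E_def)
      qed
      have "card (?app ` S K) = card (S K)" by (intro card_image) (auto simp: inj_on_def)
      then have "prob ?C = prob (?B K) / 16"
        using E_prob[OF app_len] E_prob[OF S_len, of K] by (simp add: power_add)
      moreover have "?B (Suc K) = ?B K - ?C"
        unfolding C unfolding B by (auto simp: less_Suc_eq)
      moreover have "?C \<subseteq> ?B K" unfolding C by auto
      ultimately have "prob (?B (Suc K)) = prob (?B K) - prob (?B K) / 16"
        using finite_measure_Diff[OF E_sets[OF S_len] E_sets[OF app_len]] by simp
      then show ?case using Suc by simp
    qed
    moreover define Z where "Z = (\<Inter>K. ?B K)"
    ultimately have "prob Z \<le> (15 / 16) ^ K" for K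
      using finite_measure_mono[of Z "?B K"] E_sets[OF S_len] by (metis INT_lower UNIV_I)
    moreover have "(\<lambda>K. (15 / 16 :: real) ^ K) \<longlonglongrightarrow> 0" by (intro LIMSEQ_power_zero) simp
    ultimately have "prob Z \<le> 0" by (intro LIMSEQ_le_const) auto
    then have "emeasure M Z = 0" by (simp add: emeasure_eq_measure measure_nonneg order_antisym)
    moreover have "Z \<in> sets M" unfolding Z_def using E_sets[OF S_len] by (intro sets.countable_INT) auto
    moreover have "{x \<in> space M. \<not> (\<exists>n\<ge>m. pattern n (Y x))} \<subseteq> Z"
      unfolding Z_def B by auto
    ultimately show ?thesis by (intro AE_I[of _ _ Z]) auto
  qed
  then show ?thesis by (simp add: AE_all_countable)
qed

lemma AE_bernoulli_patterns: "AE \<xi> in bernoulli_measure. \<forall>m. \<exists>n\<ge>m. pattern n \<xi>"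
proof (rule AE_patterns)
  let ?M = "\<lambda>_ :: nat. measure_pmf (bernoulli_pmf (1/2))"
  interpret product_prob_space ?M UNIV
    by (rule product_prob_spaceI) (rule prob_space_measure_pmf)
  show "prob_space bernoulli_measure" unfolding bernoulli_measure_def by (rule prob_space_axioms)
  fix N :: nat and w :: "nat \<Rightarrow> bool"
  have cyl: "{\<xi> \<in> space bernoulli_measure. \<forall>i<N. \<xi> i = w i} = prod_emb UNIV ?M {..<N} (\<Pi>\<^sub>E i\<in>{..<N}. {w i})"
    by (auto simp: bernoulli_measure_def space_PiM prod_emb_def PiE_def Pi_def restrict_def extensional_def)
  show "{\<xi> \<in> space bernoulli_measure. \<forall>i<N. \<xi> i = w i} \<in> sets bernoulli_measure"
    unfolding cyl unfolding bernoulli_measure_def by (intro sets_PiM_I) auto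
  have "measure (PiM UNIV ?M) (prod_emb UNIV ?M {..<N} (\<Pi>\<^sub>E i\<in>{..<N}. {w i})) = (\<Prod>i<N. measure (?M i) {w i})"
    by (intro measure_PiM_emb) auto
  also have "\<dots> = (\<Prod>i<N. 1 / 2)"
    by (intro prod.cong) (auto simp: measure_pmf_single pmf_bernoulli_True pmf_bernoulli_False split: bool.split)
  finally show "measure bernoulli_measure {\<xi> \<in> space bernoulli_measure. \<forall>i<N. \<xi> i = w i} = 1 / 2 ^ N"
    unfolding cyl unfolding bernoulli_measure_def by (simp add: power_one_over)
qed

text \<open>A generator flips at most one letter. Hence two points of an orbit share all occurrences
  of the pattern from some index on.\<close>

lemma wact_finite_change: "\<exists>K. \<forall>i\<ge>K. wact l \<xi> i = \<xi> i"
proof (induction l)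
  case (Cons s l)
  then obtain K where K: "\<forall>i\<ge>K. wact l \<xi> i = \<xi> i" by blast
  have one: "\<exists>K. \<forall>i\<ge>K. sact s \<eta> i = \<eta> i" for \<eta>
  proof (cases "s = gen_a")
    case True
    then show ?thesis by (intro exI[of _ 1]) (simp add: sact_a)
  next
    case False
    show ?thesis
    proof (cases "\<eta> = ones")
      case True
      then show ?thesis using sact_ones[OF False] by simp
    next
      case neq: False
      then have ex: "\<exists>h. \<not> \<eta> h" by (auto simp: ones_def)
      define h where "h = (LEAST h. \<not> \<eta> h)"
      have "\<forall>i<h. \<eta> i" "\<not> \<eta> h" using LeastI_ex[OF ex] not_less_Least unfolding h_def by blast+
      then show ?thesis using sact_first_zero[of h \<eta> s] False by (intro exI[of _ "Suc (Suc h)"]) simp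
    qed
  qed
  obtain K' where "\<forall>i\<ge>K'. sact s (wact l \<xi>) i = wact l \<xi> i" using one by blast
  then show ?case using K by (intro exI[of _ "max K K'"]) simp
qed simp

lemma ball_iso_id: "ball_iso n id \<Gamma> p \<Gamma> p"
  by (simp add: ball_iso_def)

lemma schreier_no_eigenvalues:
  assumes params: "(t, u, v, w) \<in> params" and pat: "\<forall>m. \<exists>n\<ge>m. pattern n \<xi>"
  shows "\<not> laplacian_has_eigenvalues (schreier \<xi>) t u v w"
proof (rule no_eigenvalues_if_rich[OF params])
  fix p assume "p \<in> verts (schreier \<xi>)"
  then have p: "p \<in> orbit \<xi>" by simp
  then obtain l where "p = wact l \<xi>" by (auto simp: orbit_eq)
  then obtain K where K: "\<forall>i\<ge>K. p i = \<xi> i" using wact_finite_change by blast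
  show "rich (schreier \<xi>) p"
  proof (rule rich_if_patterns[OF wf_schreier])
    fix m
    obtain n where n: "n \<ge> max m K" "pattern n \<xi>" using pat by blast
    then have "pattern n p" using K by (simp add: pattern_def)
    then show "\<exists>n\<ge>m. \<exists>\<eta> f. pattern n \<eta> \<and> ball_iso (4 * 2 ^ n) f (schreier \<eta>) \<eta> (schreier \<xi>) p"
      using n(1) ball_iso_id schreier_cong[OF p] by (metis max.bounded_iff)
  qed
qed (use schreier_reachable in simp)

section \<open>Coding of points of the graph space\<close>

text \<open>
  Lysenok's substitution \<open>wsub\<close>: the word \<open>wsub l\<close> acts as \<open>l\<close> below the vertex 1 and as \<open>wlow l\<close>
  below the vertex 0.
\<close>

fun wsub1 :: "gen \<Rightarrow> gen list" where
  "wsub1 gen_a = [gen_a, gen_c, gen_a]"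
| "wsub1 gen_b = [gen_d]"
| "wsub1 gen_c = [gen_b]"
| "wsub1 gen_d = [gen_c]"

fun wlow1 :: "gen \<Rightarrow> gen list" where
  "wlow1 gen_a = [gen_d]"
| "wlow1 gen_b = []"
| "wlow1 gen_c = [gen_a]"
| "wlow1 gen_d = [gen_a]"

definition wsub :: "gen list \<Rightarrow> gen list" where
  "wsub l = concat (map wsub1 l)"

definition wlow :: "gen list \<Rightarrow> gen list" where
  "wlow l = concat (map wlow1 l)"

lemma wsub_append [simp]: "wsub (k @ l) = wsub k @ wsub l" and wlow_append [simp]: "wlow (k @ l) = wlow k @ wlow l"
  by (simp_all add: wsub_def wlow_def)

lemma wact_wsub: "wact (wsub l) (scons x \<eta>) = scons x (if x then wact l \<eta> else wact (wlow l) \<eta>)"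
proof (induction l)
  case Nil
  then show ?case by (simp add: wsub_def wlow_def)
next
  case (Cons s l)
  have "wsub (s # l) = wsub1 s @ wsub l" "wlow (s # l) = wlow1 s @ wlow l" by (simp_all add: wsub_def wlow_def)
  with Cons show ?case by (cases s; cases x) simp_all
qed

definition detect :: "nat \<Rightarrow> gen list" where
  "detect n = (wsub ^^ n) [gen_a, gen_b, gen_a, gen_b]"

text \<open>
  \<open>abab\<close> has no fixed point on the boundary, and \<open>wlow\<close> kills all its iterates under the
  substitution; so \<open>detect n\<close> moves exactly the sequences starting with \<open>n\<close> ones.
\<close>

definition small :: "gen list \<Rightarrow> bool" where
  "small l \<longleftrightarrow> wact (wlow l) = id \<or> wact (wlow l) = sact gen_a"

lemma wact_append_fun: "wact (k @ l) = wact k \<circ> wact l"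
  by (simp add: fun_eq_iff)

lemma sact_comp_sact: "sact s \<circ> sact s = id"
  by (simp add: fun_eq_iff)

lemma small_append: "small k \<Longrightarrow> small l \<Longrightarrow> small (k @ l)"
  by (auto simp: small_def wact_append_fun sact_comp_sact)

lemma funpow_wsub_append: "(wsub ^^ n) (k @ l) = (wsub ^^ n) k @ (wsub ^^ n) l"
  by (induction n) auto

lemma wsub_single: "wsub [s] = wsub1 s"
  by (simp add: wsub_def)

lemma funpow_wsub_letter: "s \<noteq> gen_a \<Longrightarrow> \<exists>s'. s' \<noteq> gen_a \<and> (wsub ^^ n) [s] = [s']"
proof (induction n)
  case (Suc n)
  then obtain s' where "s' \<noteq> gen_a" "(wsub ^^ n) [s] = [s']" by blast
  then show ?case by (cases s') (auto simp: wsub_single)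
qed simp

lemma small_letter: "s \<noteq> gen_a \<Longrightarrow> small ((wsub ^^ n) [s])"
proof -
  assume "s \<noteq> gen_a"
  then obtain s' where "s' \<noteq> gen_a" "(wsub ^^ n) [s] = [s']" using funpow_wsub_letter by blast
  then show ?thesis by (cases s') (auto simp: small_def wlow_def fun_eq_iff)
qed

text \<open>The index starts at 2 because \<open>wlow\<close> gives d and dad for the first two
  iterates of a, which lie outside {1, a}. The next value, daddad, is trivial, and aca propagates
  the property.\<close>

lemma small_a: "small ((wsub ^^ Suc (Suc n)) [gen_a])"
proof (induction n)
  case 0
  show ?case by (simp add: small_def wlow_def wsub_def fun_eq_iff)
next
  case (Suc n)
  have "(wsub ^^ Suc (Suc (Suc n))) [gen_a] = (wsub ^^ Suc (Suc n)) ([gen_a] @ [gen_c] @ [gen_a])"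
    by (subst funpow_Suc_right) (simp add: wsub_def del: funpow.simps)
  then show ?case unfolding funpow_wsub_append using Suc small_letter[of gen_c] by (simp add: small_append del: funpow.simps)
qed

lemma detect_split: "detect n = ((wsub ^^ n) [gen_a] @ (wsub ^^ n) [gen_b]) @ ((wsub ^^ n) [gen_a] @ (wsub ^^ n) [gen_b])"
  unfolding detect_def funpow_wsub_append[symmetric] by simp

text \<open>The word is a square, so for n at least 2 its image under \<open>wlow\<close> is the
  square of an element of {1, a}. The remaining cases are the relations d d = 1 and (da)^4 =
  1.\<close>

lemma wact_wlow_detect: "wact (wlow (detect n)) \<eta> = \<eta>"
proof -
  have "n = 0 \<or> n = 1 \<or> n \<ge> 2" by linarith
  then consider "n = 0" | "n = 1" | k where "n = Suc (Suc k)"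
    by (metis Suc_1 Suc_le_D Suc_le_mono One_nat_def)
  then show ?thesis
  proof cases
    case 1
    then show ?thesis by (simp add: detect_def wlow_def)
  next
    case 2
    obtain x \<zeta> where "\<eta> = scons x \<zeta>" by (rule scons_exhaust)
    then show ?thesis using 2 by (cases x) (simp_all add: detect_def wlow_def wsub_def)
  next
    case 3
    then have "small ((wsub ^^ n) [gen_a] @ (wsub ^^ n) [gen_b])"
      using small_a small_letter[of gen_b] by (simp add: small_append del: funpow.simps)
    then show ?thesis unfolding detect_split wlow_append[of "_ @ _" "_ @ _"]
      by (auto simp: small_def wact_append_fun simp del: wlow_append)
  qed
qed

text \<open>The first letter is flipped twice, so the two occurrences of b act on the tail once as a
  and once as c; exactly one of these changes the first letter of the tail.\<close>

lemma abab_moves: "wact [gen_a, gen_b, gen_a, gen_b] \<xi> \<noteq> \<xi>"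
proof -
  obtain x \<eta> where \<xi>: "\<xi> = scons x \<eta>" by (rule scons_exhaust)
  obtain y \<zeta> where \<eta>: "\<eta> = scons y \<zeta>" by (rule scons_exhaust)
  show ?thesis by (cases x) (simp_all add: \<xi> \<eta>)
qed

lemma detect_iff: "wact (detect n) \<xi> \<noteq> \<xi> \<longleftrightarrow> (\<forall>i<n. \<xi> i)"
proof (induction n arbitrary: \<xi>)
  case 0
  then show ?case using abab_moves by (simp add: detect_def)
next
  case (Suc n)
  obtain x \<eta> where \<xi>: "\<xi> = scons x \<eta>" by (rule scons_exhaust)
  have "detect (Suc n) = wsub (detect n)" by (simp add: detect_def)
  then have "wact (detect (Suc n)) \<xi> \<noteq> \<xi> \<longleftrightarrow> x \<and> wact (detect n) \<eta> \<noteq> \<eta>"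
    by (simp add: \<xi> wact_wsub wact_wlow_detect)
  also have "\<dots> \<longleftrightarrow> x \<and> (\<forall>i<n. \<eta> i)" using Suc by simp
  also have "\<dots> \<longleftrightarrow> (\<forall>i<Suc n. \<xi> i)" by (auto simp: \<xi> less_Suc_eq_0_disj)
  finally show ?case .
qed

section \<open>Reading letters off balls\<close>

lemma ball_iso_wact:
  assumes h: "ball_iso R h (schreier \<xi>) \<xi> (schreier \<xi>') \<xi>'" and l: "length l \<le> R"
  shows "h (wact l \<xi>) = wact l \<xi>'"
  using l
proof (induction l)
  case Nil
  then show ?case using h by (simp add: ball_iso_def)
next
  case (Cons s l)
  have 1: "(\<xi>, wact l \<xi>) \<in> adjacency (schreier \<xi>) ^^ length l"
    using relpow_schreier[of \<xi> \<xi>] by auto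
  have 2: "(\<xi>, wact (s # l) \<xi>) \<in> adjacency (schreier \<xi>) ^^ length (s # l)"
    using relpow_schreier[of \<xi> \<xi>] self_in_orbit by blast
  have "wact l \<xi> \<in> vball R (schreier \<xi>) \<xi>" "wact (s # l) \<xi> \<in> vball R (schreier \<xi>) \<xi>"
    using in_vball[OF wf_schreier _ 1, of R] in_vball[OF wf_schreier _ 2, of R] Cons.prems by auto
  moreover have "(s, wact l \<xi>, wact (s # l) \<xi>) \<in> edges (schreier \<xi>)"
    by (simp add: wact_in_orbit)
  ultimately have "(s, h (wact l \<xi>), h (wact (s # l) \<xi>)) \<in> edges (schreier \<xi>')"
    using h unfolding ball_iso_def by blast
  then show ?case using Cons by simp
qed

text \<open>
  The test word of a vertex of level \<open>N\<close> is conjugate to \<open>detect N\<close>: it moves exactly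
  the boundary points below this vertex.
\<close>

lemma ball_determines_prefix:
  "\<exists>R. \<forall>\<xi> \<xi>' h. ball_iso R h (schreier \<xi>) \<xi> (schreier \<xi>') \<xi>' \<longrightarrow> (\<forall>i<N. \<xi> i = \<xi>' i)"
proof -
  have "\<exists>W. \<forall>\<zeta>. wact W (gpath N \<zeta> 0) = gpath N \<zeta> j" if "j \<in> {0..<2 ^ N}" for j
    using gpath_walk[of 0 "nat j" N] that by auto
  then obtain W where W: "\<And>j \<zeta>. j \<in> {0..<2 ^ N} \<Longrightarrow> wact (W j) (gpath N \<zeta> 0) = gpath N \<zeta> j" by metis
  \<comment> \<open>Gray position 0 consists of ones only, so conjugating with \<open>W j\<close>
    moves the support of \<open>detect N\<close> to the cylinder of position j.\<close>
  define T where "T = (\<lambda>j. W j @ detect N @ rev (W j))"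
  have T: "wact (T j) \<xi> \<noteq> \<xi> \<longleftrightarrow> (\<forall>i<N. \<xi> i = gray j i)" if j: "j \<in> {0..<2 ^ N}" for j \<xi>
  proof -
    let ?\<eta> = "wact (rev (W j)) \<xi>"
    have "wact (T j) \<xi> \<noteq> \<xi> \<longleftrightarrow> wact (detect N) ?\<eta> \<noteq> ?\<eta>"
      unfolding T_def by (metis wact_append wact_rev_wact wact_wact_rev)
    also have "\<dots> \<longleftrightarrow> (\<forall>i<N. ?\<eta> i)" by (rule detect_iff)
    also have "\<dots> \<longleftrightarrow> (\<forall>i<N. \<xi> i = gray j i)"
    proof
      have g0: "gray 0 i" for i by (simp add: gray_def)
      assume "\<forall>i<N. ?\<eta> i"
      then have "?\<eta> = gpath N ?\<eta> 0" using g0 by (auto simp: gpath_def fun_eq_iff)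
      then have "\<xi> = gpath N ?\<eta> j" using W[OF j, of ?\<eta>] by (metis wact_wact_rev)
      then have "\<xi> i = gpath N ?\<eta> j i" for i by (rule fun_cong)
      then show "\<forall>i<N. \<xi> i = gray j i" by (simp add: gpath_def)
    next
      have g0: "gray 0 i" for i by (simp add: gray_def)
      assume "\<forall>i<N. \<xi> i = gray j i"
      then have "\<xi> = gpath N \<xi> j" by (auto simp: gpath_def fun_eq_iff)
      then have "?\<eta> = gpath N \<xi> 0" using W[OF j, of \<xi>] by (metis wact_rev_wact)
      then show "\<forall>i<N. ?\<eta> i" using g0 by (simp add: gpath_def)
    qed
    finally show ?thesis .
  qed
  define R where "R = Max (length ` T ` {0..<2 ^ N})"
  have R: "length (T j) \<le> R" if "j \<in> {0..<2 ^ N}" for j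
    unfolding R_def using that by (intro Max_ge) auto
  have "\<xi> i = \<xi>' i" if h: "ball_iso R h (schreier \<xi>) \<xi> (schreier \<xi>') \<xi>'" and i: "i < N" for \<xi> \<xi>' h i
  proof -
    obtain j where j: "j \<in> {0..<2 ^ N}" "\<forall>i<N. gray j i = \<xi> i" using gray_surj[of N \<xi>] by auto
    have "(\<xi>, wact (T j) \<xi>) \<in> adjacency (schreier \<xi>) ^^ length (T j)"
      using relpow_schreier[of \<xi> \<xi>] by auto
    then have "wact (T j) \<xi> \<in> vball R (schreier \<xi>) \<xi>"
      using in_vball[OF wf_schreier] R[OF j(1)] by simp
    moreover have "\<xi> \<in> vball R (schreier \<xi>) \<xi>" by (auto simp: vball_def intro!: exI[of _ 0])
    moreover have "wact (T j) \<xi> \<noteq> \<xi>" using T[OF j(1)] j(2) by simp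
    \<comment> \<open>A word that moves \<xi> reaches a second vertex of the ball, and injectivity
      of h forces it to move \<xi>' as well. The single test for the cylinder of \<xi> thus fixes
      all N letters of \<xi>'.\<close>
    ultimately have "h (wact (T j) \<xi>) \<noteq> h \<xi>" using h unfolding ball_iso_def bij_betw_def inj_on_def by metis
    then have "wact (T j) \<xi>' \<noteq> \<xi>'" using ball_iso_wact[OF h R[OF j(1)]] ball_iso_wact[OF h, of "[]"] by simp
    then show ?thesis using T[OF j(1)] j(2) i by simp
  qed
  then show ?thesis by blast
qed

lemma sact_prefix_cong:
  assumes "\<forall>i<N. \<xi> i = \<eta> i" "i < N"
  shows "sact s \<xi> i = sact s \<eta> i"
proof -
  have "map \<xi> [0..<Suc i] = map \<eta> [0..<Suc i]" using assms by auto
  then show ?thesis unfolding sact_def bdry_def by (simp only:)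
qed

definition prefix_radius :: "nat \<Rightarrow> nat" where
  "prefix_radius N = (SOME R. \<forall>\<xi> \<xi>' h. ball_iso R h (schreier \<xi>) \<xi> (schreier \<xi>') \<xi>' \<longrightarrow> (\<forall>i<N. \<xi> i = \<xi>' i))"

lemma prefix_radius:
  "ball_iso (prefix_radius N) h (schreier \<xi>) \<xi> (schreier \<xi>') \<xi>' \<Longrightarrow> i < N \<Longrightarrow> \<xi> i = \<xi>' i"
  using someI_ex[OF ball_determines_prefix[of N]] unfolding prefix_radius_def by blast

definition looks_like :: "nat \<Rightarrow> nat rgraph set \<Rightarrow> (nat \<Rightarrow> bool) \<Rightarrow> bool" where
  "looks_like R x \<xi> \<longleftrightarrow> (\<exists>f. ball_iso R f (schreier \<xi>) \<xi> (fst (rep x)) (snd (rep x)))"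

text \<open>The equivariant factor map from \<open>X\<close> to the boundary of the tree.\<close>

definition coding :: "nat rgraph set \<Rightarrow> nat \<Rightarrow> bool" where
  "coding x i = (SOME \<xi>. looks_like (prefix_radius (Suc i)) x \<xi>) i"

text \<open>The radii are chosen arbitrarily and need not be monotone; the sum dominates each of
  those used for the first N letters.\<close>

definition coding_radius :: "nat \<Rightarrow> nat" where
  "coding_radius N = (\<Sum>i<N. prefix_radius (Suc i))"

lemma Gstar_rep:
  assumes "x \<in> Gstar"
  shows "rep x \<in> x" "rooted_connected_graph (rep x)" "\<And>R. R \<in> x \<Longrightarrow> rooted_connected_graph R \<and> rooted_iso (rep x) R"
proof -
  obtain R0 :: "nat rgraph" where R0: "x = iso_class R0" "rooted_connected_graph R0"
    using assms by (auto simp: Gstar_def)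
  then have "R0 \<in> x" by (simp add: iso_class_def rooted_iso_refl)
  then show rep: "rep x \<in> x" unfolding rep_def by (rule someI)
  then show "rooted_connected_graph (rep x)" using R0 by (simp add: iso_class_def)
  have "rooted_iso R0 (rep x)" using rep R0 by (simp add: iso_class_def)
  then have "rooted_iso (rep x) R0"
    using R0(2) rooted_iso_sym by (cases R0; cases "rep x") (auto simp: rooted_connected_graph_def)
  moreover have "rooted_connected_graph R \<and> rooted_iso R0 R" if "R \<in> x" for R
    using that R0(1) by (simp add: iso_class_def)
  ultimately show "rooted_connected_graph R \<and> rooted_iso (rep x) R" if "R \<in> x" for R
    using that rooted_iso_trans by blast
qed

lemma looks_like_mono:
  assumes "looks_like R x \<xi>" "R' \<le> R" "x \<in> Gstar"
  shows "looks_like R' x \<xi>"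
proof -
  obtain \<Gamma> y where \<Gamma>: "rep x = (\<Gamma>, y)" by fastforce
  then have "wf_lgraph \<Gamma>" using Gstar_rep(2)[OF assms(3)] rooted_connected_wf by metis
  then show ?thesis using assms(1,2) ball_iso_mono[OF _ wf_schreier, where n = R' and N = R] \<Gamma>
    unfolding looks_like_def by (metis fst_conv self_in_orbit snd_conv verts_schreier)
qed

lemma looks_like_prefix:
  assumes "looks_like (prefix_radius N) x \<xi>" "looks_like (prefix_radius N) x \<xi>'" "x \<in> Gstar" "i < N"
  shows "\<xi> i = \<xi>' i"
proof -
  obtain f f' where f: "ball_iso (prefix_radius N) f (schreier \<xi>) \<xi> (fst (rep x)) (snd (rep x))"
    and f': "ball_iso (prefix_radius N) f' (schreier \<xi>') \<xi>' (fst (rep x)) (snd (rep x))"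
    using assms(1,2) by (auto simp: looks_like_def)
  obtain g where "ball_iso (prefix_radius N) g (fst (rep x)) (snd (rep x)) (schreier \<xi>') \<xi>'"
    by (rule ball_iso_sym[OF f']; (blast | simp))
  then show ?thesis using prefix_radius[OF ball_iso_comp[OF f]] assms(4) by blast
qed

lemma coding_prefix:
  assumes "looks_like R x \<xi>" "coding_radius N \<le> R" "x \<in> Gstar" "i < N"
  shows "coding x i = \<xi> i"
proof -
  let ?r = "prefix_radius (Suc i)"
  have "?r \<le> coding_radius N" unfolding coding_radius_def using assms(4) by (intro member_le_sum) auto
  then have 1: "looks_like ?r x \<xi>" using looks_like_mono[OF assms(1) _ assms(3)] assms(2) by simp
  then have 2: "looks_like ?r x (SOME \<xi>. looks_like ?r x \<xi>)" by (rule someI[of "looks_like ?r x"])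
  show ?thesis using looks_like_prefix[OF 2 1 assms(3), of i] by (simp add: coding_def)
qed

lemma topspace_subset_Gstar: "topspace Gstar_topology \<subseteq> Gstar"
  unfolding Gstar_topology_def topology_generated_by_topspace by (auto simp: local_nbhd_def)

lemma X_subset_closure: "X \<subseteq> Gstar_topology closure_of range schreier_class"
  by (auto simp: X_def Let_def)

lemma X_subset_Gstar: "X \<subseteq> Gstar"
  by (rule order_trans[OF X_subset_closure order_trans[OF closure_of_subset_topspace topspace_subset_Gstar]])

lemma openin_local_nbhd: "x \<in> Gstar \<Longrightarrow> openin Gstar_topology (local_nbhd n x)"
  unfolding Gstar_topology_def by (rule topology_generated_by_Basis) blast

lemma self_in_local_nbhd: "x \<in> Gstar \<Longrightarrow> x \<in> local_nbhd n x"
  unfolding local_nbhd_def using Gstar_rep(1)[of x] rooted_iso_refl by blast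

lemma rooted_iso_ball:
  assumes "rooted_iso R R'" "rooted_connected_graph R" "rooted_connected_graph R'"
  shows "rooted_iso (graph_ball n R) (graph_ball n R')"
proof -
  obtain \<Gamma> x \<Delta> y where R: "R = (\<Gamma>, x)" "R' = (\<Delta>, y)" by (metis surj_pair)
  have "wf_lgraph \<Gamma>" "x \<in> verts \<Gamma>" "wf_lgraph \<Delta>"
    using rooted_connected_wf[of \<Gamma> x] rooted_connected_wf[of \<Delta> y] assms(2,3) unfolding R by simp_all
  then show ?thesis
    using rooted_iso_imp_ball_iso[OF assms(1)[unfolded R]] unfolding R rooted_iso_graph_ball by blast
qed

lemma looks_like_iff: "looks_like R x \<xi> \<longleftrightarrow> rooted_iso (graph_ball R (schreier \<xi>, \<xi>)) (graph_ball R (rep x))"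
  using rooted_iso_graph_ball[of R "schreier \<xi>" \<xi> "fst (rep x)" "snd (rep x)"] by (simp add: looks_like_def)

lemma looks_like_local_nbhd:
  assumes x: "x \<in> Gstar" and y: "y \<in> local_nbhd R x" and xi: "looks_like R x \<xi>"
  shows "looks_like R y \<xi>"
proof -
  obtain R1 R2 where R: "y \<in> Gstar" "R1 \<in> x" "R2 \<in> y" "rooted_iso (graph_ball R R1) (graph_ball R R2)"
    using y by (auto simp: local_nbhd_def)
  note xr = Gstar_rep[OF x] and yr = Gstar_rep[OF R(1)]
  have "rooted_iso (graph_ball R (rep x)) (graph_ball R R1)" using rooted_iso_ball xr R(2) by blast
  moreover have "rooted_iso R2 (rep y)"
    using yr(2) yr(3)[OF R(3)] rooted_iso_sym by (cases R2; cases "rep y") (auto simp: rooted_connected_graph_def)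
  then have "rooted_iso (graph_ball R R2) (graph_ball R (rep y))" using rooted_iso_ball yr R(3) by blast
  ultimately show ?thesis using xi R(4) unfolding looks_like_iff by (meson rooted_iso_trans)
qed

lemma rooted_connected_schreier: "rooted_connected_graph (schreier \<xi>, \<xi>)"
  unfolding rooted_connected_graph_def prod.case
proof (intro conjI ballI allI impI)
  show "edges (schreier \<xi>) \<subseteq> UNIV \<times> verts (schreier \<xi>) \<times> verts (schreier \<xi>)"
    using wf_schreier by (simp add: wf_lgraph_def)
  show "finite (emanating (schreier \<xi>) p)" if "p \<in> verts (schreier \<xi>)" for p
    using that by (simp add: emanating_schreier UNIV_gen)
  show "(p, q) \<in> (adjacency (schreier \<xi>))\<^sup>*" if "p \<in> verts (schreier \<xi>)" "q \<in> verts (schreier \<xi>)" for p q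
    using schreier_reachable that relpow_imp_rtrancl by (metis verts_schreier)
qed (auto simp: sact_in_orbit)

text \<open>Every basic neighbourhood of a point of the closure contains a Schreier class; the
  sequence \<xi> found in this way depends on R.\<close>

lemma looks_like_exists:
  assumes "x \<in> X"
  shows "\<exists>\<xi>. looks_like R x \<xi>"
proof -
  have x: "x \<in> Gstar" using assms X_subset_Gstar by blast
  have "x \<in> Gstar_topology closure_of range schreier_class" using assms X_subset_closure by (rule subsetD[rotated])
  then have "\<exists>y. y \<in> range schreier_class \<and> y \<in> local_nbhd R x"
    using openin_local_nbhd[OF x, of R] self_in_local_nbhd[OF x, of R] unfolding in_closure_of by metis
  then obtain \<xi> where "schreier_class \<xi> \<in> local_nbhd R x" by blast
  then obtain R1 R2 where R: "R1 \<in> x" "R2 \<in> schreier_class \<xi>" "rooted_iso (graph_ball R R1) (graph_ball R R2)"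
    by (auto simp: local_nbhd_def)
  have R2: "rooted_connected_graph R2" "rooted_iso (schreier \<xi>, \<xi>) R2"
    using R(2) by (auto simp: schreier_class_def iso_class_def)
  have "rooted_iso (graph_ball R (schreier \<xi>, \<xi>)) (graph_ball R R2)"
    using rooted_iso_ball[OF R2(2) rooted_connected_schreier R2(1)] .
  moreover have "rooted_iso (graph_ball R (rep x)) (graph_ball R R1)"
    using Gstar_rep[OF x] R(1) rooted_iso_ball by blast
  then have "rooted_iso (graph_ball R (rep x)) (graph_ball R R2)" using R(3) by (rule rooted_iso_trans)
  then have "rooted_iso (graph_ball R R2) (graph_ball R (rep x))"
  proof -
    assume iso: "rooted_iso (graph_ball R (rep x)) (graph_ball R R2)"
    obtain \<Gamma> p where \<Gamma>: "rep x = (\<Gamma>, p)" by fastforce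
    then have "p \<in> vball R \<Gamma> p"
      using Gstar_rep(2)[OF x] by (auto simp: vball_def rooted_connected_graph_def intro!: exI[of _ 0])
    then have "snd (graph_ball R (rep x)) \<in> verts (fst (graph_ball R (rep x)))"
      by (simp add: \<Gamma> graph_ball_def Let_def vball_def)
    with iso show ?thesis using rooted_iso_sym by (metis prod.collapse)
  qed
  ultimately show ?thesis unfolding looks_like_iff by (blast intro: rooted_iso_trans)
qed

text \<open>The condition depends only on the ball of radius R around the root, so it holds on a
  whole basic neighbourhood of each of its points.\<close>

lemma openin_looks_like: "openin (subtopology Gstar_topology X) {x \<in> X. \<exists>\<xi>\<in>S. looks_like R x \<xi>}"
proof (subst openin_subopen, intro ballI)
  fix x assume "x \<in> {x \<in> X. \<exists>\<xi>\<in>S. looks_like R x \<xi>}"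
  then obtain \<xi> where x: "x \<in> X" "\<xi> \<in> S" "looks_like R x \<xi>" by blast
  then have xG: "x \<in> Gstar" using X_subset_Gstar by blast
  have "openin (subtopology Gstar_topology X) (local_nbhd R x \<inter> X)"
    using openin_local_nbhd[OF xG] by (auto simp: openin_subtopology)
  moreover have "x \<in> local_nbhd R x \<inter> X" using self_in_local_nbhd[OF xG] x by blast
  moreover have "local_nbhd R x \<inter> X \<subseteq> {x \<in> X. \<exists>\<xi>\<in>S. looks_like R x \<xi>}"
    using looks_like_local_nbhd[OF xG _ x(3)] x(2) by blast
  ultimately show "\<exists>T. openin (subtopology Gstar_topology X) T \<and> x \<in> T \<and> T \<subseteq> {x \<in> X. \<exists>\<xi>\<in>S. looks_like R x \<xi>}"
    by blast
qed

lemma coding_cylinder_sets: "{x \<in> X. \<forall>i<N. coding x i = w i} \<in> sets X_borel"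
proof -
  have eq: "{x \<in> X. \<forall>i<N. coding x i = w i} = {x \<in> X. \<exists>\<xi>\<in>{\<xi>. \<forall>i<N. \<xi> i = w i}. looks_like (coding_radius N) x \<xi>}"
    (is "?A = ?B")
  proof (intro Set.set_eqI iffI)
    fix x assume x: "x \<in> ?A"
    then obtain \<xi> where xi: "looks_like (coding_radius N) x \<xi>" using looks_like_exists by blast
    then have "\<forall>i<N. coding x i = \<xi> i" using coding_prefix[OF xi order_refl] x X_subset_Gstar by blast
    then show "x \<in> ?B" using x xi by auto
  next
    fix x assume "x \<in> ?B"
    then obtain \<xi> where x: "x \<in> X" "\<forall>i<N. \<xi> i = w i" and xi: "looks_like (coding_radius N) x \<xi>" by blast
    then have "\<forall>i<N. coding x i = \<xi> i" using coding_prefix[OF xi order_refl] X_subset_Gstar by blast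
    then show "x \<in> ?A" using x by simp
  qed
  have "{U. openin (subtopology Gstar_topology X) U} \<subseteq> Pow X"
    using openin_subset[of "subtopology Gstar_topology X"] by (auto simp: topspace_subtopology)
  then have sets: "sets X_borel = sigma_sets X {U. openin (subtopology Gstar_topology X) U}"
    unfolding X_borel_def by (rule sets_measure_of)
  show ?thesis unfolding eq sets
    by (rule sigma_sets.Basic) (use openin_looks_like in blast)
qed

text \<open>One unit of radius pays for the change of root. The matching ball provides a unique edge
  labelled s at the root, so the definite description in \<open>move_root\<close> denotes its
  endpoint.\<close>

lemma looks_like_move_root:
  assumes x: "x \<in> Gstar" and xi: "looks_like (Suc R) x \<xi>"
  shows "move_root s x \<in> Gstar" "looks_like R (move_root s x) (sact s \<xi>)"
proof -
  obtain \<Gamma> p where \<Gamma>: "rep x = (\<Gamma>, p)" by fastforce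
  have conn: "rooted_connected_graph (\<Gamma>, p)" using Gstar_rep(2)[OF x] \<Gamma> by simp
  have wf: "wf_lgraph \<Gamma>" "p \<in> verts \<Gamma>" using rooted_connected_wf[OF conn] by auto
  obtain f where f: "ball_iso (Suc R) f (schreier \<xi>) \<xi> \<Gamma> p" using xi \<Gamma> by (auto simp: looks_like_def)
  have fp: "f \<xi> = p" using f by (simp add: ball_iso_def)
  define q where "q = f (sact s \<xi>)"
  have "emanating \<Gamma> p = (\<lambda>(s, q). (s, f q)) ` range (\<lambda>s. (s, sact s \<xi>))"
    using ball_iso_emanating[OF f wf_schreier wf(1) _ relpow_0_I] emanating_schreier[of \<xi> \<xi>] fp by simp
  then have edge: "(s, p, q') \<in> edges \<Gamma> \<longleftrightarrow> q' = q" for q'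
    unfolding q_def by (auto simp: emanating_def set_eq_iff)
  then have mv: "move_root s x = iso_class (\<Gamma>, q)" by (simp add: move_root_def \<Gamma>)
  have "(s, p, q) \<in> edges \<Gamma>" using edge by simp
  then have "q \<in> verts \<Gamma>" using wf by (auto simp: wf_lgraph_def)
  then have conn_q: "rooted_connected_graph (\<Gamma>, q)" using conn by (simp add: rooted_connected_graph_def)
  then show G: "move_root s x \<in> Gstar" using mv by (auto simp: Gstar_def)
  have "(\<xi>, sact s \<xi>) \<in> adjacency (schreier \<xi>) ^^ 1" by (auto simp: adjacency_def)
  from ball_iso_restrict[OF f wf_schreier wf(1) _ this, of R]
  have f': "ball_iso R f (schreier (sact s \<xi>)) (sact s \<xi>) \<Gamma> q"
    using schreier_cong[of "sact s \<xi>" \<xi>] by (simp add: q_def sact_in_orbit)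
  obtain \<Delta> y where \<Delta>: "rep (move_root s x) = (\<Delta>, y)" by fastforce
  have "rooted_iso (\<Gamma>, q) (\<Delta>, y)" using Gstar_rep(1)[OF G] \<Delta> mv by (simp add: iso_class_def)
  moreover have "wf_lgraph \<Delta>" using Gstar_rep(2)[OF G] \<Delta> rooted_connected_wf by metis
  ultimately obtain g where g: "ball_iso R g \<Gamma> q \<Delta> y"
    using rooted_iso_imp_ball_iso wf(1) \<open>q \<in> verts \<Gamma>\<close> by metis
  then show "looks_like R (move_root s x) (sact s \<xi>)"
    unfolding looks_like_def \<Delta> fst_conv snd_conv using ball_iso_comp[OF f' g] by blast
qed

section \<open>Equivariance and invariant measures\<close>

lemma coding_move_root:
  assumes "x \<in> X"
  shows "coding (move_root s x) = sact s (coding x)"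
proof
  fix i
  have x: "x \<in> Gstar" using assms X_subset_Gstar by blast
  let ?R = "coding_radius (Suc i)"
  obtain \<xi> where xi: "looks_like (Suc ?R) x \<xi>" using looks_like_exists[OF assms] by blast
  note mv = looks_like_move_root[OF x xi, of s]
  have "coding (move_root s x) i = sact s \<xi> i" by (rule coding_prefix[OF mv(2) order_refl mv(1) lessI])
  also have "\<forall>k<Suc i. \<xi> k = coding x k" using coding_prefix[OF xi _ x, of "Suc i"] by simp
  then have "sact s \<xi> i = sact s (coding x) i" by (rule sact_prefix_cong) simp
  finally show "coding (move_root s x) i = sact s (coding x) i" .
qed

text \<open>In Gray order a single generator maps each cylinder of level N onto the next. By
  equivariance and invariance all \<open>2 ^ N\<close> of them have equal measure, and they
  partition the space.\<close>

lemma invariant_cylinder: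
  assumes inv: "invariant_probability \<nu>"
  shows "measure \<nu> {x \<in> space \<nu>. \<forall>i<N. coding x i = w i} = 1 / 2 ^ N"
proof -
  interpret prob_space \<nu> using inv by (simp add: invariant_probability_def)
  have sp: "space \<nu> = X" and st: "sets \<nu> = sets X_borel"
    and ms: "\<And>s. move_root s \<in> measurable \<nu> \<nu>" and ds: "\<And>s. distr \<nu> \<nu> (move_root s) = \<nu>"
    using inv by (auto simp: invariant_probability_def)
  define C where "C = (\<lambda>j. {x \<in> X. \<forall>i<N. coding x i = gray j i})"
  have C_sets: "C j \<in> sets \<nu>" for j unfolding C_def st by (rule coding_cylinder_sets)
  have C_iff: "x \<in> C j \<longleftrightarrow> x \<in> X \<and> coding x = gpath N (coding x) j" for x j
    by (auto simp: C_def gpath_def fun_eq_iff)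
  have step: "prob (C (j + 1)) = prob (C j)" if j: "0 \<le> j" "j + 1 < 2 ^ N" for j
  proof -
    obtain s where s: "\<And>\<zeta>. sact s (gpath N \<zeta> j) = gpath N \<zeta> (j + 1)" using gpath_edge[OF j] by blast
    then have s': "sact s (gpath N \<zeta> (j + 1)) = gpath N \<zeta> j" for \<zeta> by (metis sact_sact)
    \<comment> \<open>Overwriting the first N letters twice is the same as once, so membership in a
      cylinder can be written as being fixed by \<open>gpath N\<close> at its position.\<close>
    have gp: "gpath N \<zeta> k = gpath N (gpath N \<zeta> k') k" for \<zeta> k k' by (auto simp: gpath_def fun_eq_iff)
    have "move_root s -` C (j + 1) \<inter> space \<nu> = C j"
    proof (intro Set.set_eqI)
      fix x
      show "x \<in> move_root s -` C (j + 1) \<inter> space \<nu> \<longleftrightarrow> x \<in> C j"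
      proof (cases "x \<in> X")
        case True
        then have "move_root s x \<in> X" using measurable_space[OF ms] sp by blast
        then have "x \<in> move_root s -` C (j + 1) \<inter> space \<nu> \<longleftrightarrow>
            sact s (coding x) = gpath N (sact s (coding x)) (j + 1)"
          using True sp by (simp add: C_iff coding_move_root)
        also have "\<dots> \<longleftrightarrow> coding x = gpath N (coding x) j"
          using s s' gp by (metis sact_sact)
        finally show ?thesis using True by (simp add: C_iff)
      qed (simp add: C_def sp)
    qed
    then show ?thesis using measure_distr[OF ms C_sets] ds by metis
  qed
  have eq: "prob (C (int k)) = prob (C 0)" if "k < 2 ^ N" for k
    using that
  proof (induction k)
    case (Suc k)
    then have "int k + 1 < 2 ^ N" by (metis of_nat_Suc add.commute of_nat_less_iff of_nat_numeral of_nat_power)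
    then have "prob (C (int k + 1)) = prob (C (int k))" by (intro step) auto
    with Suc show ?case by (simp add: add.commute)
  qed simp
  have disj: "disjoint_family_on (\<lambda>k. C (int k)) {..<2 ^ N}"
    unfolding disjoint_family_on_def
  proof (intro ballI impI)
    fix k k' :: nat assume k: "k \<in> {..<2 ^ N}" "k' \<in> {..<2 ^ N}" "k \<noteq> k'"
    show "C (int k) \<inter> C (int k') = {}"
    proof (rule ccontr)
      assume "C (int k) \<inter> C (int k') \<noteq> {}"
      then have "\<forall>i<N. gray (int k) i = gray (int k') i" by (auto simp: C_def)
      moreover have "int k < 2 ^ N" "int k' < 2 ^ N"
        using k by (metis lessThan_iff of_nat_less_iff of_nat_numeral of_nat_power)+
      ultimately have "int k = int k'" by (intro gray_inj) auto
      with k show False by simp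
    qed
  qed
  have cover: "(\<Union>k\<in>{..<2 ^ N}. C (int k)) = space \<nu>"
  proof (intro antisym subsetI)
    fix x assume x: "x \<in> space \<nu>"
    obtain j where j: "0 \<le> j" "j < 2 ^ N" "\<forall>i<N. gray j i = coding x i" using gray_surj by blast
    then have "x \<in> C (int (nat j))" "nat j < 2 ^ N" using x sp by (auto simp: C_def nat_less_iff)
    then show "x \<in> (\<Union>k\<in>{..<2 ^ N}. C (int k))" by blast
  qed (auto simp: C_def sp)
  have "1 = prob (\<Union>k\<in>{..<2 ^ N}. C (int k))" unfolding cover by (simp add: prob_space)
  also have "\<dots> = (\<Sum>k<2 ^ N. prob (C (int k)))"
    using C_sets disj by (intro finite_measure_finite_Union) auto
  also have "\<dots> = 2 ^ N * prob (C 0)" using eq by simp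
  finally have C0: "prob (C 0) = 1 / 2 ^ N" by (simp add: field_simps)
  obtain j where j: "0 \<le> j" "j < 2 ^ N" "\<forall>i<N. gray j i = w i" using gray_surj by blast
  then have "{x \<in> space \<nu>. \<forall>i<N. coding x i = w i} = C (int (nat j))" by (simp add: C_def sp)
  moreover have "nat j < 2 ^ N" using j by (simp add: nat_less_iff)
  ultimately show ?thesis using eq[of "nat j"] C0 by simp
qed

lemma wact_prefix_cong:
  assumes "\<forall>i<N. \<xi> i = \<eta> i"
  shows "\<forall>i<N. wact l \<xi> i = wact l \<eta> i"
  using assms sact_prefix_cong by (induction l) simp_all

lemma X_no_eigenvalues:
  assumes params: "(t, u, v, w) \<in> params" and x: "x \<in> X"
    and pat: "\<forall>m. \<exists>n\<ge>m. pattern n (coding x)"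
  shows "\<not> laplacian_has_eigenvalues (fst (rep x)) t u v w"
proof -
  obtain \<Gamma> p where \<Gamma>: "rep x = (\<Gamma>, p)" by fastforce
  have xG: "x \<in> Gstar" using x X_subset_Gstar by blast
  have conn: "rooted_connected_graph (\<Gamma>, p)" using Gstar_rep(2)[OF xG] \<Gamma> by simp
  have wf: "wf_lgraph \<Gamma>" "p \<in> verts \<Gamma>" using rooted_connected_wf[OF conn] by auto
  have "rich \<Gamma> q" if q: "q \<in> verts \<Gamma>" for q
  proof (rule rich_if_patterns[OF wf(1)])
    fix m
    obtain d where d: "(p, q) \<in> adjacency \<Gamma> ^^ d" using rooted_connected_reach[OF conn wf(2) q] by blast
    \<comment> \<open>The walk from the root to q is a word that depends on the approximating
      Schreier graph, and this graph is chosen only after n. The bound K must therefore be uniform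
      over all words of length d.\<close>
    have "\<forall>l. \<exists>K. \<forall>i\<ge>K. wact l (coding x) i = coding x i" by (rule allI) (rule wact_finite_change)
    then obtain k where k: "\<forall>l. \<forall>i\<ge>k l. wact l (coding x) i = coding x i" by (rule choice[THEN exE])
    let ?D = "{l :: gen list. length l = d}"
    have finD: "finite ?D"
    proof -
      have "finite (UNIV :: gen set)" by (simp add: UNIV_gen)
      from finite_lists_length_eq[OF this, of d] show ?thesis by simp
    qed
    define K where "K = Max (k ` ?D)"
    have K: "wact l (coding x) i = coding x i" if "length l = d" "i \<ge> K" for l i
    proof -
      have "k l \<le> K" unfolding K_def using finD that(1) by (intro Max_ge) auto
      then show ?thesis using k that(2) by simp
    qed
    obtain n where n: "n \<ge> max m K" "pattern n (coding x)" using pat by blast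
    \<comment> \<open>The first summand fixes the letters up to the end of the pattern, d pays for
      moving the root to q, and \<open>4 * 2 ^ n\<close> remains as the radius of the ball around
      q.\<close>
    let ?R = "coding_radius (n + 4) + 4 * 2 ^ n + d"
    obtain \<xi> where xi: "looks_like ?R x \<xi>" using looks_like_exists[OF x] by blast
    then obtain f where f: "ball_iso ?R f (schreier \<xi>) \<xi> \<Gamma> p" by (auto simp: looks_like_def \<Gamma>)
    have root: "\<xi> \<in> verts (schreier \<xi>)" by simp
    obtain g where g: "ball_iso ?R g \<Gamma> p (schreier \<xi>) \<xi>"
      and fg: "\<And>r. r \<in> vball ?R \<Gamma> p \<Longrightarrow> f (g r) = r"
      using ball_iso_sym[OF f root] by metis
    have fgq: "f (g q) = q" using fg in_vball[OF wf d] by simp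
    have gq: "(\<xi>, g q) \<in> adjacency (schreier \<xi>) ^^ d" using ball_iso_dist[OF g wf d] by simp
    then obtain l where l: "length l = d" "g q = wact l \<xi>" using relpow_schreier[of \<xi> \<xi>] by auto
    have "ball_iso (4 * 2 ^ n) f (schreier \<xi>) (g q) \<Gamma> q"
      using ball_iso_restrict[OF f wf_schreier wf(1) root gq, of "4 * 2 ^ n"] fgq by simp
    moreover have "schreier (g q) = schreier \<xi>" using l(2) by (simp add: schreier_cong wact_in_orbit)
    moreover have "pattern n (g q)"
    proof -
      have "\<forall>i<n + 4. \<xi> i = coding x i" using coding_prefix[OF xi _ xG, of "n + 4"] by simp
      then have "\<forall>i<n + 4. g q i = wact l (coding x) i" using wact_prefix_cong l(2) by simp
      then have "g q i = coding x i" if "n \<le> i" "i < n + 4" for i using K[OF l(1)] n(1) that by simp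
      with n(2) show ?thesis by (simp add: pattern_def)
    qed
    ultimately show "\<exists>n\<ge>m. \<exists>\<eta> f. pattern n \<eta> \<and> ball_iso (4 * 2 ^ n) f (schreier \<eta>) \<eta> \<Gamma> q"
      using n(1) by (metis max.bounded_iff)
  qed
  then show ?thesis unfolding \<Gamma> fst_conv
    using params rooted_connected_reach[OF conn] by (intro no_eigenvalues_if_rich)
qed

lemma AE_invariant_patterns:
  assumes "invariant_probability \<nu>"
  shows "AE x in \<nu>. \<forall>m. \<exists>n\<ge>m. pattern n (coding x)"
proof (rule AE_patterns)
  have sp: "space \<nu> = X" and st: "sets \<nu> = sets X_borel"
    using assms by (auto simp: invariant_probability_def)
  show "prob_space \<nu>" using assms by (simp add: invariant_probability_def)
  show "{x \<in> space \<nu>. \<forall>i<N. coding x i = w i} \<in> sets \<nu>" for N w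
    unfolding sp st by (rule coding_cylinder_sets)
  show "measure \<nu> {x \<in> space \<nu>. \<forall>i<N. coding x i = w i} = 1 / 2 ^ N" for N w
    by (rule invariant_cylinder[OF assms])
qed

theorem theorem4p6:
  fixes t u v w :: real
  assumes "(t, u, v, w) \<in> params"
    and "\<not> (u = v \<and> v = w)"
  shows "(\<forall>\<nu>. invariant_probability \<nu> \<longrightarrow>
            (AE x in \<nu>. \<not> laplacian_has_eigenvalues (fst (rep x)) t u v w))
       \<and> (AE \<xi> in bernoulli_measure. \<not> laplacian_has_eigenvalues (schreier \<xi>) t u v w)
       \<and> (\<forall>x\<in>X1. \<not> laplacian_has_eigenvalues (fst (rep x)) t u v w)"
proof (intro conjI allI impI ballI)
  fix \<nu> assume inv: "invariant_probability \<nu>"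
  then have "space \<nu> = X" by (simp add: invariant_probability_def)
  then show "AE x in \<nu>. \<not> laplacian_has_eigenvalues (fst (rep x)) t u v w"
    using AE_invariant_patterns[OF inv] AE_space X_no_eigenvalues[OF assms(1)]
    by (auto elim: AE_mp)
next
  show "AE \<xi> in bernoulli_measure. \<not> laplacian_has_eigenvalues (schreier \<xi>) t u v w"
    using AE_bernoulli_patterns by eventually_elim (rule schreier_no_eigenvalues[OF assms(1)])
next
  show "\<not> laplacian_has_eigenvalues (fst (rep x)) t u v w" if "x \<in> X1" for x
    using X1_no_eigenvalues[OF assms(1) that] .
qed

end
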